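(* Let $D$ and $D'$ be bounded finitely connected domains in $\mathbb{C}$, let $Q:\mathbb{C}\to(0,\infty)$ be a measurable function, and let $f:D\to D'$ be a lower $Q$-homeomorphism. Suppose that for every $z_0\in\partial D$ there is $\varepsilon_0=\varepsilon(z_0)>0$ such that $$\int_{\varepsilon<|z-z_0|<\varepsilon_0}Q(z)\,\frac{dm(z)}{|z-z_0|^2}=o\left(\left[\log\frac1\varepsilon\right]^2\right)\quad\text{as }\varepsilon\to0 .$$ Then $f$ can be extended to a homeomorphism of $\overline{D}_P$ onto $\overline{D'}_P$.
   Context: Notation: $S(z_0,r)=\{z\in\mathbb{C}:|z-z_0|=r\}$; $dm$ is Lebesgue measure in $\mathbb{C}$. Prime ends. For a bounded finitely connected domain $D\subset\mathbb{C}$, $\overline{D}_P$ is the completion of $D$ by its Carathéodory prime ends with the topology of prime ends, described as follows. There is a conformal mapping $g_0$ of $D$ onto a bounded circular domain $D_0$ (a domain whose boundary consists of finitely many mutually disjoint circles and isolated points), prime ends of $D$ are in natural one-to-one correspondence with points of $\partial D_0$, and so $g_0$ extends to a bijection $\widetilde{g_0}:\overline{D}_P\to\overline{D_0}$. The topology of $\overline{D}_P$ is induced by the metric $\rho_0(p_1,p_2)=|\widetilde{g_0}(p_1)-\widetilde{g_0}(p_2)|$ (so $\overline{D}_P$ is the metric completion of $D$ with respect to $|g_0(z)-g_0(w)|$); it does not depend on the choice of $g_0$. Continuity of maps between $\overline{D}_P$ and $\overline{D'}_P$ refers to these topologies. Modulus. A dashed line is a continuous mapping $\gamma$ of an open subset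 of $\mathbb{R}$ or of a circle into the plane. For a family $\Gamma$ of dashed lines, a Borel function $\varrho:\mathbb{C}\to[0,\infty]$ is admissible, $\varrho\in\mathrm{adm}\,\Gamma$, if $\int_\gamma\varrho\,ds\ge 1$ for every $\gamma\in\Gamma$ (integration with respect to length, i.e. one-dimensional Hausdorff measure counted with multiplicity). The modulus is $M(\Gamma)=\inf_{\varrho\in\mathrm{adm}\,\Gamma}\int_{\mathbb{C}}\varrho^2\,dm$. A property holds for a.e. $\gamma\in\Gamma$ if the subfamily where it fails has modulus zero. A Lebesgue measurable $\varrho:\mathbb{C}\to[0,\infty]$ is extensively admissible, $\varrho\in\mathrm{ext\,adm}\,\Gamma$, if $\int_\gamma\varrho\,ds\ge1$ for a.e. $\gamma\in\Gamma$. Lower $Q$-homeomorphism. For bounded domains $D,D'\subset\mathbb{C}$, $z_0\in\overline{D}$ and measurable $Q:\mathbb{C}\to(0,\infty)$, a homeomorphism $f$ of $D$ onto $D'$ is a lower $Q$-homeomorphism at $z_0$ if, with $d_0=\sup_{z\in D}|z-z_0|$, for all $\varepsilon_0\in(0,d_0)$ and $\varepsilon\in(0,\varepsilon_0)$, $$M(f\Sigma_\varepsilon)\ \ge\ \inf_{\varrho\in\mathrm{ext\,adm}\,\Sigma_\varepsilon}\int_{D\cap R_\varepsilon}\frac{\varrho^2(z)}{Q(z)}\,dm(z),$$ where $R_\varepsilon=\{z:\varepsilon<|z-z_0|<\varepsilon_0\}$ and $\Sigma_\varepsilon$ is the family of all intersections $D\cap S(z_0,r)$, $r\in(\varepsilon,\varepsilon_0)$.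 $f$ is a lower $Q$-homeomorphism if this holds at every $z_0\in\overline{D}$. *)

theory Defs
  imports "HOL-Complex_Analysis.Complex_Analysis" "HOL-Library.Landau_Symbols"
begin

section \<open>One-dimensional Hausdorff measure\<close>

definition hausdorff1_premeasure :: "real \<Rightarrow> complex set \<Rightarrow> ennreal" where
  "hausdorff1_premeasure \<delta> A =
     (INF U \<in> {U :: nat \<Rightarrow> complex set.
                 A \<subseteq> (\<Union>i. U i) \<and> (\<forall>i. bounded (U i) \<and> diameter (U i) \<le> \<delta>)}.
        \<Sum>i. ennreal (diameter (U i)))"

definition hausdorff1_outer :: "complex set \<Rightarrow> ennreal" where
  "hausdorff1_outer A = (SUP \<delta> \<in> {0<..}. hausdorff1_premeasure \<delta> A)"

text \<open>The measure lives on all sets that are measurable in the sense of Caratheodory; in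
  particular it is complete.\<close>

definition hausdorff1 :: "complex measure" where
  "hausdorff1 = measure_of UNIV (lambda_system UNIV UNIV hausdorff1_outer) hausdorff1_outer"

lemma hausdorff1_premeasure_mono:
  "A \<subseteq> B \<Longrightarrow> hausdorff1_premeasure \<delta> A \<le> hausdorff1_premeasure \<delta> B"
  unfolding hausdorff1_premeasure_def by (rule INF_superset_mono) auto

lemma hausdorff1_premeasure_UN:
  "hausdorff1_premeasure \<delta> (\<Union>n. A n) \<le> (\<Sum>n. hausdorff1_premeasure \<delta> (A n))"
proof (rule ennreal_le_epsilon)
  fix e :: real
  assume "0 < e" and fin: "(\<Sum>n. hausdorff1_premeasure \<delta> (A n)) < top"
  define C where "C B = {U :: nat \<Rightarrow> complex set.
    B \<subseteq> (\<Union>i. U i) \<and> (\<forall>i. bounded (U i) \<and> diameter (U i) \<le> \<delta>)}" for B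
  have pre: "hausdorff1_premeasure \<delta> B = (INF U\<in>C B. \<Sum>i. ennreal (diameter (U i)))" for B
    unfolding hausdorff1_premeasure_def C_def ..
  have "\<exists>U\<in>C (A n). (\<Sum>i. ennreal (diameter (U i)))
          \<le> hausdorff1_premeasure \<delta> (A n) + ennreal (e * (1/2) ^ Suc n)" for n
  proof -
    have "hausdorff1_premeasure \<delta> (A n) \<noteq> top"
      using ennreal_suminf_lessD[OF fin, of n] by simp
    hence "hausdorff1_premeasure \<delta> (A n)
             < hausdorff1_premeasure \<delta> (A n) + ennreal (e * (1/2) ^ Suc n)"
      using \<open>0 < e\<close> by (simp add: ennreal_add_left_cancel_less[of _ 0, simplified])
    then show ?thesis
      unfolding pre[of "A n"] INF_less_iff by (auto intro: less_imp_le)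
  qed
  then obtain U where U: "\<And>n. U n \<in> C (A n)"
    and le: "\<And>n. (\<Sum>i. ennreal (diameter (U n i)))
               \<le> hausdorff1_premeasure \<delta> (A n) + ennreal (e * (1/2) ^ Suc n)"
    by metis
  define V where "V k = (case prod_decode k of (n, i) \<Rightarrow> U n i)" for k
  have "(\<Union>n. A n) \<subseteq> (\<Union>k. V k)"
  proof
    fix x assume "x \<in> (\<Union>n. A n)"
    then obtain n i where "x \<in> U n i" using U by (fastforce simp: C_def)
    then have "x \<in> V (prod_encode (n, i))" by (simp add: V_def)
    then show "x \<in> (\<Union>k. V k)" by blast
  qed
  moreover have "bounded (V k) \<and> diameter (V k) \<le> \<delta>" for k
    using U by (auto simp: V_def C_def split: prod.split)
  ultimately have "V \<in> C (\<Union>n. A n)" by (simp add: C_def)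
  then have "hausdorff1_premeasure \<delta> (\<Union>n. A n) \<le> (\<Sum>k. ennreal (diameter (V k)))"
    unfolding pre by (rule INF_lower)
  also have "\<dots> = (\<Sum>k. (\<lambda>p. ennreal (diameter (U (fst p) (snd p)))) (prod_decode k))"
    by (simp add: V_def case_prod_beta)
  also have "\<dots> = (\<Sum>n. \<Sum>i. ennreal (diameter (U n i)))"
    by (rule suminf_ennreal_2dimen) simp
  also have "\<dots> \<le> (\<Sum>n. hausdorff1_premeasure \<delta> (A n) + ennreal (e * (1/2) ^ Suc n))"
    by (intro suminf_le le) auto
  also have "\<dots> = (\<Sum>n. hausdorff1_premeasure \<delta> (A n)) + (\<Sum>n. ennreal (e * (1/2) ^ Suc n))"
    by (rule suminf_add[symmetric]) auto
  also have "(\<Sum>n. ennreal (e * (1/2) ^ Suc n)) = ennreal e"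
    using \<open>0 < e\<close> sums_mult[OF power_half_series, of e]
    by (intro suminf_ennreal_eq) auto
  finally show "hausdorff1_premeasure \<delta> (\<Union>n. A n)
      \<le> (\<Sum>n. hausdorff1_premeasure \<delta> (A n)) + ennreal e" .
qed

lemma outer_measure_space_hausdorff1: "outer_measure_space UNIV hausdorff1_outer"
  unfolding outer_measure_space_def
proof (intro conjI)
  have "hausdorff1_premeasure \<delta> {} = 0" if "\<delta> > 0" for \<delta>
    unfolding hausdorff1_premeasure_def using that
    by (intro antisym INF_lower2[of "\<lambda>_. {}"]) auto
  then show "positive UNIV hausdorff1_outer"
    by (simp add: positive_def hausdorff1_outer_def)
  show "increasing UNIV hausdorff1_outer"
    unfolding increasing_def hausdorff1_outer_def
    by (auto intro!: SUP_mono' hausdorff1_premeasure_mono)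
  show "countably_subadditive UNIV hausdorff1_outer"
    unfolding countably_subadditive_def
  proof (intro allI impI)
    fix A :: "nat \<Rightarrow> complex set"
    have "hausdorff1_premeasure \<delta> (\<Union>n. A n) \<le> (\<Sum>n. hausdorff1_outer (A n))"
      if "\<delta> > 0" for \<delta>
      by (rule order_trans[OF hausdorff1_premeasure_UN], intro suminf_le)
         (use that in \<open>auto simp: hausdorff1_outer_def intro: SUP_upper\<close>)
    then show "hausdorff1_outer (\<Union>n. A n) \<le> (\<Sum>n. hausdorff1_outer (A n))"
      unfolding hausdorff1_outer_def[of "\<Union>n. A n"] by (auto intro: SUP_least)
  qed
qed

lemma measure_space_hausdorff1:
  "measure_space UNIV (lambda_system UNIV UNIV hausdorff1_outer) hausdorff1_outer"
  using sigma_algebra.caratheodory_lemma[OF sigma_algebra_Pow, of UNIV]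
    outer_measure_space_hausdorff1 by (simp add: Pow_UNIV)

lemma emeasure_hausdorff1:
  "A \<in> sets hausdorff1 \<Longrightarrow> emeasure hausdorff1 A = hausdorff1_outer A"
proof -
  interpret L: sigma_algebra UNIV "lambda_system UNIV UNIV hausdorff1_outer"
    using measure_space_hausdorff1 by (simp add: measure_space_def)
  assume "A \<in> sets hausdorff1"
  then show ?thesis
    using measure_space_hausdorff1 unfolding hausdorff1_def measure_space_def
    by (intro emeasure_measure_of_sigma) auto
qed


section \<open>Dashed lines and modulus\<close>

text \<open>A dashed line is encoded as a pair of its parameter set, a relatively open subset of the
  real axis or of a circle in the complex plane, and the map on it.\<close>

type_synonym curve = "complex set \<times> (complex \<Rightarrow> complex)"

definition dashed_line :: "curve \<Rightarrow> bool" where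
  "dashed_line = (\<lambda>(\<Delta>, \<gamma>).
     (openin (top_of_set \<real>) \<Delta> \<or> (\<exists>a r. r > 0 \<and> openin (top_of_set (sphere a r)) \<Delta>))
     \<and> continuous_on \<Delta> \<gamma>)"

definition multiplicity_at :: "curve \<Rightarrow> complex \<Rightarrow> ennreal" where
  "multiplicity_at = (\<lambda>(\<Delta>, \<gamma>) w. emeasure (count_space UNIV) {t \<in> \<Delta>. \<gamma> t = w})"

definition line_integral :: "curve \<Rightarrow> (complex \<Rightarrow> ennreal) \<Rightarrow> ennreal" where
  "line_integral c \<rho> = (\<integral>\<^sup>+w. \<rho> w * multiplicity_at c w \<partial>hausdorff1)"

definition admissible :: "curve set \<Rightarrow> (complex \<Rightarrow> ennreal) set" where
  "admissible \<Gamma> = {\<rho> \<in> borel_measurable borel. \<forall>c\<in>\<Gamma>. 1 \<le> line_integral c \<rho>}"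

definition modulus :: "curve set \<Rightarrow> ennreal" where
  "modulus \<Gamma> = (INF \<rho> \<in> admissible \<Gamma>. \<integral>\<^sup>+z. (\<rho> z)\<^sup>2 \<partial>lborel)"

text \<open>A Lebesgue measurable density agrees with a Borel one off a Borel null set, and almost
  every curve meets that null set in length zero; so for almost every curve the integral below
  is that of a measurable function.\<close>

definition ext_admissible :: "curve set \<Rightarrow> (complex \<Rightarrow> ennreal) set" where
  "ext_admissible \<Gamma> =
     {\<rho> \<in> borel_measurable lebesgue. modulus {c \<in> \<Gamma>. \<not> 1 \<le> line_integral c \<rho>} = 0}"


section \<open>Lower Q-homeomorphisms\<close>

definition annulus :: "complex \<Rightarrow> real \<Rightarrow> real \<Rightarrow> complex set" where
  "annulus z0 a b = {z. a < cmod (z - z0) \<and> cmod (z - z0) < b}"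

definition circle_sections :: "complex set \<Rightarrow> complex \<Rightarrow> real \<Rightarrow> real \<Rightarrow> curve set" where
  "circle_sections D z0 a b = (\<lambda>r. (D \<inter> sphere z0 r, \<lambda>z. z)) ` {a<..<b}"

definition image_family :: "(complex \<Rightarrow> complex) \<Rightarrow> curve set \<Rightarrow> curve set" where
  "image_family f \<Gamma> = (\<lambda>(\<Delta>, \<gamma>). (\<Delta>, f \<circ> \<gamma>)) ` \<Gamma>"

lemma dashed_line_sections:
  assumes "open D" "0 \<le> a" "continuous_on D f"
    and "c \<in> circle_sections D z0 a b \<union> image_family f (circle_sections D z0 a b)"
  shows "dashed_line c"
proof -
  have "openin (top_of_set (sphere z0 r)) (D \<inter> sphere z0 r)" for r
    using assms(1) by (metis Int_commute openin_open_Int)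
  moreover have "continuous_on (D \<inter> S) f" for S
    using assms(3) by (rule continuous_on_subset) auto
  moreover have "\<exists>r. a < r \<and> (c = (D \<inter> sphere z0 r, \<lambda>z. z) \<or> c = (D \<inter> sphere z0 r, f \<circ> (\<lambda>z. z)))"
    using assms(4) unfolding circle_sections_def image_family_def image_image case_prod_conv
    by (elim UnE imageE) auto
  then obtain r where "a < r" and
    "c = (D \<inter> sphere z0 r, \<lambda>z. z) \<or> c = (D \<inter> sphere z0 r, f \<circ> (\<lambda>z. z))"
    by blast
  moreover have "r > 0"
    using assms(2) \<open>a < r\<close> by linarith
  ultimately show ?thesis
    unfolding dashed_line_def by (elim disjE) (auto simp: o_def)
qed

definition lower_Q_homeomorphism_at ::
  "(complex \<Rightarrow> real) \<Rightarrow> complex set \<Rightarrow> complex set \<Rightarrow> (complex \<Rightarrow> complex) \<Rightarrow> complex \<Rightarrow> bool" where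
  "lower_Q_homeomorphism_at Q D D' f z0 \<longleftrightarrow>
     (\<exists>g. homeomorphism D D' f g) \<and>
     (\<forall>\<epsilon>0 \<epsilon>. 0 < \<epsilon>0 \<and> \<epsilon>0 < (SUP z\<in>D. cmod (z - z0)) \<and> 0 < \<epsilon> \<and> \<epsilon> < \<epsilon>0 \<longrightarrow>
        modulus (image_family f (circle_sections D z0 \<epsilon> \<epsilon>0)) \<ge>
        (INF \<rho> \<in> ext_admissible (circle_sections D z0 \<epsilon> \<epsilon>0).
           \<integral>\<^sup>+z \<in> D \<inter> annulus z0 \<epsilon> \<epsilon>0. (\<rho> z)\<^sup>2 / ennreal (Q z) \<partial>lebesgue))"

definition lower_Q_homeomorphism ::
  "(complex \<Rightarrow> real) \<Rightarrow> complex set \<Rightarrow> complex set \<Rightarrow> (complex \<Rightarrow> complex) \<Rightarrow> bool" where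
  "lower_Q_homeomorphism Q D D' f \<longleftrightarrow>
     (\<forall>z0 \<in> closure D. lower_Q_homeomorphism_at Q D D' f z0)"


section \<open>Completion by prime ends\<close>

text \<open>For a bounded set the components of the complement in the plane correspond to those of the
  complement in the sphere.\<close>

definition bounded_finitely_connected_domain :: "complex set \<Rightarrow> bool" where
  "bounded_finitely_connected_domain D \<longleftrightarrow>
     open D \<and> connected D \<and> D \<noteq> {} \<and> bounded D \<and> finite (components (- D))"

text \<open>Isolated boundary points appear as circles of radius zero.\<close>

definition bounded_circular_domain :: "complex set \<Rightarrow> bool" where
  "bounded_circular_domain D \<longleftrightarrow>
     open D \<and> connected D \<and> D \<noteq> {} \<and> bounded D \<and>
     (\<exists>\<C>. finite \<C> \<and> (\<forall>(a, r) \<in> \<C>. (0::real) \<le> r) \<and>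
          disjoint_family_on (\<lambda>(a, r). sphere a r) \<C> \<and>
          frontier D = (\<Union>(a, r) \<in> \<C>. sphere a r))"

definition circular_uniformization :: "(complex \<Rightarrow> complex) \<Rightarrow> complex set \<Rightarrow> bool" where
  "circular_uniformization g D \<longleftrightarrow>
     g holomorphic_on D \<and> inj_on g D \<and> bounded_circular_domain (g ` D)"

text \<open>The completion of \<open>D\<close> with respect to the metric \<open>\<bar>g z - g w\<bar>\<close>, as
  equivalence classes of Cauchy sequences: the classes of constant sequences are the points of
  \<open>D\<close>, the remaining ones are its prime ends. Here \<open>g\<close> is any conformal map of \<open>D\<close> onto a
  bounded circular domain; two such maps give homeomorphic completions, compatibly with the
  embeddings of \<open>D\<close>, so statements are made for every \<open>g\<close>.\<close>

definition prime_end_sequences :: "(complex \<Rightarrow> complex) \<Rightarrow> complex set \<Rightarrow> (nat \<Rightarrow> complex) set" where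
  "prime_end_sequences g D = {x. range x \<subseteq> D \<and> Cauchy (\<lambda>n. g (x n))}"

definition prime_end_rel ::
  "(complex \<Rightarrow> complex) \<Rightarrow> complex set \<Rightarrow> ((nat \<Rightarrow> complex) \<times> (nat \<Rightarrow> complex)) set" where
  "prime_end_rel g D =
     {(x, y). x \<in> prime_end_sequences g D \<and> y \<in> prime_end_sequences g D \<and>
              (\<lambda>n. dist (g (x n)) (g (y n))) \<longlonglongrightarrow> 0}"

definition prime_end_completion ::
  "(complex \<Rightarrow> complex) \<Rightarrow> complex set \<Rightarrow> (nat \<Rightarrow> complex) set set" where
  "prime_end_completion g D = prime_end_sequences g D // prime_end_rel g D"

definition prime_end_embed ::
  "(complex \<Rightarrow> complex) \<Rightarrow> complex set \<Rightarrow> complex \<Rightarrow> (nat \<Rightarrow> complex) set" where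
  "prime_end_embed g D z = prime_end_rel g D `` {\<lambda>_. z}"

text \<open>The extension of \<open>g\<close> to the completion.\<close>

definition prime_end_map :: "(complex \<Rightarrow> complex) \<Rightarrow> (nat \<Rightarrow> complex) set \<Rightarrow> complex" where
  "prime_end_map g p = lim (\<lambda>n. g ((SOME x. x \<in> p) n))"

definition prime_end_dist ::
  "(complex \<Rightarrow> complex) \<Rightarrow> (nat \<Rightarrow> complex) set \<Rightarrow> (nat \<Rightarrow> complex) set \<Rightarrow> real" where
  "prime_end_dist g p q = dist (prime_end_map g p) (prime_end_map g q)"

definition prime_end_topology ::
  "(complex \<Rightarrow> complex) \<Rightarrow> complex set \<Rightarrow> (nat \<Rightarrow> complex) set topology" where
  "prime_end_topology g D =
     Metric_space.mtopology (prime_end_completion g D) (prime_end_dist g)"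

lemma prime_end_rel_iff:
  assumes "x \<in> prime_end_sequences g D" "y \<in> prime_end_sequences g D"
  shows "(x, y) \<in> prime_end_rel g D \<longleftrightarrow> lim (\<lambda>n. g (x n)) = lim (\<lambda>n. g (y n))"
proof -
  have x: "(\<lambda>n. g (x n)) \<longlonglongrightarrow> lim (\<lambda>n. g (x n))" and y: "(\<lambda>n. g (y n)) \<longlonglongrightarrow> lim (\<lambda>n. g (y n))"
    using assms by (auto simp: prime_end_sequences_def Cauchy_convergent_iff convergent_LIMSEQ_iff)
  have "(\<lambda>n. dist (g (x n)) (g (y n))) \<longlonglongrightarrow> dist (lim (\<lambda>n. g (x n))) (lim (\<lambda>n. g (y n)))"
    by (intro tendsto_dist x y)
  then have "(\<lambda>n. dist (g (x n)) (g (y n))) \<longlonglongrightarrow> 0 \<longleftrightarrow>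
      dist (lim (\<lambda>n. g (x n))) (lim (\<lambda>n. g (y n))) = 0"
    using LIMSEQ_unique by metis
  then show ?thesis using assms by (simp add: prime_end_rel_def)
qed

lemma prime_end_map_class:
  assumes "x \<in> prime_end_sequences g D"
  shows "prime_end_map g (prime_end_rel g D `` {x}) = lim (\<lambda>n. g (x n))"
proof -
  have "x \<in> prime_end_rel g D `` {x}"
    using prime_end_rel_iff[OF assms assms] by simp
  then have "(SOME y. y \<in> prime_end_rel g D `` {x}) \<in> prime_end_rel g D `` {x}"
    by (rule someI[where P="\<lambda>y. y \<in> prime_end_rel g D `` {x}"])
  then show ?thesis
    unfolding prime_end_map_def using assms prime_end_rel_iff[of x g D]
    by (auto simp: prime_end_rel_def)
qed

lemma prime_end_map_embed:
  "z \<in> D \<Longrightarrow> prime_end_map g (prime_end_embed g D z) = g z"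
  unfolding prime_end_embed_def
  by (subst prime_end_map_class)
    (auto simp: prime_end_sequences_def intro: LIMSEQ_imp_Cauchy[OF tendsto_const])

lemma bij_betw_prime_end_map:
  "bij_betw (prime_end_map g) (prime_end_completion g D) (closure (g ` D))"
  unfolding bij_betw_def
proof
  show "inj_on (prime_end_map g) (prime_end_completion g D)"
  proof (rule inj_onI)
    fix p q
    assume "p \<in> prime_end_completion g D" "q \<in> prime_end_completion g D"
      and eq: "prime_end_map g p = prime_end_map g q"
    then obtain x y where x: "x \<in> prime_end_sequences g D" "p = prime_end_rel g D `` {x}"
      and y: "y \<in> prime_end_sequences g D" "q = prime_end_rel g D `` {y}"
      by (auto simp: prime_end_completion_def elim!: quotientE)
    have l: "lim (\<lambda>n. g (x n)) = lim (\<lambda>n. g (y n))"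
      using eq prime_end_map_class x y by metis
    show "p = q"
      unfolding x y
    proof (intro set_eqI)
      fix w
      show "w \<in> prime_end_rel g D `` {x} \<longleftrightarrow> w \<in> prime_end_rel g D `` {y}"
        using prime_end_rel_iff[OF x(1), of w] prime_end_rel_iff[OF y(1), of w] l x(1) y(1)
        by (cases "w \<in> prime_end_sequences g D") (auto simp: prime_end_rel_def)
    qed
  qed
  show "prime_end_map g ` prime_end_completion g D = closure (g ` D)"
  proof (intro set_eqI iffI)
    fix w assume "w \<in> prime_end_map g ` prime_end_completion g D"
    then obtain x where x: "x \<in> prime_end_sequences g D" and w: "w = lim (\<lambda>n. g (x n))"
      using prime_end_map_class by (fastforce simp: prime_end_completion_def elim!: quotientE)
    have "(\<lambda>n. g (x n)) \<longlonglongrightarrow> w"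
      using x w by (auto simp: prime_end_sequences_def Cauchy_convergent_iff convergent_LIMSEQ_iff)
    moreover have "g (x n) \<in> g ` D" for n using x by (auto simp: prime_end_sequences_def)
    ultimately show "w \<in> closure (g ` D)" 
      by (auto simp: closure_sequential intro!: exI[of _ "\<lambda>n. g (x n)"])
  next
    fix w assume "w \<in> closure (g ` D)"
    then obtain u where u: "\<And>n. u n \<in> g ` D" "u \<longlonglongrightarrow> w"
      by (auto simp: closure_sequential)
    have "\<forall>n. \<exists>z. z \<in> D \<and> u n = g z" using u(1) by auto
    then obtain x where x: "\<And>n. x n \<in> D" "\<And>n. u n = g (x n)" by metis
    have l: "(\<lambda>n. g (x n)) \<longlonglongrightarrow> w" using u(2) unfolding x(2) .
    have xs: "x \<in> prime_end_sequences g D"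
      using x l by (auto simp: prime_end_sequences_def intro: LIMSEQ_imp_Cauchy)
    have "prime_end_map g (prime_end_rel g D `` {x}) = w"
      using prime_end_map_class[OF xs] limI[OF l] by simp
    moreover have "prime_end_rel g D `` {x} \<in> prime_end_completion g D"
      unfolding prime_end_completion_def using xs by (rule quotientI)
    ultimately show "w \<in> prime_end_map g ` prime_end_completion g D" by blast
  qed
qed

lemma Metric_space_prime_end_completion:
  "Metric_space (prime_end_completion g D) (prime_end_dist g)"
proof
  show "prime_end_dist g p q = 0 \<longleftrightarrow> p = q"
    if "p \<in> prime_end_completion g D" "q \<in> prime_end_completion g D" for p q
    using that bij_betw_prime_end_map[of g D]
    by (auto simp: prime_end_dist_def bij_betw_def dest: inj_onD)
qed (simp_all add: prime_end_dist_def dist_commute dist_triangle)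

definition extends_to_prime_end_homeomorphism ::
  "(complex \<Rightarrow> complex) \<Rightarrow> (complex \<Rightarrow> complex) \<Rightarrow> complex set \<Rightarrow>
   (complex \<Rightarrow> complex) \<Rightarrow> complex set \<Rightarrow> bool" where
  "extends_to_prime_end_homeomorphism f g D g' D' \<longleftrightarrow>
     (\<exists>F. homeomorphic_map (prime_end_topology g D) (prime_end_topology g' D') F \<and>
          (\<forall>z\<in>D. F (prime_end_embed g D z) = prime_end_embed g' D' (f z)))"

end

theory Submission
  imports Defs
begin

text \<open>Write \<open>h = g' \<circ> f\<close>, so that both \<open>g\<close> and \<open>h\<close> map \<open>D\<close> onto circular domains; it suffices that
  \<open>h \<circ> g\<^sup>-\<^sup>1\<close> and its inverse are uniformly continuous. The Cauchy-Schwarz inequality turns the growth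
  condition on \<open>Q\<close> into a lower bound for the modulus of the images of the sections
  \<open>D \<inter> S(z0, r)\<close>, \<open>a < r < b\<close>, namely a multiple of \<open>(ln (b / a))\<^sup>2\<close> divided by the integral of
  \<open>Q(z) / \<bar>z - z0\<bar>\<^sup>2\<close> over the annulus; a conformal map satisfies the same bound with \<open>Q = 1\<close>, so \<open>g\<close>
  and \<open>h\<close> play symmetric roles. Divergence of the bound as \<open>a \<rightarrow> 0\<close> gives sections with arbitrarily
  short images, and its positivity gives arbitrarily small circles about any boundary point of the
  image whose preimages have small diameter. Finally, in a circular domain a set of small length
  leaves a main component that meets every connected set of large diameter. Given a boundary point
  of one image of \<open>D\<close>, a small circle about it with small preimage near \<open>z0\<close>, and a section
  \<open>D \<inter> S(z0, r)\<close> with short image in the other, the main component stays on the far side of the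
  circle, so the near side has an image of small diameter.\<close>


section \<open>Hausdorff measure: Borel sets, Lipschitz images and projections\<close>

text \<open>Only divergence and positivity of the length-area bounds matter, so the geometric
  inequalities are proved with crude constants: estimates of covers by their diameters replace polar
  coordinates and the change of variables formula, and their factors accumulate. Additivity of line
  integrals needs Borel sets to be measurable for \<open>hausdorff1\<close>, whose sigma-algebra is
  given by the Caratheodory condition. The topological obstacle is that the boundary of
  \<open>D\<close> is arbitrary: a section of \<open>D\<close> by a circle, and its image, may have
  infinitely many components, so a short image need not be a crosscut. Sections are therefore used
  only as sets of small length. Connected sections by circles and disks are available only in the
  two circular images of \<open>D\<close>; \<open>D\<close> itself is an intermediary, where
  preimages of circles from one side are compared with circles about a boundary point. The
  comparison is one-sided and is carried out once in each direction.\<close>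

lemma hausdorff1_outer_mono: "A \<subseteq> B \<Longrightarrow> hausdorff1_outer A \<le> hausdorff1_outer B"
  unfolding hausdorff1_outer_def by (auto intro!: SUP_mono' hausdorff1_premeasure_mono)

lemma hausdorff1_outer_empty [simp]: "hausdorff1_outer {} = 0"
  using outer_measure_space_hausdorff1 by (simp add: outer_measure_space_def positive_def)

lemma hausdorff1_outer_UN:
  fixes A :: "nat \<Rightarrow> complex set"
  shows "hausdorff1_outer (\<Union>n. A n) \<le> (\<Sum>n. hausdorff1_outer (A n))"
proof (unfold hausdorff1_outer_def[of "\<Union>n. A n"], rule SUP_least)
  fix \<delta> :: real assume "\<delta> \<in> {0<..}"
  then show "hausdorff1_premeasure \<delta> (\<Union>n. A n) \<le> (\<Sum>n. hausdorff1_outer (A n))"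
    by (intro order_trans[OF hausdorff1_premeasure_UN] suminf_le)
       (auto simp: hausdorff1_outer_def intro: SUP_upper)
qed

lemma hausdorff1_outer_Un: "hausdorff1_outer (A \<union> B) \<le> hausdorff1_outer A + hausdorff1_outer B"
proof -
  have "A \<union> B = (\<Union>n. binaryset A B n)"
    by (simp add: UN_binaryset_eq)
  moreover have "(\<Sum>n. hausdorff1_outer (binaryset A B n)) = hausdorff1_outer A + hausdorff1_outer B"
    by (rule suminf_binaryset_eq) simp
  ultimately show ?thesis
    using hausdorff1_outer_UN[of "binaryset A B"] by simp
qed

lemma hausdorff1_premeasure_antimono:
  "\<delta> \<le> \<delta>' \<Longrightarrow> hausdorff1_premeasure \<delta>' A \<le> hausdorff1_premeasure \<delta> A"
  unfolding hausdorff1_premeasure_def by (rule INF_superset_mono) (auto intro: order_trans)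

lemma hausdorff1_premeasure_le_outer: "0 < \<delta> \<Longrightarrow> hausdorff1_premeasure \<delta> A \<le> hausdorff1_outer A"
  unfolding hausdorff1_outer_def by (auto intro: SUP_upper)

lemma hausdorff1_outer_le:
  assumes "\<And>\<delta>. 0 < \<delta> \<Longrightarrow> hausdorff1_premeasure \<delta> A \<le> x"
  shows "hausdorff1_outer A \<le> x"
  unfolding hausdorff1_outer_def using assms by (auto intro: SUP_least)

lemma hausdorff1_premeasure_leI:
  assumes "A \<subseteq> (\<Union>i. U i)" "\<And>i. bounded (U i)" "\<And>i. diameter (U i) \<le> \<delta>"
  shows "hausdorff1_premeasure \<delta> A \<le> (\<Sum>i. ennreal (diameter (U i)))"
  unfolding hausdorff1_premeasure_def using assms by (intro INF_lower) auto

lemma hausdorff1_premeasure_geI: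
  assumes "\<And>U. A \<subseteq> (\<Union>i. U i) \<Longrightarrow> (\<And>i. bounded (U i)) \<Longrightarrow> (\<And>i. diameter (U i) \<le> \<delta>) \<Longrightarrow>
      x \<le> (\<Sum>i. ennreal (diameter (U i)))"
  shows "x \<le> hausdorff1_premeasure \<delta> A"
  unfolding hausdorff1_premeasure_def using assms by (intro INF_greatest) auto

text \<open>Caratheodory's metric property: a covering set of diameter below \<open>d\<close> cannot
  meet both \<open>A\<close> and \<open>B\<close>, so a fine cover of the union splits into covers
  of the two parts.\<close>

lemma hausdorff1_outer_separated:
  assumes d: "0 < d" and sep: "\<And>x y. x \<in> A \<Longrightarrow> y \<in> B \<Longrightarrow> d \<le> dist x y"
  shows "hausdorff1_outer A + hausdorff1_outer B \<le> hausdorff1_outer (A \<union> B)"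
proof -
  have pre: "hausdorff1_premeasure \<delta> A + hausdorff1_premeasure \<delta> B \<le> hausdorff1_outer (A \<union> B)"
    if \<delta>: "0 < \<delta>" "\<delta> < d" for \<delta>
  proof -
    have "hausdorff1_premeasure \<delta> A + hausdorff1_premeasure \<delta> B \<le> hausdorff1_premeasure \<delta> (A \<union> B)"
    proof (rule hausdorff1_premeasure_geI)
      fix U :: "nat \<Rightarrow> complex set"
      assume cov: "A \<union> B \<subseteq> (\<Union>i. U i)" and bd: "\<And>i. bounded (U i)" and dm: "\<And>i. diameter (U i) \<le> \<delta>"
      define V where "V i = (if U i \<inter> A = {} then {} else U i)" for i
      define V' where "V' i = (if U i \<inter> A = {} then U i else {})" for i
      have disj: "U i \<inter> A = {}" if "y \<in> U i" "y \<in> B" for y i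
      proof (rule ccontr)
        assume "U i \<inter> A \<noteq> {}"
        then obtain x where "x \<in> U i" "x \<in> A" by blast
        then have "d \<le> dist x y" "dist x y \<le> diameter (U i)"
          using sep that diameter_bounded_bound[OF bd] by auto
        then show False using dm[of i] \<delta> by linarith
      qed
      have "A \<subseteq> (\<Union>i. V i)"
      proof
        fix x assume "x \<in> A"
        moreover from this obtain i where "x \<in> U i" using cov by blast
        ultimately have "x \<in> V i" by (auto simp: V_def)
        then show "x \<in> (\<Union>i. V i)" by blast
      qed
      moreover have "B \<subseteq> (\<Union>i. V' i)"
      proof
        fix x assume "x \<in> B"
        moreover from this obtain i where "x \<in> U i" using cov by blast
        ultimately have "x \<in> V' i" using disj by (auto simp: V'_def)
        then show "x \<in> (\<Union>i. V' i)" by blast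
      qed
      ultimately have "hausdorff1_premeasure \<delta> A \<le> (\<Sum>i. ennreal (diameter (V i)))"
        "hausdorff1_premeasure \<delta> B \<le> (\<Sum>i. ennreal (diameter (V' i)))"
        using bd dm \<delta> by (intro hausdorff1_premeasure_leI; simp add: V_def V'_def)+
      then have "hausdorff1_premeasure \<delta> A + hausdorff1_premeasure \<delta> B \<le>
          (\<Sum>i. ennreal (diameter (V i)) + ennreal (diameter (V' i)))"
        by (simp add: suminf_add[symmetric] add_mono)
      also have "\<dots> = (\<Sum>i. ennreal (diameter (U i)))"
        by (intro suminf_cong) (auto simp: V_def V'_def)
      finally show "hausdorff1_premeasure \<delta> A + hausdorff1_premeasure \<delta> B
          \<le> (\<Sum>i. ennreal (diameter (U i)))" .
    qed
    also have "\<dots> \<le> hausdorff1_outer (A \<union> B)"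
      using \<delta> by (intro hausdorff1_premeasure_le_outer)
    finally show ?thesis .
  qed
  \<comment> \<open>A sequence of mesh sizes replaces the supremum over all \<open>\<delta>\<close>,
    so that suprema of two increasing sequences can be added; \<open>n + 2\<close> keeps every mesh
    strictly below \<open>d\<close>.\<close>
  have outer: "hausdorff1_outer X = (SUP n. hausdorff1_premeasure (d / real (n + 2)) X)" for X
  proof (rule antisym)
    show "hausdorff1_outer X \<le> (SUP n. hausdorff1_premeasure (d / real (n + 2)) X)"
    proof (rule hausdorff1_outer_le)
      fix \<delta> :: real assume "0 < \<delta>"
      obtain n where "d / \<delta> < real n" using reals_Archimedean2 by blast
      then have "d / real (n + 2) \<le> \<delta>"
        using \<open>0 < \<delta>\<close> d by (simp add: field_simps) 
      then show "hausdorff1_premeasure \<delta> X \<le> (SUP n. hausdorff1_premeasure (d / real (n + 2)) X)"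
        by (intro SUP_upper2[of n] hausdorff1_premeasure_antimono) auto
    qed
    show "(SUP n. hausdorff1_premeasure (d / real (n + 2)) X) \<le> hausdorff1_outer X"
      using d by (intro SUP_least hausdorff1_premeasure_le_outer) auto
  qed
  have inc: "incseq (\<lambda>n. hausdorff1_premeasure (d / real (n + 2)) X)" for X
    using d by (intro incseq_SucI hausdorff1_premeasure_antimono) (auto intro!: divide_left_mono)
  have "hausdorff1_outer A + hausdorff1_outer B =
      (SUP n. hausdorff1_premeasure (d / real (n + 2)) A + hausdorff1_premeasure (d / real (n + 2)) B)"
    unfolding outer by (rule ennreal_SUP_add[symmetric]) (rule inc)+
  also have "\<dots> \<le> hausdorff1_outer (A \<union> B)"
    using d by (intro SUP_least pre) (auto simp: field_simps intro!: add_pos_nonneg)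
  finally show ?thesis .
qed

text \<open>Each pair has its own gap, possibly tending to 0 with the indices. A finite union still
  has positive distance to the next set, and the infinite sum is the supremum of the finite
  ones.\<close>

lemma hausdorff1_outer_sum_separated:
  fixes R :: "nat \<Rightarrow> complex set"
  assumes "\<And>i j. i < j \<Longrightarrow> \<exists>d>0. \<forall>x\<in>R i. \<forall>y\<in>R j. d \<le> dist x y"
  shows "(\<Sum>i. hausdorff1_outer (R i)) \<le> hausdorff1_outer (\<Union>i. R i)"
proof -
  have "(\<Sum>i<n. hausdorff1_outer (R i)) \<le> hausdorff1_outer (\<Union>i<n. R i)" for n
  proof (induction n)
    case (Suc n)
    have "\<exists>d>0. \<forall>x\<in>(\<Union>i<n. R i). \<forall>y\<in>R n. d \<le> dist x y"
    proof -
      have "\<forall>i. \<exists>d>0. i < n \<longrightarrow> (\<forall>x\<in>R i. \<forall>y\<in>R n. d \<le> dist x y)"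
        using assms by (metis zero_less_one)
      then obtain d where d: "\<And>i. 0 < d i" "\<And>i x y. i < n \<Longrightarrow> x \<in> R i \<Longrightarrow> y \<in> R n \<Longrightarrow> d i \<le> dist x y"
        by metis
      have "0 < Min (insert 1 (d ` {..<n}))"
        using d(1) by (subst Min_gr_iff) auto
      moreover have "Min (insert 1 (d ` {..<n})) \<le> dist x y" if "i < n" "x \<in> R i" "y \<in> R n" for i x y
        using d(2)[OF that] that(1) by (intro order_trans[OF Min_le[of _ "d i"]]) auto
      ultimately show ?thesis by blast
    qed
    then obtain d where "0 < d" "\<And>x y. x \<in> (\<Union>i<n. R i) \<Longrightarrow> y \<in> R n \<Longrightarrow> d \<le> dist x y" by blast
    from hausdorff1_outer_separated[OF this]
    have "hausdorff1_outer (\<Union>i<n. R i) + hausdorff1_outer (R n) \<le> hausdorff1_outer ((\<Union>i<n. R i) \<union> R n)" .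
    with Suc show ?case
      by (simp add: lessThan_Suc Un_commute add.commute order_trans[OF add_left_mono])
  qed simp
  then have "(\<Sum>i<n. hausdorff1_outer (R i)) \<le> hausdorff1_outer (\<Union>i. R i)" for n
    by (rule order_trans) (auto intro: hausdorff1_outer_mono)
  then show ?thesis
    by (intro suminf_le_const) auto
qed

text \<open>Caratheodory's criterion. The part of \<open>T\<close> off \<open>C\<close> is cut into
  layers by the distance to \<open>C\<close>. Layers whose indices differ by at least 2 are
  separated, which makes the sum of their measures finite, so the part close to \<open>C\<close> but
  off it has measure tending to 0.\<close>

lemma closed_in_sets_hausdorff1:
  assumes "closed C"
  shows "C \<in> sets hausdorff1"
proof -
  interpret L: sigma_algebra UNIV "lambda_system UNIV UNIV hausdorff1_outer"
    using measure_space_hausdorff1 by (simp add: measure_space_def)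
  have "hausdorff1_outer (C \<inter> T) + hausdorff1_outer ((UNIV - C) \<inter> T) \<le> hausdorff1_outer T" for T
  proof (cases "C = {} \<or> hausdorff1_outer T = top")
    case False
    then have ne: "C \<noteq> {}" and fin: "hausdorff1_outer T < top" by (auto simp: less_top)
    define D where "D n = {x \<in> T. 1 / real (n + 1) \<le> infdist x C}" for n
    define R where "R n = {x \<in> T. 1 / real (n + 2) \<le> infdist x C \<and> infdist x C < 1 / real (n + 1)}" for n
    have sep: "\<exists>d>0. \<forall>x\<in>R i. \<forall>y\<in>R j. d \<le> dist x y" if "i + 1 < j" for i j
    proof (intro exI conjI ballI)
      have "real (i + 2) < real (j + 1)" using that by simp
      then show "0 < 1 / real (i + 2) - 1 / real (j + 1)"
        by (simp add: frac_less2)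
      fix x y assume "x \<in> R i" "y \<in> R j"
      moreover have "infdist x C \<le> infdist y C + dist x y"
        by (rule infdist_triangle)
      ultimately show "1 / real (i + 2) - 1 / real (j + 1) \<le> dist x y"
        by (auto simp: R_def)
    qed
    \<comment> \<open>Adjacent layers may touch; splitting into even and odd indices costs only a
      factor 2.\<close>
    have even: "(\<Sum>i. hausdorff1_outer (R (2 * i))) \<le> hausdorff1_outer T"
      using sep by (intro order_trans[OF hausdorff1_outer_sum_separated hausdorff1_outer_mono]) (simp, force simp: R_def)
    have odd: "(\<Sum>i. hausdorff1_outer (R (2 * i + 1))) \<le> hausdorff1_outer T"
      using sep by (intro order_trans[OF hausdorff1_outer_sum_separated hausdorff1_outer_mono]) (simp, force simp: R_def)
    have "(\<Sum>i. hausdorff1_outer (R i)) \<le> hausdorff1_outer T + hausdorff1_outer T"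
    proof (rule suminf_le_const)
      fix n
      have "(\<Sum>i<n. hausdorff1_outer (R i)) \<le> (\<Sum>i<2*n. hausdorff1_outer (R i))"
        by (intro sum_mono2) auto
      also have "\<dots> = (\<Sum>i<n. hausdorff1_outer (R (2 * i))) + (\<Sum>i<n. hausdorff1_outer (R (2 * i + 1)))"
        by (induction n) (simp_all add: algebra_simps)
      also have "\<dots> \<le> (\<Sum>i. hausdorff1_outer (R (2 * i))) + (\<Sum>i. hausdorff1_outer (R (2 * i + 1)))"
        by (intro add_mono sum_le_suminf) auto
      finally show "(\<Sum>i<n. hausdorff1_outer (R i)) \<le> hausdorff1_outer T + hausdorff1_outer T"
        using even odd by (meson add_mono order_trans)
    qed auto
    then have sumfin: "(\<Sum>i. hausdorff1_outer (R i)) \<noteq> top"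
      using fin by (auto simp: top_unique)
    have "(\<lambda>n. \<Sum>i. hausdorff1_outer (R (i + n))) \<longlonglongrightarrow> 0"
    proof -
      define r where "r i = enn2real (hausdorff1_outer (R i))" for i
      have fi: "hausdorff1_outer (R i) = ennreal (r i)" for i
        using ennreal_suminf_lessD[of "\<lambda>i. hausdorff1_outer (R i)" top i] sumfin
        by (simp add: r_def less_top)
      have r0: "0 \<le> r i" for i by (simp add: r_def)
      have "summable r"
        using sumfin r0 unfolding fi by (intro summable_suminf_not_top) auto
      then have s: "summable (\<lambda>i. r (i + n))" for n by (simp add: summable_ignore_initial_segment)
      have "(\<Sum>i. hausdorff1_outer (R (i + n))) = ennreal (\<Sum>i. r (i + n))" for n
        unfolding fi using r0 s by (intro suminf_ennreal2) auto
      moreover have "(\<lambda>n. \<Sum>i. r (i + n)) \<longlonglongrightarrow> 0"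
        by (rule suminf_exist_split2) fact
      ultimately show ?thesis using tendsto_ennrealI by fastforce
    qed
    then have "(\<lambda>n. hausdorff1_outer T + (\<Sum>i. hausdorff1_outer (R (i + n)))) \<longlonglongrightarrow> hausdorff1_outer T + 0"
      by (intro tendsto_intros)
    \<comment> \<open>\<open>D n\<close> keeps distance \<open>1 / (n + 1)\<close> from
      \<open>C\<close>, so the measures of \<open>C \<inter> T\<close> and \<open>D n\<close> add up
      to at most that of \<open>T\<close>; the rest of \<open>T - C\<close> lies in the tail of the
      layers.\<close>
    moreover have "hausdorff1_outer (C \<inter> T) + hausdorff1_outer ((UNIV - C) \<inter> T) \<le>
        hausdorff1_outer T + (\<Sum>i. hausdorff1_outer (R (i + n)))" for n
    proof -
      have "(UNIV - C) \<inter> T \<subseteq> D n \<union> (\<Union>i. R (i + n))"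
      proof
        fix x assume x: "x \<in> (UNIV - C) \<inter> T"
        then have pos: "0 < infdist x C"
          using assms ne by (simp add: infdist_pos_not_in_closed)
        show "x \<in> D n \<union> (\<Union>i. R (i + n))"
        proof (cases "1 / real (n + 1) \<le> infdist x C")
          case False
          \<comment> \<open>The first index whose threshold is reached exceeds \<open>n\<close>, and
            its predecessor fails, which is membership in layer \<open>k - 1\<close>.\<close>
          define k where "k = (LEAST k. 1 / real (k + 1) \<le> infdist x C)"
          obtain m where "1 / infdist x C < real m" using reals_Archimedean2 by blast
          then have ex: "1 / real (m + 1) \<le> infdist x C" using pos by (simp add: field_simps)
          have k: "1 / real (k + 1) \<le> infdist x C" unfolding k_def by (rule LeastI, rule ex)
          have "\<not> k \<le> n"
          proof
            assume "k \<le> n"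
            then have "1 / real (n + 1) \<le> 1 / real (k + 1)" by (simp add: frac_le)
            with k False show False by linarith
          qed
          then have "k = (k - n - 1) + n + 1" by simp
          then obtain i where i: "k = i + n + 1" by blast
          have "\<not> 1 / real (i + n + 1) \<le> infdist x C"
            using not_less_Least[of "i + n" "\<lambda>k. 1 / real (k + 1) \<le> infdist x C"] i
            unfolding k_def by (simp add: add.assoc)
          then have "x \<in> R (i + n)" using k x unfolding R_def i by (simp add: algebra_simps)
          then show ?thesis by blast
        qed (use x in \<open>auto simp: D_def\<close>)
      qed
      then have "hausdorff1_outer ((UNIV - C) \<inter> T) \<le> hausdorff1_outer (D n \<union> (\<Union>i. R (i + n)))"
        by (rule hausdorff1_outer_mono)
      also have "\<dots> \<le> hausdorff1_outer (D n) + (\<Sum>i. hausdorff1_outer (R (i + n)))"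
        by (rule order_trans[OF hausdorff1_outer_Un]) (intro add_left_mono hausdorff1_outer_UN)
      finally have "hausdorff1_outer (C \<inter> T) + hausdorff1_outer ((UNIV - C) \<inter> T) \<le>
          (hausdorff1_outer (C \<inter> T) + hausdorff1_outer (D n)) + (\<Sum>i. hausdorff1_outer (R (i + n)))"
        by (simp add: add.assoc add_left_mono)
      also have "hausdorff1_outer (C \<inter> T) + hausdorff1_outer (D n) \<le> hausdorff1_outer (C \<inter> T \<union> D n)"
      proof (rule hausdorff1_outer_separated)
        show "0 < 1 / real (n + 1)" by simp
        fix x y assume "x \<in> C \<inter> T" "y \<in> D n"
        then show "1 / real (n + 1) \<le> dist x y"
          using infdist_le[of x C y] by (auto simp: D_def dist_commute)
      qed
      also have "\<dots> \<le> hausdorff1_outer T"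
        by (rule hausdorff1_outer_mono) (auto simp: D_def)
      finally show ?thesis by (simp add: add_right_mono)
    qed
    ultimately show ?thesis
      by (intro tendsto_lowerbound[where F=sequentially]) auto
  qed (auto simp: top_unique)
  moreover have "hausdorff1_outer T \<le> hausdorff1_outer (C \<inter> T) + hausdorff1_outer ((UNIV - C) \<inter> T)" for T
    by (rule order_trans[OF hausdorff1_outer_mono hausdorff1_outer_Un]) blast
  ultimately have "C \<in> lambda_system UNIV UNIV hausdorff1_outer"
    by (auto simp: lambda_system_def intro: antisym)
  then show ?thesis
    unfolding hausdorff1_def by (simp add: sets_measure_of_conv L.sigma_sets_eq)
qed

lemma space_hausdorff1 [simp]: "space hausdorff1 = UNIV"
  by (simp add: hausdorff1_def space_measure_of_conv)

lemma borel_sets_hausdorff1: "sets borel \<subseteq> sets hausdorff1"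
proof -
  have "sets borel = sigma_sets UNIV (Collect (closed :: complex set \<Rightarrow> bool))"
    by (simp add: borel_eq_closed)
  also have "\<dots> \<subseteq> sets hausdorff1"
    using sets.sigma_sets_subset[of "Collect closed" hausdorff1] closed_in_sets_hausdorff1 by auto
  finally show ?thesis .
qed

text \<open>The identity pushes \<open>hausdorff1\<close> onto the Borel sigma-algebra, so that the
  measurability rules for Borel functions apply; integrals of Borel functions do not change.\<close>

definition hausdorff1_borel :: "complex measure" where
  "hausdorff1_borel = distr hausdorff1 borel (\<lambda>x. x)"

lemma sets_hausdorff1_borel [simp, measurable_cong]: "sets hausdorff1_borel = sets borel"
  by (simp add: hausdorff1_borel_def)

lemma measurable_id_hausdorff1: "(\<lambda>x. x) \<in> hausdorff1 \<rightarrow>\<^sub>M borel"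
  using borel_sets_hausdorff1 by (auto simp: measurable_def)

lemma emeasure_hausdorff1_borel:
  "A \<in> sets borel \<Longrightarrow> emeasure hausdorff1_borel A = hausdorff1_outer A"
  using borel_sets_hausdorff1 emeasure_hausdorff1
  by (subst hausdorff1_borel_def, subst emeasure_distr) (auto simp: measurable_id_hausdorff1)

lemma nn_integral_hausdorff1:
  "p \<in> borel_measurable borel \<Longrightarrow> (\<integral>\<^sup>+w. p w \<partial>hausdorff1) = (\<integral>\<^sup>+w. p w \<partial>hausdorff1_borel)"
  unfolding hausdorff1_borel_def by (subst nn_integral_distr) (auto simp: measurable_id_hausdorff1)

lemma borel_measurable_hausdorff1_borel:
  "p \<in> borel_measurable borel \<Longrightarrow> p \<in> borel_measurable hausdorff1_borel"
  by (simp cong: measurable_cong_sets)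

lemma ennreal_le_times_of_divide_le:
  assumes "0 < L" "x / ennreal L \<le> y"
  shows "x \<le> ennreal L * y"
proof -
  have "x = ennreal L * (x / ennreal L)"
    using assms(1) by (simp add: ennreal_times_divide mult.commute[of "ennreal L"] ennreal_mult_divide_eq)
  also have "\<dots> \<le> ennreal L * y"
    using assms(2) by (rule mult_left_mono) simp
  finally show ?thesis .
qed

lemma hausdorff1_outer_lipschitz_image:
  assumes L: "0 < L" and lip: "\<And>x y. x \<in> E \<Longrightarrow> y \<in> E \<Longrightarrow> dist (k x) (k y) \<le> L * dist x y"
  shows "hausdorff1_outer (k ` E) \<le> ennreal L * hausdorff1_outer E"
proof (rule hausdorff1_outer_le)
  fix \<delta> :: real assume \<delta>: "0 < \<delta>"
  have "hausdorff1_premeasure \<delta> (k ` E) / ennreal L \<le> hausdorff1_premeasure (\<delta> / L) E"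
  proof (rule hausdorff1_premeasure_geI)
    fix U :: "nat \<Rightarrow> complex set"
    assume cov: "E \<subseteq> (\<Union>i. U i)" and bd: "\<And>i. bounded (U i)" and dm: "\<And>i. diameter (U i) \<le> \<delta> / L"
    have lip': "dist (k x) (k y) \<le> L * diameter (U i)" if "x \<in> U i \<inter> E" "y \<in> U i \<inter> E" for x y i
      using lip[of x y] diameter_bounded_bound[OF bd, of x i y] that L
      by (meson IntE mult_left_mono order_trans less_imp_le)
    have bd': "bounded (k ` (U i \<inter> E))" for i
    proof (cases "U i \<inter> E = {}")
      case False
      then obtain x where "x \<in> U i \<inter> E" by blast
      then have "\<forall>y\<in>k ` (U i \<inter> E). dist (k x) y \<le> L * diameter (U i)" using lip' by blast
      then show ?thesis unfolding bounded_def by blast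
    qed simp
    have dm': "diameter (k ` (U i \<inter> E)) \<le> L * diameter (U i)" for i
      using L lip' diameter_ge_0[OF bd] by (intro diameter_le) (auto simp: dist_norm)
    have "hausdorff1_premeasure \<delta> (k ` E) \<le> (\<Sum>i. ennreal (diameter (k ` (U i \<inter> E))))"
    proof (rule hausdorff1_premeasure_leI)
      show "k ` E \<subseteq> (\<Union>i. k ` (U i \<inter> E))" using cov by blast
      show "diameter (k ` (U i \<inter> E)) \<le> \<delta>" for i
        using dm'[of i] dm[of i] L by (simp add: field_simps)
    qed (rule bd')
    also have "\<dots> \<le> (\<Sum>i. ennreal L * ennreal (diameter (U i)))"
      using dm' L diameter_ge_0[OF bd] by (intro suminf_le) (auto simp: ennreal_mult[symmetric] intro!: ennreal_leI)
    also have "\<dots> = ennreal L * (\<Sum>i. ennreal (diameter (U i)))"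
      by simp
    finally show "hausdorff1_premeasure \<delta> (k ` E) / ennreal L \<le> (\<Sum>i. ennreal (diameter (U i)))"
      using L by (simp add: divide_le_posI_ennreal)
  qed
  also have "\<dots> \<le> hausdorff1_outer E"
    using L \<delta> by (intro hausdorff1_premeasure_le_outer) simp
  finally show "hausdorff1_premeasure \<delta> (k ` E) \<le> ennreal L * hausdorff1_outer E"
    by (rule ennreal_le_times_of_divide_le[OF L])
qed

text \<open>A covering set is sent by \<open>u\<close> into an interval whose half-length is its
  diameter, centred at the image of any of its points; hence the factor 2. The Borel set
  \<open>X\<close> stands in for the image of \<open>E\<close>, whose measurability is not
  assumed.\<close>

lemma emeasure_projection_le_hausdorff1_outer:
  fixes u :: "complex \<Rightarrow> real"
  assumes lip: "\<And>x y. \<bar>u x - u y\<bar> \<le> dist x y" and X: "X \<in> sets borel" "X \<subseteq> u ` E"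
  shows "emeasure lborel X \<le> 2 * hausdorff1_outer E"
proof -
  have "emeasure lborel X / 2 \<le> hausdorff1_premeasure 1 E"
  proof (rule hausdorff1_premeasure_geI)
    fix U :: "nat \<Rightarrow> complex set"
    assume cov: "E \<subseteq> (\<Union>i. U i)" and bd: "\<And>i. bounded (U i)"
    define c where "c i = (SOME x. x \<in> U i)" for i
    define I where "I i = {u (c i) - diameter (U i)..u (c i) + diameter (U i)}" for i
    have uI: "u x \<in> I i" if "x \<in> U i" for x i
    proof -
      have "c i \<in> U i" unfolding c_def using that by (rule someI)
      then have "\<bar>u x - u (c i)\<bar> \<le> diameter (U i)"
        using lip[of x "c i"] diameter_bounded_bound[OF bd that, of "c i"] by linarith
      then show ?thesis by (auto simp: I_def abs_le_iff)
    qed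
    have "X \<subseteq> (\<Union>i. I i)"
    proof
      fix t assume "t \<in> X"
      then obtain x i where "t = u x" "x \<in> U i" using cov X(2) by fastforce
      then show "t \<in> (\<Union>i. I i)" using uI by blast
    qed
    then have "emeasure lborel X \<le> emeasure lborel (\<Union>i. I i)"
      by (intro emeasure_mono) (auto simp: I_def)
    also have "\<dots> \<le> (\<Sum>i. emeasure lborel (I i))"
      by (intro emeasure_subadditive_countably) (auto simp: I_def)
    also have "\<dots> = (\<Sum>i. 2 * ennreal (diameter (U i)))"
      using diameter_ge_0[OF bd] by (intro suminf_cong) (simp add: I_def ennreal_mult'')
    also have "\<dots> = 2 * (\<Sum>i. ennreal (diameter (U i)))" by simp
    finally show "emeasure lborel X / 2 \<le> (\<Sum>i. ennreal (diameter (U i)))"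
      by (simp add: divide_le_posI_ennreal)
  qed
  also have "\<dots> \<le> hausdorff1_outer E" by (intro hausdorff1_premeasure_le_outer) simp
  finally show ?thesis
    using ennreal_le_times_of_divide_le[of 2] by simp
qed


section \<open>The coarea inequality\<close>

lemma diameter_square_cbox:
  fixes u v :: complex
  assumes "0 \<le> s" "Re v - Re u = s" "Im v - Im u = s"
  shows "(diameter (cbox u v))\<^sup>2 \<le> 2 * s\<^sup>2" "emeasure lborel (interior (cbox u v)) = ennreal (s\<^sup>2)"
proof -
  have "diameter (cbox u v) \<le> sqrt 2 * s"
  proof (rule diameter_le)
    fix x y assume xy: "x \<in> cbox u v" "y \<in> cbox u v"
    then have "\<bar>Re (x - y)\<bar> \<le> s" "\<bar>Im (x - y)\<bar> \<le> s"
      using assms by (auto simp: in_cbox_complex_iff)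
    then have "(Re (x - y))\<^sup>2 \<le> s\<^sup>2" "(Im (x - y))\<^sup>2 \<le> s\<^sup>2"
      using assms(1) by (metis abs_ge_zero power2_abs power_mono)+
    then have "cmod (x - y) \<le> sqrt (2 * s\<^sup>2)"
      unfolding cmod_def by (intro real_sqrt_le_mono) simp
    then show "norm (x - y) \<le> sqrt 2 * s" using assms(1) by (simp add: real_sqrt_mult)
  qed (use assms in auto)
  moreover have "0 \<le> diameter (cbox u v)" by (intro diameter_ge_0 bounded_cbox)
  ultimately have "(diameter (cbox u v))\<^sup>2 \<le> (sqrt 2 * s)\<^sup>2" by (intro power_mono)
  then show "(diameter (cbox u v))\<^sup>2 \<le> 2 * s\<^sup>2" by (simp add: power_mult_distrib)
  have "emeasure lborel (box u v) = ennreal (\<Prod>b\<in>Basis. (v - u) \<bullet> b)"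
    using assms by (intro emeasure_lborel_box) (auto simp: Basis_complex_def)
  also have "(\<Prod>b\<in>Basis. (v - u) \<bullet> b) = s\<^sup>2"
    using assms by (auto simp: Basis_complex_def power2_eq_square)
  finally show "emeasure lborel (interior (cbox u v)) = ennreal (s\<^sup>2)"
    by (simp add: interior_cbox)
qed

text \<open>Squared diameters are comparable to area only for fat covering sets. The squares are
  dyadic and non-overlapping, they lie in an open set barely larger than \<open>B\<close>, and the
  squared diameter of a square is at most twice its area.\<close>

lemma fine_cover:
  fixes B :: "complex set"
  assumes B: "B \<in> sets borel" "bounded B" and pos: "0 < e" "0 < \<delta>"
  obtains U :: "nat \<Rightarrow> complex set" where
    "B \<subseteq> (\<Union>i. U i)" "\<And>i. bounded (U i)" "\<And>i. diameter (U i) \<le> \<delta>"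
    "(\<Sum>i. ennreal ((diameter (U i))\<^sup>2)) \<le> 2 * (emeasure lborel B + ennreal e)"
proof -
  have fin: "emeasure lborel B < \<infinity>" using B(2) by (rule emeasure_bounded_finite)
  obtain O' where O': "open O'" "B \<subseteq> O'" "emeasure lborel (O' - B) < ennreal e"
  proof -
    have "B \<in> sets lebesgue" using B(1) by simp
    from sets_lebesgue_outer_open[OF this pos(1)] obtain T where
      T: "open T" "B \<subseteq> T" "T - B \<in> lmeasurable" "emeasure lebesgue (T - B) < ennreal e" by metis
    moreover have "emeasure lborel (T - B) = emeasure lebesgue (T - B)"
      using T(1) B(1) by simp
    ultimately show ?thesis using that by metis
  qed
  have mO: "emeasure lborel O' \<le> emeasure lborel B + ennreal e"
  proof -
    have "emeasure lborel O' = emeasure lborel B + emeasure lborel (O' - B)"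
      using O' B(1) by (subst plus_emeasure) (auto simp: Un_absorb1)
    then show ?thesis using O'(3) by (simp add: add_left_mono less_imp_le)
  qed
  obtain r where r: "0 < r" "\<And>z. z \<in> B \<Longrightarrow> cmod z \<le> r"
    using B(2) bounded_pos by blast
  define a b where "a = Complex (-r) (-r)" and "b = Complex r r"
  have sub: "B \<subseteq> cbox a b"
  proof
    fix z assume "z \<in> B"
    then have "\<bar>Re z\<bar> \<le> r" "\<bar>Im z\<bar> \<le> r" using r(2)[of z] abs_Re_le_cmod[of z] abs_Im_le_cmod[of z] by auto
    then show "z \<in> cbox a b" by (auto simp: a_def b_def in_cbox_complex_iff)
  qed
  have ne: "box a b \<noteq> {}"
    using r(1) by (auto simp: box_ne_empty Basis_complex_def a_def b_def)
  \<comment> \<open>The gauge forces each square into a disk of radius \<open>\<delta> / 2\<close>,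
    which bounds its diameter, and into \<open>O'\<close>, which bounds the total area.\<close>
  define g where "g x = ball x (\<delta> / 2) \<inter> (if x \<in> O' then O' else UNIV)" for x
  have "gauge g" unfolding gauge_def g_def using O'(1) pos by auto
  from covering_lemma[OF sub ne this] obtain \<D> where D: "countable \<D>"
    "\<And>K. K \<in> \<D> \<Longrightarrow> interior K \<noteq> {} \<and> (\<exists>c d. K = cbox c d)"
    "pairwise (\<lambda>A B. interior A \<inter> interior B = {}) \<D>"
    "\<And>K. K \<in> \<D> \<Longrightarrow> \<exists>x \<in> B \<inter> K. K \<subseteq> g x"
    "\<And>u v. cbox u v \<in> \<D> \<Longrightarrow> \<exists>n. \<forall>i \<in> Basis. v \<bullet> i - u \<bullet> i = (b \<bullet> i - a \<bullet> i) / 2^n"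
    "B \<subseteq> \<Union>\<D>"
    by metis
  have KO: "K \<subseteq> O'" and Kd: "diameter K \<le> \<delta>" and Kb: "bounded K"
    and Kq: "ennreal ((diameter K)\<^sup>2) \<le> 2 * emeasure lborel (interior K)" if K: "K \<in> \<D>" for K
  proof -
    obtain x where x: "x \<in> B" "K \<subseteq> g x" using D(4)[OF K] by blast
    then have "x \<in> O'" using O'(2) by blast
    with x show "K \<subseteq> O'" by (simp add: g_def)
    have "K \<subseteq> ball x (\<delta> / 2)" using x by (auto simp: g_def)
    then have "diameter K \<le> diameter (ball x (\<delta> / 2))" by (intro diameter_subset) auto
    then show "diameter K \<le> \<delta>" using pos by simp
    obtain u v where uv: "K = cbox u v" using D(2)[OF K] by blast
    then show "bounded K" by simp
    obtain n where n: "\<And>i. i \<in> Basis \<Longrightarrow> v \<bullet> i - u \<bullet> i = (b \<bullet> i - a \<bullet> i) / 2^n"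
      using D(5) K uv by metis
    have "Re v - Re u = 2 * r / 2 ^ n" "Im v - Im u = 2 * r / 2 ^ n"
      using n[of 1] n[of \<i>] by (auto simp: Basis_complex_def a_def b_def)
    from diameter_square_cbox[OF _ this] r(1)
    have "(diameter K)\<^sup>2 \<le> 2 * (2 * r / 2 ^ n)\<^sup>2" "emeasure lborel (interior K) = ennreal ((2 * r / 2 ^ n)\<^sup>2)"
      by (auto simp: uv)
    then show "ennreal ((diameter K)\<^sup>2) \<le> 2 * emeasure lborel (interior K)"
      using ennreal_leI[of "(diameter K)\<^sup>2" "2 * (2 * r / 2 ^ n)\<^sup>2"] by (simp add: ennreal_mult'')
  qed
  \<comment> \<open>The countable family is indexed by naturals, with the empty set at the indices
    left over when it is finite.\<close>
  define I where "I = to_nat_on \<D> ` \<D>"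
  define U where "U n = (if n \<in> I then from_nat_into \<D> n else {})" for n
  have UD: "U n \<in> \<D>" if "n \<in> I" for n
    using that D(1) by (auto simp: U_def I_def)
  have U0: "U n = {}" if "n \<notin> I" for n using that by (simp add: U_def)
  have Uinj: "U m \<noteq> U n" if "m \<in> I" "n \<in> I" "m \<noteq> n" for m n
    using that D(1) by (auto simp: U_def I_def)
  have disj: "disjoint_family (\<lambda>n. interior (U n))"
    unfolding disjoint_family_on_def
  proof (intro ballI impI)
    fix m n :: nat assume "m \<noteq> n"
    show "interior (U m) \<inter> interior (U n) = {}"
    proof (cases "m \<in> I \<and> n \<in> I")
      case True
      then show ?thesis using D(3) UD Uinj \<open>m \<noteq> n\<close> unfolding pairwise_def by metis
    qed (auto simp: U0)
  qed
  have "(\<Sum>i. ennreal ((diameter (U i))\<^sup>2)) \<le> (\<Sum>i. 2 * emeasure lborel (interior (U i)))"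
  proof (rule suminf_le)
    fix i show "ennreal ((diameter (U i))\<^sup>2) \<le> 2 * emeasure lborel (interior (U i))"
      by (cases "i \<in> I") (auto simp: U0 intro: Kq UD)
  qed auto
  also have "\<dots> = 2 * (\<Sum>i. emeasure lborel (interior (U i)))" by simp
  finally have s1: "(\<Sum>i. ennreal ((diameter (U i))\<^sup>2)) \<le> 2 * (\<Sum>i. emeasure lborel (interior (U i)))" .
  have "(\<Sum>i. emeasure lborel (interior (U i))) = emeasure lborel (\<Union>i. interior (U i))"
    by (rule suminf_emeasure) (use disj in auto)
  also have "\<dots> \<le> emeasure lborel O'"
  proof (rule emeasure_mono)
    have "interior (U i) \<subseteq> O'" for i
      using interior_subset[of "U i"] KO[OF UD] U0 by (cases "i \<in> I") auto
    then show "(\<Union>i. interior (U i)) \<subseteq> O'" by blast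
  qed (use O' in auto)
  also note mO
  finally have s: "(\<Sum>i. ennreal ((diameter (U i))\<^sup>2)) \<le> 2 * (emeasure lborel B + ennreal e)"
    by (intro order_trans[OF s1] mult_left_mono) auto
  have "B \<subseteq> (\<Union>i. U i)"
  proof
    fix x assume "x \<in> B"
    then obtain K where K: "K \<in> \<D>" "x \<in> K" using D(6) by blast
    then have "U (to_nat_on \<D> K) = K" using D(1) by (simp add: U_def I_def)
    then show "x \<in> (\<Union>i. U i)" using K(2) by blast
  qed
  moreover have "bounded (U i)" "diameter (U i) \<le> \<delta>" for i
    using Kb[OF UD] Kd[OF UD] U0 pos by (cases "i \<in> I"; auto)+
  ultimately show ?thesis using that s by blast
qed

text \<open>Each piece of a fine cover is mapped into a disk whose radius is \<open>L\<close> times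
  its diameter, of area \<open>pi * L\<^sup>2\<close> times the squared diameter; the remaining 2 is
  that of \<open>fine_cover\<close>.\<close>

lemma emeasure_lipschitz_image_le:
  fixes k :: "complex \<Rightarrow> complex"
  assumes B: "B \<in> sets borel" "bounded B" and L: "0 < L"
    and lip: "\<And>x y. x \<in> B \<Longrightarrow> y \<in> B \<Longrightarrow> dist (k x) (k y) \<le> L * dist x y"
    and S: "S \<in> sets borel" "S \<subseteq> k ` B"
  shows "emeasure lborel S \<le> ennreal (2 * pi * L\<^sup>2) * emeasure lborel B"
proof -
  have le: "emeasure lborel S \<le> ennreal (2 * pi * L\<^sup>2) * (emeasure lborel B + ennreal e)" if e: "0 < e" for e
  proof -
    obtain U :: "nat \<Rightarrow> complex set" where U: "B \<subseteq> (\<Union>i. U i)" "\<And>i. bounded (U i)"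
      "(\<Sum>i. ennreal ((diameter (U i))\<^sup>2)) \<le> 2 * (emeasure lborel B + ennreal e)"
      using fine_cover[OF B e zero_less_one] by metis
    define c where "c i = (SOME x. x \<in> U i \<inter> B)" for i
    have kx: "k x \<in> cball (k (c i)) (L * diameter (U i))" if "x \<in> U i \<inter> B" for x i
    proof -
      have c: "c i \<in> U i \<inter> B" unfolding c_def using that by (rule someI)
      have "dist (k (c i)) (k x) \<le> L * dist (c i) x" using lip c that by auto
      also have "\<dots> \<le> L * diameter (U i)"
        using L diameter_bounded_bound[OF U(2), of "c i" i x] c that by (intro mult_left_mono) auto
      finally show ?thesis by simp
    qed
    have "S \<subseteq> (\<Union>i. cball (k (c i)) (L * diameter (U i)))"
    proof
      fix t assume "t \<in> S"
      then obtain x i where "t = k x" "x \<in> U i \<inter> B" using S(2) U(1) by fastforce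
      then show "t \<in> (\<Union>i. cball (k (c i)) (L * diameter (U i)))" using kx by blast
    qed
    then have "emeasure lborel S \<le> emeasure lborel (\<Union>i. cball (k (c i)) (L * diameter (U i)))"
      by (intro emeasure_mono) auto
    also have "\<dots> \<le> (\<Sum>i. emeasure lborel (cball (k (c i)) (L * diameter (U i))))"
      by (intro emeasure_subadditive_countably) auto
    also have "\<dots> = (\<Sum>i. ennreal (pi * L\<^sup>2) * ennreal ((diameter (U i))\<^sup>2))"
      using L diameter_ge_0[OF U(2)]
      by (intro suminf_cong) (simp add: emeasure_cball unit_ball_vol_2 power_mult_distrib ennreal_mult'[symmetric] mult.assoc)
    also have "\<dots> = ennreal (pi * L\<^sup>2) * (\<Sum>i. ennreal ((diameter (U i))\<^sup>2))" by simp
    also have "\<dots> \<le> ennreal (pi * L\<^sup>2) * (2 * (emeasure lborel B + ennreal e))"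
      using U(3) by (rule mult_left_mono) simp
    also have "\<dots> = ennreal (2 * pi * L\<^sup>2) * (emeasure lborel B + ennreal e)"
    proof -
      have "ennreal (2 * pi * L\<^sup>2) = 2 * ennreal (pi * L\<^sup>2)"
        by (simp add: ennreal_mult' mult.assoc)
      then show ?thesis by (simp only: mult_ac)
    qed
    finally show ?thesis .
  qed
  show ?thesis
  proof (rule ennreal_le_epsilon)
    fix e :: real assume e: "0 < e"
    define c where "c = 2 * pi * L\<^sup>2"
    have c: "0 < c" using L by (simp add: c_def)
    have "emeasure lborel S \<le> ennreal c * (emeasure lborel B + ennreal (e / c))"
      unfolding c_def using e c by (intro le) (simp add: c_def)
    also have "\<dots> = ennreal c * emeasure lborel B + ennreal e"
      using c e by (simp add: distrib_left ennreal_mult'[symmetric])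
    finally show "emeasure lborel S \<le> ennreal (2 * pi * L\<^sup>2) * emeasure lborel B + ennreal e"
      unfolding c_def .
  qed
qed

text \<open>Eilenberg's inequality for the distance to \<open>z0\<close>, a substitute for polar
  coordinates. Measurability of the slice integral in \<open>r\<close> is left open, so a Borel
  majorant \<open>\<Lambda>\<close> carries the estimate.\<close>

definition coarea_bound :: "complex \<Rightarrow> (complex \<Rightarrow> ennreal) \<Rightarrow> bool" where
  "coarea_bound z0 p \<longleftrightarrow>
     (\<exists>\<Lambda> \<in> borel_measurable borel.
        (\<forall>r. (\<integral>\<^sup>+z\<in>sphere z0 r. p z \<partial>hausdorff1_borel) \<le> \<Lambda> r) \<and>
        (\<integral>\<^sup>+r. \<Lambda> r \<partial>lborel) \<le> 4 * (\<integral>\<^sup>+z. p z \<partial>lborel))"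

lemma sphere_in_borel [measurable]: "sphere (a :: complex) r \<in> sets borel"
  by (intro borel_closed) auto

text \<open>The lower limit of the majorants still majorizes the slices, since the slice integrals
  increase, and Fatou's lemma keeps the bound on its integral.\<close>

lemma coarea_bound_SUP:
  assumes U: "\<And>i. U i \<in> borel_measurable borel" "incseq U" "\<And>i. coarea_bound z0 (U i)"
  shows "coarea_bound z0 (\<lambda>z. SUP i. U i z)"
proof -
  obtain \<Lambda> where \<Lambda>: "\<And>i. \<Lambda> i \<in> borel_measurable borel"
    "\<And>i r. (\<integral>\<^sup>+z\<in>sphere z0 r. U i z \<partial>hausdorff1_borel) \<le> \<Lambda> i r"
    "\<And>i. (\<integral>\<^sup>+r. \<Lambda> i r \<partial>lborel) \<le> 4 * (\<integral>\<^sup>+z. U i z \<partial>lborel)"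
    using U(3) unfolding coarea_bound_def by metis
  note [measurable] = U(1) \<Lambda>(1)
  have Umono: "U i z \<le> U j z" if "i \<le> j" for i j z
    using U(2) that by (auto simp: incseq_def le_fun_def)
  show ?thesis
    unfolding coarea_bound_def
  proof (intro bexI conjI allI)
    show "(\<lambda>r. liminf (\<lambda>i. \<Lambda> i r)) \<in> borel_measurable borel" by measurable
    show "(\<integral>\<^sup>+z\<in>sphere z0 r. (SUP i. U i z) \<partial>hausdorff1_borel) \<le> liminf (\<lambda>i. \<Lambda> i r)" for r
    proof -
      have "(\<integral>\<^sup>+z\<in>sphere z0 r. (SUP i. U i z) \<partial>hausdorff1_borel)
          = (\<integral>\<^sup>+z. (SUP i. U i z * indicator (sphere z0 r) z) \<partial>hausdorff1_borel)"
        by (intro nn_integral_cong) (simp add: SUP_mult_right_ennreal)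
      also have "\<dots> = (SUP i. \<integral>\<^sup>+z\<in>sphere z0 r. U i z \<partial>hausdorff1_borel)"
      proof (rule nn_integral_monotone_convergence_SUP)
        show "incseq (\<lambda>i z. U i z * indicator (sphere z0 r) z)"
          by (auto simp: incseq_def le_fun_def intro!: mult_right_mono Umono)
      qed (rule borel_measurable_hausdorff1_borel, measurable)
      also have "\<dots> \<le> liminf (\<lambda>i. \<Lambda> i r)"
      proof (rule SUP_least, rule Liminf_bounded)
        fix i
        have "(\<integral>\<^sup>+z\<in>sphere z0 r. U i z \<partial>hausdorff1_borel) \<le> \<Lambda> j r" if "i \<le> j" for j
          by (rule order_trans[OF nn_integral_mono \<Lambda>(2)]) (intro mult_right_mono Umono that, simp)
        then show "\<forall>\<^sub>F j in sequentially. (\<integral>\<^sup>+z\<in>sphere z0 r. U i z \<partial>hausdorff1_borel) \<le> \<Lambda> j r"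
          by (auto intro: eventually_sequentiallyI)
      qed
      finally show ?thesis .
    qed
    have "(\<integral>\<^sup>+r. liminf (\<lambda>i. \<Lambda> i r) \<partial>lborel) \<le> liminf (\<lambda>i. \<integral>\<^sup>+r. \<Lambda> i r \<partial>lborel)"
      by (rule nn_integral_liminf) simp
    also have "\<dots> \<le> 4 * (\<integral>\<^sup>+z. (SUP i. U i z) \<partial>lborel)"
    proof -
      have "(\<integral>\<^sup>+r. \<Lambda> i r \<partial>lborel) \<le> 4 * (\<integral>\<^sup>+z. (SUP i. U i z) \<partial>lborel)" for i
        by (rule order_trans[OF \<Lambda>(3)]) (auto intro!: mult_left_mono nn_integral_mono SUP_upper)
      then show ?thesis by (intro Liminf_le) auto
    qed
    finally show "(\<integral>\<^sup>+r. liminf (\<lambda>i. \<Lambda> i r) \<partial>lborel) \<le> 4 * (\<integral>\<^sup>+z. (SUP i. U i z) \<partial>lborel)" .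
  qed
qed

text \<open>A covering set of diameter \<open>d\<close> meets only circles with radius in an
  interval of length \<open>2 * d\<close> and adds \<open>d\<close> to the premeasure for each, in
  total \<open>2 * d\<^sup>2\<close>; with the factor 2 of \<open>fine_cover\<close> this gives 4.
  Fatou's lemma handles the limit of vanishing mesh.\<close>

lemma coarea_bound_indicator_bounded:
  assumes E: "E \<in> sets borel" "bounded E"
  shows "coarea_bound z0 (indicator E)"
proof -
  have "\<forall>n. \<exists>U :: nat \<Rightarrow> complex set. E \<subseteq> (\<Union>i. U i) \<and> (\<forall>i. bounded (U i)) \<and>
      (\<forall>i. diameter (U i) \<le> 1 / real (Suc n)) \<and>
      (\<Sum>i. ennreal ((diameter (U i))\<^sup>2)) \<le> 2 * (emeasure lborel E + ennreal (1 / real (Suc n)))"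
    using fine_cover[OF E, of "1 / real (Suc n)" "1 / real (Suc n)" for n] by (metis of_nat_0_less_iff zero_less_Suc zero_less_divide_1_iff)
  then obtain U :: "nat \<Rightarrow> nat \<Rightarrow> complex set" where
    U: "\<And>n. E \<subseteq> (\<Union>i. U n i)" "\<And>n i. bounded (U n i)" "\<And>n i. diameter (U n i) \<le> 1 / real (Suc n)"
      "\<And>n. (\<Sum>i. ennreal ((diameter (U n i))\<^sup>2)) \<le> 2 * (emeasure lborel E + ennreal (1 / real (Suc n)))"
    by metis
  define c where "c n i = dist z0 (SOME x. x \<in> U n i)" for n i
  define J where "J n i = {c n i - diameter (U n i)..c n i + diameter (U n i)}" for n i
  define \<Lambda> where "\<Lambda> n r = (\<Sum>i. ennreal (diameter (U n i)) * indicator (J n i) r)" for n r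
  have [measurable]: "\<Lambda> n \<in> borel_measurable borel" for n unfolding \<Lambda>_def J_def by measurable
  have inJ: "r \<in> J n i" if "x \<in> U n i" "x \<in> sphere z0 r" for x n i r
  proof -
    have "(SOME x. x \<in> U n i) \<in> U n i" using that(1) by (rule someI)
    then have "dist x (SOME x. x \<in> U n i) \<le> diameter (U n i)"
      using diameter_bounded_bound[OF U(2) that(1)] by blast
    moreover have "r = dist z0 x" using that(2) by simp
    ultimately have "\<bar>r - c n i\<bar> \<le> diameter (U n i)"
      unfolding c_def by (metis (no_types, lifting) abs_dist_diff_le dist_commute order_trans)
    then show ?thesis by (auto simp: J_def abs_le_iff)
  qed
  have pre: "hausdorff1_premeasure (1 / real (Suc n)) (E \<inter> sphere z0 r) \<le> \<Lambda> n r" for n r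
  proof -
    define V where "V i = (if r \<in> J n i then U n i else {})" for i
    have "hausdorff1_premeasure (1 / real (Suc n)) (E \<inter> sphere z0 r) \<le> (\<Sum>i. ennreal (diameter (V i)))"
    proof (rule hausdorff1_premeasure_leI)
      show "E \<inter> sphere z0 r \<subseteq> (\<Union>i. V i)"
      proof
        fix x assume x: "x \<in> E \<inter> sphere z0 r"
        then obtain i where i: "x \<in> U n i" using U(1) by blast
        with x inJ have "x \<in> V i" by (simp add: V_def)
        then show "x \<in> (\<Union>i. V i)" by blast
      qed
    qed (use U in \<open>auto simp: V_def\<close>)
    also have "\<dots> = \<Lambda> n r"
      unfolding \<Lambda>_def by (intro suminf_cong) (simp add: V_def)
    finally show ?thesis .
  qed
  have H: "hausdorff1_outer (E \<inter> sphere z0 r) \<le> liminf (\<lambda>n. \<Lambda> n r)" for r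
  proof (rule hausdorff1_outer_le, rule Liminf_bounded)
    fix \<delta> :: real assume "0 < \<delta>"
    then obtain m where m: "1 / real (Suc m) < \<delta>"
      by (metis nat_approx_posE)
    have "hausdorff1_premeasure \<delta> (E \<inter> sphere z0 r) \<le> \<Lambda> n r" if "m \<le> n" for n
    proof (rule order_trans[OF hausdorff1_premeasure_antimono pre])
      have "1 / real (Suc n) \<le> 1 / real (Suc m)" using that by (simp add: frac_le)
      then show "1 / real (Suc n) \<le> \<delta>" using m by linarith
    qed
    then show "\<forall>\<^sub>F n in sequentially. hausdorff1_premeasure \<delta> (E \<inter> sphere z0 r) \<le> \<Lambda> n r"
      by (auto intro: eventually_sequentiallyI)
  qed
  have int: "(\<integral>\<^sup>+r. \<Lambda> n r \<partial>lborel) \<le> 4 * (emeasure lborel E + ennreal (1 / real (Suc n)))" for n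
  proof -
    have "(\<integral>\<^sup>+r. \<Lambda> n r \<partial>lborel) = (\<Sum>i. \<integral>\<^sup>+r. ennreal (diameter (U n i)) * indicator (J n i) r \<partial>lborel)"
      unfolding \<Lambda>_def by (rule nn_integral_suminf) (simp add: J_def)
    also have "\<dots> = (\<Sum>i. 2 * ennreal ((diameter (U n i))\<^sup>2))"
    proof (intro suminf_cong)
      fix i
      have d: "0 \<le> diameter (U n i)" using diameter_ge_0[OF U(2)] .
      have "(\<integral>\<^sup>+r. ennreal (diameter (U n i)) * indicator (J n i) r \<partial>lborel)
          = ennreal (diameter (U n i)) * ennreal (2 * diameter (U n i))"
        using d by (simp add: J_def nn_integral_cmult)
      also have "\<dots> = 2 * ennreal ((diameter (U n i))\<^sup>2)"
        using d by (simp add: ennreal_mult power2_eq_square mult_ac)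
      finally show "(\<integral>\<^sup>+r. ennreal (diameter (U n i)) * indicator (J n i) r \<partial>lborel)
          = 2 * ennreal ((diameter (U n i))\<^sup>2)" .
    qed
    also have "\<dots> = 2 * (\<Sum>i. ennreal ((diameter (U n i))\<^sup>2))" by simp
    also have "\<dots> \<le> 2 * (2 * (emeasure lborel E + ennreal (1 / real (Suc n))))"
      by (rule mult_left_mono[OF U(4)]) simp
    finally show ?thesis by (simp add: mult.assoc[symmetric])
  qed
  show ?thesis
    unfolding coarea_bound_def
  proof (intro bexI conjI allI)
    show "(\<lambda>r. liminf (\<lambda>n. \<Lambda> n r)) \<in> borel_measurable borel" by measurable
    show "(\<integral>\<^sup>+z\<in>sphere z0 r. indicator E z \<partial>hausdorff1_borel) \<le> liminf (\<lambda>n. \<Lambda> n r)" for r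
    proof -
      have "(\<integral>\<^sup>+z\<in>sphere z0 r. indicator E z \<partial>hausdorff1_borel)
          = (\<integral>\<^sup>+z. indicator (E \<inter> sphere z0 r) z \<partial>hausdorff1_borel)"
        by (intro nn_integral_cong) (simp add: indicator_inter_arith)
      also have "\<dots> = hausdorff1_outer (E \<inter> sphere z0 r)"
        using E by (simp add: emeasure_hausdorff1_borel)
      finally show ?thesis using H by simp
    qed
    have "(\<integral>\<^sup>+r. liminf (\<lambda>n. \<Lambda> n r) \<partial>lborel) \<le> liminf (\<lambda>n. \<integral>\<^sup>+r. \<Lambda> n r \<partial>lborel)"
      by (rule nn_integral_liminf) simp
    also have "\<dots> \<le> liminf (\<lambda>n. 4 * (emeasure lborel E + ennreal (1 / real (Suc n))))"
      by (intro Liminf_mono always_eventually allI int)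
    also have "\<dots> = 4 * (emeasure lborel E + ennreal 0)"
    proof (rule lim_imp_Liminf)
      have "(\<lambda>n. ennreal (1 / real (Suc n))) \<longlonglongrightarrow> ennreal 0"
        by (intro tendsto_ennrealI LIMSEQ_Suc lim_1_over_n)
      then have "(\<lambda>n. emeasure lborel E + ennreal (1 / real (Suc n))) \<longlonglongrightarrow> emeasure lborel E + ennreal 0"
        by (intro tendsto_add tendsto_const)
      then show "(\<lambda>n. 4 * (emeasure lborel E + ennreal (1 / real (Suc n)))) \<longlonglongrightarrow> 4 * (emeasure lborel E + ennreal 0)"
        by (intro ennreal_tendsto_cmult) auto
    qed simp
    finally show "(\<integral>\<^sup>+r. liminf (\<lambda>n. \<Lambda> n r) \<partial>lborel) \<le> 4 * (\<integral>\<^sup>+z. indicator E z \<partial>lborel)"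
      using E by simp
  qed
qed

lemma coarea_inequality:
  assumes "p \<in> borel_measurable borel"
  shows "coarea_bound z0 p"
  using assms
proof (induction rule: borel_measurable_induct)
  case (cong f g)
  then have "f = g" by (simp add: fun_eq_iff)
  with cong(4) show ?case by (simp only:)
next
  case (set A)
  define E where "E n = A \<inter> ball 0 (real n)" for n
  have "(SUP n. indicator (E n) z) = (indicator A z :: ennreal)" for z
  proof (rule antisym)
    show "(SUP n. indicator (E n) z) \<le> (indicator A z :: ennreal)"
      by (intro SUP_least) (auto simp: E_def indicator_def)
    obtain n where "cmod z < real n" using reals_Archimedean2 by blast
    then show "indicator A z \<le> (SUP n. indicator (E n) z :: ennreal)"
      by (intro SUP_upper2[of n]) (auto simp: E_def indicator_def)
  qed
  then have "(\<lambda>z. SUP n. indicator (E n) z) = (indicator A :: complex \<Rightarrow> ennreal)"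
    by (rule ext)
  moreover have "coarea_bound z0 (\<lambda>z. SUP n. indicator (E n) z)"
  proof (rule coarea_bound_SUP)
    show "indicator (E i) \<in> borel_measurable borel" "coarea_bound z0 (indicator (E i))" for i
      unfolding E_def using set
      by (intro borel_measurable_indicator coarea_bound_indicator_bounded bounded_Int; auto)+
    show "incseq (\<lambda>n. indicator (E n) :: complex \<Rightarrow> ennreal)"
      by (auto simp: incseq_def le_fun_def E_def indicator_def)
  qed
  ultimately show ?case by (simp only:)
next
  case (mult u c)
  note [measurable] = mult.hyps(2)
  from mult obtain \<Lambda> where \<Lambda>: "\<Lambda> \<in> borel_measurable borel"
    "\<And>r. (\<integral>\<^sup>+z\<in>sphere z0 r. u z \<partial>hausdorff1_borel) \<le> \<Lambda> r" "(\<integral>\<^sup>+r. \<Lambda> r \<partial>lborel) \<le> 4 * (\<integral>\<^sup>+z. u z \<partial>lborel)"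
    unfolding coarea_bound_def by metis
  note [measurable] = \<Lambda>(1)
  show ?case unfolding coarea_bound_def
  proof (intro bexI conjI allI)
    show "(\<integral>\<^sup>+z\<in>sphere z0 r. c * u z \<partial>hausdorff1_borel) \<le> c * \<Lambda> r" for r
      using mult_left_mono[OF \<Lambda>(2)[of r], of c] by (simp add: nn_integral_cmult mult.assoc)
    show "(\<integral>\<^sup>+r. c * \<Lambda> r \<partial>lborel) \<le> 4 * (\<integral>\<^sup>+z. c * u z \<partial>lborel)"
      using mult_left_mono[OF \<Lambda>(3), of c] by (simp add: nn_integral_cmult mult.left_commute)
  qed measurable
next
  case (add u v)
  note [measurable] = add.hyps(1,3)
  from add obtain \<Lambda> where \<Lambda>: "\<Lambda> \<in> borel_measurable borel"
    "\<And>r. (\<integral>\<^sup>+z\<in>sphere z0 r. u z \<partial>hausdorff1_borel) \<le> \<Lambda> r" "(\<integral>\<^sup>+r. \<Lambda> r \<partial>lborel) \<le> 4 * (\<integral>\<^sup>+z. u z \<partial>lborel)"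
    unfolding coarea_bound_def by metis
  from add obtain \<Lambda>' where \<Lambda>': "\<Lambda>' \<in> borel_measurable borel"
    "\<And>r. (\<integral>\<^sup>+z\<in>sphere z0 r. v z \<partial>hausdorff1_borel) \<le> \<Lambda>' r" "(\<integral>\<^sup>+r. \<Lambda>' r \<partial>lborel) \<le> 4 * (\<integral>\<^sup>+z. v z \<partial>lborel)"
    unfolding coarea_bound_def by metis
  note [measurable] = \<Lambda>(1) \<Lambda>'(1)
  show ?case unfolding coarea_bound_def
  proof (intro bexI conjI allI)
    show "(\<integral>\<^sup>+z\<in>sphere z0 r. v z + u z \<partial>hausdorff1_borel) \<le> \<Lambda>' r + \<Lambda> r" for r
    proof -
      have "(\<integral>\<^sup>+z\<in>sphere z0 r. v z + u z \<partial>hausdorff1_borel) =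
          (\<integral>\<^sup>+z\<in>sphere z0 r. v z \<partial>hausdorff1_borel) + (\<integral>\<^sup>+z\<in>sphere z0 r. u z \<partial>hausdorff1_borel)"
        unfolding distrib_right
        by (rule nn_integral_add; rule borel_measurable_hausdorff1_borel, measurable)
      then show ?thesis using \<Lambda>(2)[of r] \<Lambda>'(2)[of r] by (simp only: add_mono)
    qed
    show "(\<integral>\<^sup>+r. \<Lambda>' r + \<Lambda> r \<partial>lborel) \<le> 4 * (\<integral>\<^sup>+z. v z + u z \<partial>lborel)"
      using \<Lambda>(3) \<Lambda>'(3) by (simp add: distrib_left nn_integral_add add_mono)
  qed measurable
next
  case (seq U)
  have "(SUP i. U i) = (\<lambda>z. SUP i. U i z)" by (simp add: fun_eq_iff image_comp)
  then show ?case using coarea_bound_SUP[of U z0] seq by simp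
qed


section \<open>Conformal pullback of densities\<close>

text \<open>A setwise bound between \<open>\<mu>\<close> on \<open>Y\<close> and the image under
  \<open>T\<close> of \<open>c\<close> times \<open>\<mu>\<close> on \<open>X\<close> is an
  inequality of measures and so passes to integrals. It replaces the change of variables formula:
  for lengths \<open>T\<close> is the map itself, for areas its inverse.\<close>

lemma nn_integral_transport_le:
  fixes \<mu> :: "'a :: topological_space measure"
  assumes \<mu>: "sets \<mu> = sets borel" and XY: "X \<in> sets borel" "Y \<in> sets borel"
    and T: "T \<in> borel_measurable borel" and P: "P \<in> borel_measurable borel"
    and le: "\<And>B. B \<in> sets borel \<Longrightarrow> emeasure \<mu> (Y \<inter> B) \<le> c * emeasure \<mu> (X \<inter> T -` B)"
  shows "(\<integral>\<^sup>+y\<in>Y. P y \<partial>\<mu>) \<le> c * (\<integral>\<^sup>+x\<in>X. P (T x) \<partial>\<mu>)"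
proof -
  have sp: "space \<mu> = UNIV" using sets_eq_imp_space_eq[OF \<mu>] by simp
  have m: "f \<in> borel_measurable \<mu>" if "f \<in> borel_measurable borel" for f :: "'a \<Rightarrow> ennreal"
    using that \<mu> by (simp cong: measurable_cong_sets)
  have T\<mu>: "T \<in> density \<mu> (\<lambda>x. c * indicator X x) \<rightarrow>\<^sub>M borel"
    using T \<mu> by (simp cong: measurable_cong_sets)
  define N where "N = distr (density \<mu> (\<lambda>x. c * indicator X x)) borel T"
  have "density \<mu> (indicator Y) \<le> N"
  proof (subst le_measure)
    show "sets (density \<mu> (indicator Y)) = sets N" using \<mu> by (simp add: N_def)
    show "\<forall>B\<in>sets (density \<mu> (indicator Y)). emeasure (density \<mu> (indicator Y)) B \<le> emeasure N B"
    proof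
      fix B assume "B \<in> sets (density \<mu> (indicator Y))"
      then have B: "B \<in> sets borel" using \<mu> by simp
      have TB: "T -` B \<in> sets borel" using measurable_sets[OF T B] by simp
      have "emeasure (density \<mu> (indicator Y)) B = (\<integral>\<^sup>+x. indicator Y x * indicator B x \<partial>\<mu>)"
        using B XY \<mu> by (intro emeasure_density m) auto
      also have "\<dots> = (\<integral>\<^sup>+x. indicator (Y \<inter> B) x \<partial>\<mu>)"
        by (intro nn_integral_cong) (simp add: indicator_inter_arith)
      also have "\<dots> = emeasure \<mu> (Y \<inter> B)" using B XY \<mu> by simp
      also have "\<dots> \<le> c * emeasure \<mu> (X \<inter> T -` B)" by (rule le[OF B])
      also have "\<dots> = (\<integral>\<^sup>+x. c * indicator (X \<inter> T -` B) x \<partial>\<mu>)"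
        using TB XY \<mu> by (simp add: nn_integral_cmult_indicator)
      also have "\<dots> = emeasure (density \<mu> (\<lambda>x. c * indicator X x)) (T -` B)"
        using TB XY \<mu> by (subst emeasure_density) (auto intro!: m simp: indicator_inter_arith mult.assoc)
      also have "\<dots> = emeasure N B"
        unfolding N_def using T\<mu> B by (subst emeasure_distr) (auto simp: sp)
      finally show "emeasure (density \<mu> (indicator Y)) B \<le> emeasure N B" .
    qed
  qed
  then have "(\<integral>\<^sup>+y. P y \<partial>density \<mu> (indicator Y)) \<le> (\<integral>\<^sup>+y. P y \<partial>N)"
    by (intro nn_integral_mono_measure) (simp_all add: N_def \<mu>)
  also have "(\<integral>\<^sup>+y. P y \<partial>density \<mu> (indicator Y)) = (\<integral>\<^sup>+y\<in>Y. P y \<partial>\<mu>)"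
    using P XY by (subst nn_integral_density) (auto intro!: m simp: mult.commute)
  also have "(\<integral>\<^sup>+y. P y \<partial>N) = (\<integral>\<^sup>+x. P (T x) \<partial>density \<mu> (\<lambda>x. c * indicator X x))"
    unfolding N_def using T\<mu> P by (intro nn_integral_distr) auto
  also have "\<dots> = (\<integral>\<^sup>+x. c * indicator X x * P (T x) \<partial>\<mu>)"
    using P XY T by (subst nn_integral_density) (auto intro!: m)
  also have "\<dots> = (\<integral>\<^sup>+x. c * (P (T x) * indicator X x) \<partial>\<mu>)"
    by (intro nn_integral_cong) (simp add: mult_ac)
  also have "\<dots> = c * (\<integral>\<^sup>+x\<in>X. P (T x) \<partial>\<mu>)"
  proof (rule nn_integral_cmult, rule m)
    have [measurable]: "T \<in> borel_measurable borel" "P \<in> borel_measurable borel" "X \<in> sets borel" by fact+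
    show "(\<lambda>x. P (T x) * indicator X x) \<in> borel_measurable borel" by measurable
  qed
  finally show ?thesis .
qed

lemma borel_measurable_extend_by_0:
  fixes f :: "complex \<Rightarrow> complex"
  assumes "continuous_on D f" "D \<in> sets borel"
  shows "(\<lambda>z. if z \<in> D then f z else 0) \<in> borel_measurable borel"
proof -
  have "(\<lambda>z. indicator D z *\<^sub>R f z) \<in> borel_measurable borel"
    using assms by (intro borel_measurable_continuous_on_indicator)
  moreover have "(\<lambda>z. indicator D z *\<^sub>R f z) = (\<lambda>z. if z \<in> D then f z else 0)" by auto
  ultimately show ?thesis by simp
qed

text \<open>The image is the preimage of \<open>A\<close> under the inverse map, which is Borel once
  extended by 0.\<close>

lemma homeomorphism_image_borel:
  fixes f :: "complex \<Rightarrow> complex"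
  assumes "homeomorphism D D' f g" "D' \<in> sets borel" "A \<in> sets borel" "A \<subseteq> D"
  shows "f ` A \<in> sets borel"
proof -
  define k where "k w = (if w \<in> D' then g w else 0)" for w
  have "k \<in> borel_measurable borel"
    unfolding k_def using assms(1,2) by (intro borel_measurable_extend_by_0) (auto simp: homeomorphism_def)
  then have "k -` A \<in> sets borel" using assms(3) measurable_sets[of k borel borel A] by simp
  moreover have "f ` A = D' \<inter> k -` A"
  proof (intro equalityI subsetI)
    fix w assume "w \<in> f ` A"
    then obtain z where "z \<in> A" "w = f z" by blast
    moreover from this have "z \<in> D" using assms(4) by blast
    ultimately show "w \<in> D' \<inter> k -` A"
      using assms(1) by (auto simp: k_def homeomorphism_def)
  next
    fix w assume w: "w \<in> D' \<inter> k -` A"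
    then have "g w \<in> A" by (auto simp: k_def split: if_splits)
    moreover have "w = f (g w)" using w assms(1) by (auto simp: homeomorphism_def)
    ultimately show "w \<in> f ` A" by blast
  qed
  ultimately show ?thesis using assms(2) by simp
qed

lemma holomorphic_injective_homeomorphism:
  assumes "G holomorphic_on D" "open D" "inj_on G D"
  obtains k where "homeomorphism D (G ` D) G k" "open (G ` D)"
proof -
  obtain k where k: "k holomorphic_on (G ` D)" "\<And>z. z \<in> D \<Longrightarrow> k (G z) = z"
    using holomorphic_has_inverse[OF assms] by metis
  have "homeomorphism D (G ` D) G k"
    using k assms(1) by (auto simp: homeomorphism_def holomorphic_on_imp_continuous_on image_iff)
  moreover have "open (G ` D)" using open_mapping_thm3 assms by blast
  ultimately show ?thesis by (rule that)
qed

text \<open>Where the derivative stays within \<open>cmod c / 2\<close> of its value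
  \<open>c\<close> at \<open>w\<close>, distances change by a factor between
  \<open>cmod c / 2\<close> and \<open>3 / 2 * cmod c\<close>; the quotient of the two is the
  3.\<close>

lemma injective_holomorphic_bilipschitz_near:
  assumes G: "G holomorphic_on D" "open D" "inj_on G D" and w: "w \<in> D"
  obtains e m where "0 < e" "0 < m" "ball w e \<subseteq> D"
    "\<And>x y. x \<in> ball w e \<Longrightarrow> y \<in> ball w e \<Longrightarrow> dist (G x) (G y) \<le> m * dist x y \<and> m * dist x y \<le> 3 * dist (G x) (G y)"
proof -
  define c where "c = deriv G w"
  have c: "c \<noteq> 0" unfolding c_def by (rule holomorphic_injective_imp_regular[OF G w])
  have "continuous_on D (deriv G)"
    using G by (intro holomorphic_on_imp_continuous_on holomorphic_deriv)
  then have "isCont (deriv G) w" using G(2) w continuous_on_eq_continuous_at by blast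
  then obtain d where d: "0 < d" "\<And>z. dist z w < d \<Longrightarrow> dist (deriv G z) c < cmod c / 2"
    unfolding continuous_at_eps_delta c_def using c[unfolded c_def] by (meson half_gt_zero zero_less_norm_iff)
  obtain e where e: "0 < e" "ball w e \<subseteq> D" "e \<le> d"
  proof -
    obtain e' where "0 < e'" "ball w e' \<subseteq> D" using G(2) w openE by blast
    then show ?thesis using d(1) by (intro that[of "min e' d"]) auto
  qed
  \<comment> \<open>Mean value inequality for \<open>G x - c * x\<close>, on a disk because
    convexity is needed.\<close>
  have *: "cmod ((G x - c * x) - (G y - c * y)) \<le> cmod c / 2 * cmod (x - y)"
    if xy: "x \<in> ball w e" "y \<in> ball w e" for x y
  proof (rule field_differentiable_bound[where S = "ball w e" and f' = "\<lambda>z. deriv G z - c"])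
    show "((\<lambda>x. G x - c * x) has_field_derivative deriv G z - c) (at z within ball w e)"
      if "z \<in> ball w e" for z
      using that e G by (auto intro!: derivative_eq_intros holomorphic_derivI[OF G(1,2)])
    show "cmod (deriv G z - c) \<le> cmod c / 2" if "z \<in> ball w e" for z
      using that d(2)[of z] e by (auto simp: dist_norm dist_commute norm_minus_commute)
  qed (use xy in auto)
  show ?thesis
  proof (rule that[of e "3 / 2 * cmod c"])
    fix x y assume xy: "x \<in> ball w e" "y \<in> ball w e"
    have 1: "cmod (c * (x - y)) = cmod c * dist x y" by (simp add: norm_mult dist_norm)
    have 2: "cmod ((G x - G y) - c * (x - y)) \<le> cmod c / 2 * dist x y"
      using *[OF xy] by (simp add: algebra_simps dist_norm)
    have "dist (G x) (G y) \<le> cmod ((G x - G y) - c * (x - y)) + cmod (c * (x - y))"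
      unfolding dist_norm by (metis diff_add_cancel norm_triangle_ineq)
    moreover have "cmod (c * (x - y)) \<le> cmod ((G x - G y) - c * (x - y)) + dist (G x) (G y)"
      unfolding dist_norm by (metis norm_triangle_sub norm_minus_commute add.commute)
    ultimately show "dist (G x) (G y) \<le> 3 / 2 * cmod c * dist x y \<and> 3 / 2 * cmod c * dist x y \<le> 3 * dist (G x) (G y)"
      using 1 2 by simp
  qed (use e c in auto)
qed

text \<open>By Lindelof, countably many open sets carrying the estimate cover \<open>D\<close>;
  making them disjoint keeps it, since it passes to subsets.\<close>

lemma injective_holomorphic_bilipschitz_partition:
  assumes G: "G holomorphic_on D" "open D" "inj_on G D"
  obtains E :: "nat \<Rightarrow> complex set" and m :: "nat \<Rightarrow> real" where
    "\<And>i. E i \<in> sets borel" "disjoint_family E" "(\<Union>i. E i) = D" "\<And>i. 0 < m i"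
    "\<And>i x y. x \<in> E i \<Longrightarrow> y \<in> E i \<Longrightarrow> dist (G x) (G y) \<le> m i * dist x y \<and> m i * dist x y \<le> 3 * dist (G x) (G y)"
proof (cases "D = {}")
  case True
  show ?thesis by (rule that[of "\<lambda>_. {}" "\<lambda>_. 1"]) (auto simp: True disjoint_family_on_def)
next
  case False
  define bl where "bl U m \<longleftrightarrow> 0 < m \<and> (\<forall>x\<in>U. \<forall>y\<in>U. dist (G x) (G y) \<le> m * dist x y \<and> m * dist x y \<le> 3 * dist (G x) (G y))"
    for U and m :: real
  define \<F> where "\<F> = {U. open U \<and> U \<subseteq> D \<and> (\<exists>m. bl U m)}"
  have "\<Union>\<F> = D"
  proof (intro equalityI subsetI)
    fix w assume w: "w \<in> D"
    obtain e m where "0 < e" "0 < m" "ball w e \<subseteq> D"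
      "\<And>x y. x \<in> ball w e \<Longrightarrow> y \<in> ball w e \<Longrightarrow> dist (G x) (G y) \<le> m * dist x y \<and> m * dist x y \<le> 3 * dist (G x) (G y)"
      using injective_holomorphic_bilipschitz_near[OF G w] by metis
    then have "ball w e \<in> \<F>" "w \<in> ball w e" unfolding \<F>_def bl_def by auto
    then show "w \<in> \<Union>\<F>" by blast
  qed (auto simp: \<F>_def)
  moreover have "\<And>U. U \<in> \<F> \<Longrightarrow> open U" by (simp add: \<F>_def)
  ultimately obtain \<F>' where F': "\<F>' \<subseteq> \<F>" "countable \<F>'" "\<Union>\<F>' = D"
    by (metis Lindelof)
  then have ne: "\<F>' \<noteq> {}" using False by auto
  define U where "U = from_nat_into \<F>'"
  have UF: "U i \<in> \<F>'" for i unfolding U_def by (rule from_nat_into[OF ne])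
  have rU: "range U = \<F>'" unfolding U_def using ne F'(2) by (rule range_from_nat_into)
  have "\<exists>m. bl (U i) m" for i using UF F'(1) by (auto simp: \<F>_def)
  then obtain m where m: "\<And>i. bl (U i) (m i)" by metis
  show ?thesis
  proof (rule that[of "disjointed U" m])
    have "open (U i)" for i using UF F'(1) by (auto simp: \<F>_def)
    then have "range U \<subseteq> sets borel" by auto
    then show "disjointed U i \<in> sets borel" for i
      using sets.range_disjointed_sets by blast
    show "(\<Union>i. disjointed U i) = D"
      unfolding UN_disjointed_eq using rU F'(3) by simp
    show "0 < m i" for i using m by (auto simp: bl_def)
    show "dist (G x) (G y) \<le> m i * dist x y \<and> m i * dist x y \<le> 3 * dist (G x) (G y)"
      if "x \<in> disjointed U i" "y \<in> disjointed U i" for i x y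
      using that m disjointed_subset[of U i] unfolding bl_def by blast
  qed (rule disjoint_family_disjointed)
qed

lemma nn_integral_disjoint_UN:
  fixes X :: "nat \<Rightarrow> 'a :: topological_space set"
  assumes "sets \<mu> = sets borel" "\<And>i. X i \<in> sets borel" "disjoint_family X" "p \<in> borel_measurable borel"
  shows "(\<integral>\<^sup>+z\<in>(\<Union>i. X i). p z \<partial>\<mu>) = (\<Sum>i. \<integral>\<^sup>+z\<in>X i. p z \<partial>\<mu>)"
proof -
  have [measurable]: "p \<in> borel_measurable borel" "\<And>i. X i \<in> sets borel" by fact+
  have "(\<integral>\<^sup>+z\<in>(\<Union>i. X i). p z \<partial>\<mu>) = (\<integral>\<^sup>+z. (\<Sum>i. p z * indicator (X i) z) \<partial>\<mu>)"
    using assms(3) by (intro nn_integral_cong) (simp add: suminf_indicator)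
  also have "\<dots> = (\<Sum>i. \<integral>\<^sup>+z\<in>X i. p z \<partial>\<mu>)"
  proof (rule nn_integral_suminf)
    have "(\<lambda>z. p z * indicator (X i) z) \<in> borel_measurable borel" for i by measurable
    then show "(\<lambda>z. p z * indicator (X i) z) \<in> borel_measurable \<mu>" for i
      using assms(1) by (simp cong: measurable_cong_sets)
  qed
  finally show ?thesis .
qed

text \<open>\<open>T P\<close> is, up to bounded factors, the pullback \<open>\<bar>G'\<bar> \<cdot> (P \<circ> G)\<close> of the metric density \<open>P\<close>.\<close>

lemma conformal_pullback:
  assumes G: "G holomorphic_on D" "open D" "inj_on G D" and bd: "bounded (G ` D)"
  obtains T :: "(complex \<Rightarrow> ennreal) \<Rightarrow> complex \<Rightarrow> ennreal" where
    "\<And>P. P \<in> borel_measurable borel \<Longrightarrow> T P \<in> borel_measurable borel"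
    "\<And>P. P \<in> borel_measurable borel \<Longrightarrow>
       (\<integral>\<^sup>+z. (T P z)\<^sup>2 \<partial>lborel) \<le> ennreal (18 * pi) * (\<integral>\<^sup>+w. (P w)\<^sup>2 \<partial>lborel)"
    "\<And>P A. P \<in> borel_measurable borel \<Longrightarrow> A \<in> sets borel \<Longrightarrow> A \<subseteq> D \<Longrightarrow>
       (\<integral>\<^sup>+w\<in>G ` A. P w \<partial>hausdorff1_borel) \<le> (\<integral>\<^sup>+z\<in>A. T P z \<partial>hausdorff1_borel)"
proof -
  obtain k where k: "homeomorphism D (G ` D) G k" and oG: "open (G ` D)"
    using holomorphic_injective_homeomorphism[OF G] by metis
  obtain E :: "nat \<Rightarrow> complex set" and m :: "nat \<Rightarrow> real" where
    E: "\<And>i. E i \<in> sets borel" "disjoint_family E" "(\<Union>i. E i) = D" and m: "\<And>i. 0 < m i" and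
    bl: "\<And>i x y. x \<in> E i \<Longrightarrow> y \<in> E i \<Longrightarrow> dist (G x) (G y) \<le> m i * dist x y \<and> m i * dist x y \<le> 3 * dist (G x) (G y)"
    using injective_holomorphic_bilipschitz_partition[OF G] by metis
  note [measurable] = E(1)
  define G' where "G' z = (if z \<in> D then G z else 0)" for z
  define k' where "k' w = (if w \<in> G ` D then k w else 0)" for w
  have [measurable]: "G' \<in> borel_measurable borel" "k' \<in> borel_measurable borel"
    unfolding G'_def k'_def using G(2) oG k
    by (auto intro!: borel_measurable_extend_by_0 simp: homeomorphism_def)
  have ED: "E i \<subseteq> D" for i using E(3) by blast
  have EDm: "z \<in> D" if "z \<in> E i" for z i using ED that by blast
  have kG: "k (G z) = z" if "z \<in> D" for z using k that by (auto simp: homeomorphism_def)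
  have k'G: "k' (G z) = z" if "z \<in> D" for z using kG that by (auto simp: k'_def)
  have imgB: "G ` A \<in> sets borel" if "A \<in> sets borel" "A \<subseteq> D" for A
    by (rule homeomorphism_image_borel[OF k borel_open[OF oG] that])
  \<comment> \<open>\<open>wt\<close> plays the role of the modulus of the derivative: on each piece
    it is the upper Lipschitz constant.\<close>
  define wt where "wt z = (\<Sum>i. ennreal (m i) * indicator (E i) z)" for z
  have [measurable]: "wt \<in> borel_measurable borel" unfolding wt_def by measurable
  have wt: "wt z = ennreal (m i)" if "z \<in> E i" for z i
  proof -
    have "wt z = (\<Sum>j\<in>{i}. ennreal (m j) * indicator (E j) z)"
      unfolding wt_def using E(2) that
      by (intro suminf_finite) (auto simp: disjoint_family_on_def indicator_def)
    then show ?thesis using that by simp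
  qed
  define T where "T P z = wt z * P (G' z) * indicator D z" for P :: "complex \<Rightarrow> ennreal" and z
  have disjG: "disjoint_family (\<lambda>i. G ` (A \<inter> E i))" for A
    unfolding disjoint_family_on_def
  proof (intro ballI impI)
    fix i j :: nat assume "i \<noteq> j"
    then have "(A \<inter> E i) \<inter> (A \<inter> E j) = {}" using E(2) unfolding disjoint_family_on_def by blast
    moreover have "G ` ((A \<inter> E i) \<inter> (A \<inter> E j)) = G ` (A \<inter> E i) \<inter> G ` (A \<inter> E j)"
      using ED[of i] ED[of j] by (intro inj_on_image_Int[OF G(3)]) (simp_all add: le_infI2)
    ultimately show "G ` (A \<inter> E i) \<inter> G ` (A \<inter> E j) = {}"
      by (simp only: image_empty)
  qed
  have Tm: "T P \<in> borel_measurable borel" if [measurable]: "P \<in> borel_measurable borel" for P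
  proof -
    have [measurable]: "D \<in> sets borel" using G(2) by simp
    show ?thesis unfolding T_def by measurable
  qed
  show ?thesis
  proof (rule that[of T])
    fix P :: "complex \<Rightarrow> ennreal" assume P[measurable]: "P \<in> borel_measurable borel"
    show "T P \<in> borel_measurable borel" by (rule Tm) fact
    have "(\<integral>\<^sup>+z. (T P z)\<^sup>2 \<partial>lborel) = (\<integral>\<^sup>+z\<in>(\<Union>i. E i). (T P z)\<^sup>2 \<partial>lborel)"
      unfolding E(3) by (intro nn_integral_cong) (auto simp: T_def indicator_def)
    also have "\<dots> = (\<Sum>i. \<integral>\<^sup>+z\<in>E i. (T P z)\<^sup>2 \<partial>lborel)"
      using Tm[OF P] E by (intro nn_integral_disjoint_UN) auto
    also have "\<dots> \<le> (\<Sum>i. ennreal (18 * pi) * (\<integral>\<^sup>+w\<in>G ` E i. (P w)\<^sup>2 \<partial>lborel))"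
    proof (rule suminf_le)
      fix i
      \<comment> \<open>Areas are compared through the inverse, with Lipschitz constant
        \<open>3 / m i\<close> on the piece; \<open>2 * pi * 9\<close> is the source of
        \<open>18 * pi\<close>.\<close>
      have "(\<integral>\<^sup>+z\<in>E i. (P (G' z))\<^sup>2 \<partial>lborel) \<le> ennreal (2 * pi * (3 / m i)\<^sup>2) * (\<integral>\<^sup>+w\<in>G ` E i. (P (G' (k' w)))\<^sup>2 \<partial>lborel)"
      proof (rule nn_integral_transport_le)
        show "G ` E i \<in> sets borel" by (rule imgB) (use ED in auto)
        fix B :: "complex set" assume B: "B \<in> sets borel"
        have kB: "G ` E i \<inter> k' -` B = G ` (E i \<inter> B)"
        proof (intro equalityI subsetI)
          fix w assume "w \<in> G ` E i \<inter> k' -` B"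
          then obtain z where "z \<in> E i" "w = G z" "k' w \<in> B" by blast
          then show "w \<in> G ` (E i \<inter> B)" using k'G[of z] EDm[of z i] by auto
        next
          fix w assume "w \<in> G ` (E i \<inter> B)"
          then obtain z where "z \<in> E i" "w = G z" "z \<in> B" by blast
          then show "w \<in> G ` E i \<inter> k' -` B" using k'G[of z] EDm[of z i] by auto
        qed
        have GEB: "G ` (E i \<inter> B) \<in> sets borel" by (rule imgB) (use ED B in auto)
        have "emeasure lborel (E i \<inter> B) \<le> ennreal (2 * pi * (3 / m i)\<^sup>2) * emeasure lborel (G ` (E i \<inter> B))"
        proof (rule emeasure_lipschitz_image_le[where k=k])
          show "bounded (G ` (E i \<inter> B))" by (rule bounded_subset[OF bd]) (use ED in blast)
          show "E i \<inter> B \<subseteq> k ` G ` (E i \<inter> B)"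
          proof
            fix z assume "z \<in> E i \<inter> B"
            moreover from this have "z = k (G z)" using kG EDm by auto
            ultimately show "z \<in> k ` G ` (E i \<inter> B)" by blast
          qed
          fix x y assume "x \<in> G ` (E i \<inter> B)" "y \<in> G ` (E i \<inter> B)"
          then obtain a b where ab: "a \<in> E i" "b \<in> E i" "x = G a" "y = G b" by blast
          then have "a \<in> D" "b \<in> D" using ED by blast+
          then show "dist (k x) (k y) \<le> 3 / m i * dist x y"
            using bl[OF ab(1,2)] m[of i] by (simp add: ab kG field_simps)
        qed (use m B GEB in auto)
        then show "emeasure lborel (E i \<inter> B) \<le> ennreal (2 * pi * (3 / m i)\<^sup>2) * emeasure lborel (G ` E i \<inter> k' -` B)"
          unfolding kB .
      qed auto
      also have "(\<integral>\<^sup>+w\<in>G ` E i. (P (G' (k' w)))\<^sup>2 \<partial>lborel) = (\<integral>\<^sup>+w\<in>G ` E i. (P w)\<^sup>2 \<partial>lborel)"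
      proof (rule nn_integral_cong)
        fix w
        have "G' (k' w) = w" if wi: "w \<in> G ` E i"
        proof -
          obtain z where "z \<in> E i" "w = G z" using wi by blast
          then show ?thesis using EDm[of z i] k'G[of z] by (auto simp: G'_def)
        qed
        then show "(P (G' (k' w)))\<^sup>2 * indicator (G ` E i) w = (P w)\<^sup>2 * indicator (G ` E i) w"
          by (auto simp: indicator_def)
      qed
      finally have le: "(\<integral>\<^sup>+z\<in>E i. (P (G' z))\<^sup>2 \<partial>lborel) \<le> ennreal (2 * pi * (3 / m i)\<^sup>2) * (\<integral>\<^sup>+w\<in>G ` E i. (P w)\<^sup>2 \<partial>lborel)" .
      have "(\<integral>\<^sup>+z\<in>E i. (T P z)\<^sup>2 \<partial>lborel) = (\<integral>\<^sup>+z. ennreal ((m i)\<^sup>2) * ((P (G' z))\<^sup>2 * indicator (E i) z) \<partial>lborel)"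
        using ED[of i] m[of i]
        by (intro nn_integral_cong) (auto simp: T_def wt indicator_def power_mult_distrib ennreal_power)
      also have "\<dots> = ennreal ((m i)\<^sup>2) * (\<integral>\<^sup>+z\<in>E i. (P (G' z))\<^sup>2 \<partial>lborel)"
        by (rule nn_integral_cmult) measurable
      also have "\<dots> \<le> ennreal ((m i)\<^sup>2) * (ennreal (2 * pi * (3 / m i)\<^sup>2) * (\<integral>\<^sup>+w\<in>G ` E i. (P w)\<^sup>2 \<partial>lborel))"
        using le by (rule mult_left_mono) simp
      also have "\<dots> = ennreal ((m i)\<^sup>2 * (2 * pi * (3 / m i)\<^sup>2)) * (\<integral>\<^sup>+w\<in>G ` E i. (P w)\<^sup>2 \<partial>lborel)"
        by (subst ennreal_mult) (auto simp: mult.assoc)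
      also have "(m i)\<^sup>2 * (2 * pi * (3 / m i)\<^sup>2) = 18 * pi"
        using m[of i] by (simp add: field_simps power2_eq_square)
      finally show "(\<integral>\<^sup>+z\<in>E i. (T P z)\<^sup>2 \<partial>lborel) \<le> ennreal (18 * pi) * (\<integral>\<^sup>+w\<in>G ` E i. (P w)\<^sup>2 \<partial>lborel)" .
    qed auto
    also have "\<dots> = ennreal (18 * pi) * (\<Sum>i. \<integral>\<^sup>+w\<in>G ` E i. (P w)\<^sup>2 \<partial>lborel)" by simp
    also have "(\<Sum>i. \<integral>\<^sup>+w\<in>G ` E i. (P w)\<^sup>2 \<partial>lborel) = (\<integral>\<^sup>+w\<in>(\<Union>i. G ` E i). (P w)\<^sup>2 \<partial>lborel)"
      using disjG[of UNIV] imgB ED E(1) by (intro nn_integral_disjoint_UN[symmetric]) auto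
    also have "ennreal (18 * pi) * \<dots> \<le> ennreal (18 * pi) * (\<integral>\<^sup>+w. (P w)\<^sup>2 \<partial>lborel)"
      by (intro mult_left_mono nn_integral_mono) (auto simp: indicator_def)
    finally show "(\<integral>\<^sup>+z. (T P z)\<^sup>2 \<partial>lborel) \<le> ennreal (18 * pi) * (\<integral>\<^sup>+w. (P w)\<^sup>2 \<partial>lborel)" .
  next
    fix P :: "complex \<Rightarrow> ennreal" and A
    assume P[measurable]: "P \<in> borel_measurable borel" and A[measurable]: "A \<in> sets borel" and AD: "A \<subseteq> D"
    have AE: "A \<inter> E i \<in> sets borel" "A \<inter> E i \<subseteq> D" for i using E(1) A AD by auto
    have "G ` A = (\<Union>i. G ` (A \<inter> E i))" using AD E(3) by blast
    then have "(\<integral>\<^sup>+w\<in>G ` A. P w \<partial>hausdorff1_borel) = (\<integral>\<^sup>+w\<in>(\<Union>i. G ` (A \<inter> E i)). P w \<partial>hausdorff1_borel)"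
      by simp
    also have "\<dots> = (\<Sum>i. \<integral>\<^sup>+w\<in>G ` (A \<inter> E i). P w \<partial>hausdorff1_borel)"
      using disjG imgB[OF AE] by (intro nn_integral_disjoint_UN) auto
    also have "\<dots> \<le> (\<Sum>i. \<integral>\<^sup>+z\<in>A \<inter> E i. T P z \<partial>hausdorff1_borel)"
    proof (rule suminf_le)
      fix i
      \<comment> \<open>Lengths are compared forward, with Lipschitz constant
        \<open>m i\<close>.\<close>
      have "(\<integral>\<^sup>+w\<in>G ` (A \<inter> E i). P w \<partial>hausdorff1_borel)
          \<le> ennreal (m i) * (\<integral>\<^sup>+z\<in>A \<inter> E i. P (G' z) \<partial>hausdorff1_borel)"
      proof (rule nn_integral_transport_le)
        show "G ` (A \<inter> E i) \<in> sets borel" by (rule imgB[OF AE])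
        fix B :: "complex set" assume B: "B \<in> sets borel"
        have GB: "G' -` B \<in> sets borel" using measurable_sets[of G' borel borel B] B by simp
        define S where "S = A \<inter> E i \<inter> G' -` B"
        have S: "S \<in> sets borel" "S \<subseteq> D" using AE GB by (auto simp: S_def)
        have eq: "G ` (A \<inter> E i) \<inter> B = G ` S"
          using AE(2)[of i] by (auto simp: S_def G'_def subset_iff)
        have "hausdorff1_outer (G ` S) \<le> ennreal (m i) * hausdorff1_outer S"
          by (rule hausdorff1_outer_lipschitz_image) (use m bl in \<open>auto simp: S_def\<close>)
        then have "emeasure hausdorff1_borel (G ` (A \<inter> E i) \<inter> B) \<le> ennreal (m i) * emeasure hausdorff1_borel S"
          unfolding eq using S imgB[OF S] by (simp add: emeasure_hausdorff1_borel)
        then show "emeasure hausdorff1_borel (G ` (A \<inter> E i) \<inter> B) \<le> ennreal (m i) * emeasure hausdorff1_borel (A \<inter> E i \<inter> G' -` B)"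
          by (simp add: S_def)
      qed auto
      also have "\<dots> = (\<integral>\<^sup>+z. ennreal (m i) * (P (G' z) * indicator (A \<inter> E i) z) \<partial>hausdorff1_borel)"
        by (rule nn_integral_cmult[symmetric], rule borel_measurable_hausdorff1_borel) measurable
      also have "\<dots> = (\<integral>\<^sup>+z\<in>A \<inter> E i. T P z \<partial>hausdorff1_borel)"
        using AD by (intro nn_integral_cong) (auto simp: T_def wt indicator_def)
      finally show "(\<integral>\<^sup>+w\<in>G ` (A \<inter> E i). P w \<partial>hausdorff1_borel) \<le> (\<integral>\<^sup>+z\<in>A \<inter> E i. T P z \<partial>hausdorff1_borel)" .
    qed auto
    also have "\<dots> = (\<integral>\<^sup>+z\<in>(\<Union>i. A \<inter> E i). T P z \<partial>hausdorff1_borel)"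
      using E(2) AE(1) Tm[OF P] by (intro nn_integral_disjoint_UN[symmetric]) (auto simp: disjoint_family_on_def)
    also have "(\<Union>i. A \<inter> E i) = A" using AD E(3) by blast
    finally show "(\<integral>\<^sup>+w\<in>G ` A. P w \<partial>hausdorff1_borel) \<le> (\<integral>\<^sup>+z\<in>A. T P z \<partial>hausdorff1_borel)" .
  qed
qed


section \<open>Length-area inequalities\<close>

lemma ennreal_power2_le_imp_le: "x\<^sup>2 \<le> y\<^sup>2 \<Longrightarrow> x \<le> y" for x y :: ennreal
proof (rule ccontr)
  assume le: "x\<^sup>2 \<le> y\<^sup>2" and "\<not> x \<le> y"
  then have lt: "y < x" by simp
  have "y < top" using lt by (rule order.strict_trans2) simp
  then obtain r where r: "y = ennreal r" "0 \<le> r" by (cases y) auto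
  show False
  proof (cases x)
    case (real s)
    then have "r < s" using lt r by (simp add: ennreal_less_iff)
    then show False using le real r by (simp add: ennreal_power ennreal_le_iff)
  next
    case top
    then show False using le r by (simp add: ennreal_power power2_eq_square ennreal_mult_top ennreal_top_mult top_unique flip: ennreal_mult)
  qed
qed

lemma annulus_in_borel [measurable]: "annulus z0 a b \<in> sets borel"
proof -
  have "annulus z0 a b = ball z0 b - cball z0 a"
    by (auto simp: annulus_def dist_norm norm_minus_commute)
  then show ?thesis by simp
qed

definition Q_annulus :: "(complex \<Rightarrow> real) \<Rightarrow> complex \<Rightarrow> real \<Rightarrow> real \<Rightarrow> ennreal" where
  "Q_annulus Q z0 a b = (\<integral>\<^sup>+z\<in>annulus z0 a b. ennreal (Q z / (cmod (z - z0))\<^sup>2) \<partial>lebesgue)"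

lemma Q_annulus_mono: "a' \<le> a \<Longrightarrow> b \<le> b' \<Longrightarrow> Q_annulus Q z0 a b \<le> Q_annulus Q z0 a' b'"
  unfolding Q_annulus_def by (intro nn_integral_mono) (auto simp: annulus_def indicator_def)

lemma Q_annulus_1_finite:
  assumes "0 < a"
  shows "Q_annulus (\<lambda>_. 1) z0 a b < top"
proof -
  have "Q_annulus (\<lambda>_. 1) z0 a b \<le> (\<integral>\<^sup>+z. ennreal (1 / a\<^sup>2) * indicator (ball z0 b) z \<partial>lborel)"
    unfolding Q_annulus_def nn_integral_completion
  proof (rule nn_integral_mono)
    fix z
    show "ennreal (1 / (cmod (z - z0))\<^sup>2) * indicator (annulus z0 a b) z \<le> ennreal (1 / a\<^sup>2) * indicator (ball z0 b) z"
    proof (cases "z \<in> annulus z0 a b")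
      case True
      then have "a\<^sup>2 \<le> (cmod (z - z0))\<^sup>2" using assms by (intro power_mono) (auto simp: annulus_def)
      then have "1 / (cmod (z - z0))\<^sup>2 \<le> 1 / a\<^sup>2" using assms by (intro frac_le) auto
      moreover have "z \<in> ball z0 b" using True by (auto simp: annulus_def dist_norm norm_minus_commute)
      ultimately show ?thesis using True by (simp add: ennreal_leI)
    qed simp
  qed
  also have "\<dots> = ennreal (1 / a\<^sup>2) * emeasure lborel (ball z0 b)"
    by (rule nn_integral_cmult_indicator) simp
  also have "\<dots> < top"
    using emeasure_bounded_finite[of "ball z0 b"] by (simp add: ennreal_mult_less_top)
  finally show ?thesis .
qed

text \<open>The coarea inequality is applied to \<open>p\<close> divided by the distance to
  \<open>z0\<close>: its integral over the circle of radius \<open>r\<close> is at least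
  \<open>1 / r\<close>, and these values integrate to the logarithm.\<close>

lemma ln_le_annulus_integral:
  assumes D[measurable]: "D \<in> sets borel" and ab: "0 < a" "a < b" and p[measurable]: "p \<in> borel_measurable borel"
    and ge: "\<And>r. a < r \<Longrightarrow> r < b \<Longrightarrow> 1 \<le> (\<integral>\<^sup>+z\<in>D \<inter> sphere z0 r. p z \<partial>hausdorff1_borel)"
  shows "ennreal (ln (b / a)) \<le> 4 * (\<integral>\<^sup>+z\<in>D \<inter> annulus z0 a b. p z / ennreal (cmod (z - z0)) \<partial>lborel)"
proof -
  define p' where "p' z = p z / ennreal (cmod (z - z0)) * indicator (D \<inter> annulus z0 a b) z" for z
  have [measurable]: "p' \<in> borel_measurable borel" unfolding p'_def by measurable
  obtain \<Lambda> where \<Lambda>[measurable]: "\<Lambda> \<in> borel_measurable borel"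
    and le: "\<And>r. (\<integral>\<^sup>+z\<in>sphere z0 r. p' z \<partial>hausdorff1_borel) \<le> \<Lambda> r"
    and int: "(\<integral>\<^sup>+r. \<Lambda> r \<partial>lborel) \<le> 4 * (\<integral>\<^sup>+z. p' z \<partial>lborel)"
    using coarea_inequality[of p' z0] unfolding coarea_bound_def by auto
  have \<Lambda>ge: "ennreal (1 / r) \<le> \<Lambda> r" if r: "a < r" "r < b" for r
  proof -
    have "ennreal (1 / r) * 1 \<le> ennreal (1 / r) * (\<integral>\<^sup>+z\<in>D \<inter> sphere z0 r. p z \<partial>hausdorff1_borel)"
      using ge[OF r] by (rule mult_left_mono) simp
    also have "\<dots> = (\<integral>\<^sup>+z. ennreal (1 / r) * (p z * indicator (D \<inter> sphere z0 r) z) \<partial>hausdorff1_borel)"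
      by (rule nn_integral_cmult[symmetric], rule borel_measurable_hausdorff1_borel) measurable
    also have "\<dots> = (\<integral>\<^sup>+z\<in>sphere z0 r. p' z \<partial>hausdorff1_borel)"
    proof (rule nn_integral_cong)
      fix z
      show "ennreal (1 / r) * (p z * indicator (D \<inter> sphere z0 r) z) = p' z * indicator (sphere z0 r) z"
      proof (cases "z \<in> D \<inter> sphere z0 r")
        case True
        then have "cmod (z - z0) = r" by (auto simp: dist_norm norm_minus_commute)
        then show ?thesis using True r ab
          by (simp add: p'_def annulus_def divide_ennreal_def inverse_ennreal inverse_eq_divide mult.commute)
      qed (auto simp: p'_def indicator_def)
    qed
    also have "\<dots> \<le> \<Lambda> r" by (rule le)
    finally show ?thesis by simp
  qed
  have "ennreal (ln (b / a)) = (\<integral>\<^sup>+r. ennreal (1 / r) * indicator {a..b} r \<partial>lborel)"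
  proof -
    have "(\<integral>\<^sup>+r. ennreal (1 / r) * indicator {a..b} r \<partial>lborel) = ln b - ln a"
    proof (rule nn_integral_FTC_Icc)
      show "DERIV ln x :> 1 / x" if "x \<in> {a..b}" for x
        using that ab DERIV_ln_divide[of x] by auto
    qed (use ab in auto)
    then show ?thesis using ab by (simp add: ln_div)
  qed
  also have "\<dots> \<le> (\<integral>\<^sup>+r. \<Lambda> r \<partial>lborel)"
  proof (rule nn_integral_mono_AE)
    have "AE r in lborel. r \<noteq> a" "AE r in lborel. r \<noteq> b" by (rule AE_lborel_singleton)+
    then show "AE r in lborel. ennreal (1 / r) * indicator {a..b} r \<le> \<Lambda> r"
    proof eventually_elim
      case (elim r)
      show ?case
      proof (cases "r \<in> {a..b}")
        case True
        then show ?thesis using elim \<Lambda>ge[of r] by simp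
      qed simp
    qed
  qed
  also note int
  finally show ?thesis unfolding p'_def .
qed

text \<open>The factors are \<open>\<rho> / sqrt Q\<close> and
  \<open>sqrt Q / cmod (z - z0)\<close>; only the first is restricted to \<open>D\<close>, so the
  second yields the integral over the full annulus.\<close>

lemma weighted_annulus_Cauchy_Schwarz:
  assumes \<rho>[measurable]: "\<rho> \<in> borel_measurable lebesgue" and D[measurable]: "D \<in> sets lebesgue"
    and Q[measurable]: "Q \<in> borel_measurable lebesgue" and Qpos: "\<And>z. 0 < Q z" and a: "0 < a"
  shows "(\<integral>\<^sup>+z\<in>D \<inter> annulus z0 a b. \<rho> z / ennreal (cmod (z - z0)) \<partial>lebesgue)\<^sup>2 \<le>
     (\<integral>\<^sup>+z\<in>D \<inter> annulus z0 a b. (\<rho> z)\<^sup>2 / ennreal (Q z) \<partial>lebesgue) * Q_annulus Q z0 a b"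
proof -
  have ann[measurable]: "annulus z0 a b \<in> sets lebesgue" by (simp add: annulus_in_borel)
  have cm[measurable]: "(\<lambda>z. cmod (z - z0)) \<in> borel_measurable lebesgue"
    by (rule measurable_completion) measurable
  define u where "u z = \<rho> z * ennreal (1 / sqrt (Q z)) * indicator (D \<inter> annulus z0 a b) z" for z
  define v where "v z = ennreal (sqrt (Q z) / cmod (z - z0)) * indicator (annulus z0 a b) z" for z
  have [measurable]: "u \<in> borel_measurable lebesgue" "v \<in> borel_measurable lebesgue"
    unfolding u_def v_def by measurable
  have "(\<integral>\<^sup>+z\<in>D \<inter> annulus z0 a b. \<rho> z / ennreal (cmod (z - z0)) \<partial>lebesgue) = (\<integral>\<^sup>+z. u z * v z \<partial>lebesgue)"
  proof (rule nn_integral_cong)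
    fix z
    show "\<rho> z / ennreal (cmod (z - z0)) * indicator (D \<inter> annulus z0 a b) z = u z * v z"
    proof (cases "z \<in> D \<inter> annulus z0 a b")
      case True
      then have "0 < cmod (z - z0)" using a unfolding annulus_def by auto
      moreover have "0 < sqrt (Q z)" using Qpos by simp
      ultimately show ?thesis
        using True by (simp add: u_def v_def divide_ennreal_def inverse_ennreal mult.assoc inverse_eq_divide flip: ennreal_mult)
    qed (auto simp: u_def)
  qed
  moreover have "(\<integral>\<^sup>+z. (u z)\<^sup>2 \<partial>lebesgue) = (\<integral>\<^sup>+z\<in>D \<inter> annulus z0 a b. (\<rho> z)\<^sup>2 / ennreal (Q z) \<partial>lebesgue)"
  proof (rule nn_integral_cong)
    fix z
    have "(ennreal (1 / sqrt (Q z)))\<^sup>2 = ennreal (1 / Q z)"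
      using Qpos[of z] by (simp add: ennreal_power power_divide)
    then show "(u z)\<^sup>2 = (\<rho> z)\<^sup>2 / ennreal (Q z) * indicator (D \<inter> annulus z0 a b) z"
      using Qpos[of z] by (auto simp: u_def power_mult_distrib divide_ennreal_def inverse_ennreal inverse_eq_divide indicator_def)
  qed
  moreover have "(\<integral>\<^sup>+z. (v z)\<^sup>2 \<partial>lebesgue) = Q_annulus Q z0 a b"
    unfolding Q_annulus_def
  proof (rule nn_integral_cong)
    fix z
    have "(ennreal (sqrt (Q z) / cmod (z - z0)))\<^sup>2 = ennreal (Q z / (cmod (z - z0))\<^sup>2)"
      using Qpos[of z] by (simp add: ennreal_power power_divide)
    then show "(v z)\<^sup>2 = ennreal (Q z / (cmod (z - z0))\<^sup>2) * indicator (annulus z0 a b) z"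
      by (auto simp: v_def power_mult_distrib indicator_def)
  qed
  ultimately show ?thesis using Cauchy_Schwarz_nn_integral[of u lebesgue v] by simp
qed

lemma ennreal_ln_square_le:
  assumes le: "ennreal l \<le> 4 * X" and sq: "X\<^sup>2 \<le> Y" and l: "0 \<le> l"
  shows "ennreal (l\<^sup>2) \<le> 16 * Y"
proof -
  have "ennreal (l\<^sup>2) = (ennreal l)\<^sup>2" using l by (simp add: ennreal_power)
  also have "\<dots> \<le> (4 * X)\<^sup>2" using le by (rule power_mono) simp
  also have "\<dots> = 16 * X\<^sup>2" by (simp add: power_mult_distrib)
  also have "\<dots> \<le> 16 * Y" using sq by (rule mult_left_mono) simp
  finally show ?thesis .
qed

lemma line_integral_section:
  "line_integral (D \<inter> sphere z0 r, \<lambda>z. z) \<rho> = (\<integral>\<^sup>+z\<in>D \<inter> sphere z0 r. \<rho> z \<partial>hausdorff1)"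
  unfolding line_integral_def multiplicity_at_def
proof (rule nn_integral_cong)
  fix w
  have "{t \<in> D \<inter> sphere z0 r. t = w} = (if w \<in> D \<inter> sphere z0 r then {w} else {})" by auto
  then show "\<rho> w * (case (D \<inter> sphere z0 r, \<lambda>z. z) of (\<Delta>, \<gamma>) \<Rightarrow> \<lambda>w. emeasure (count_space UNIV) {t \<in> \<Delta>. \<gamma> t = w}) w
      = \<rho> w * indicator (D \<inter> sphere z0 r) w"
    by (simp add: indicator_def)
qed

lemma line_integral_image_section:
  assumes "inj_on f D"
  shows "line_integral (D \<inter> sphere z0 r, f \<circ> (\<lambda>z. z)) \<rho> = (\<integral>\<^sup>+w\<in>f ` (D \<inter> sphere z0 r). \<rho> w \<partial>hausdorff1)"
  unfolding line_integral_def multiplicity_at_def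
proof (rule nn_integral_cong)
  fix w
  have "emeasure (count_space UNIV) {t \<in> D \<inter> sphere z0 r. f t = w} = indicator (f ` (D \<inter> sphere z0 r)) w"
  proof (cases "w \<in> f ` (D \<inter> sphere z0 r)")
    case True
    then obtain t where t: "t \<in> D \<inter> sphere z0 r" "w = f t" by blast
    then have "{t \<in> D \<inter> sphere z0 r. f t = w} = {t}" using assms by (auto dest: inj_onD)
    then show ?thesis using True by simp
  next
    case False
    then have "{t \<in> D \<inter> sphere z0 r. f t = w} = {}" by blast
    then have "emeasure (count_space UNIV) {t \<in> D \<inter> sphere z0 r. f t = w} = 0" by (simp only: emeasure_empty)
    then show ?thesis using False by simp
  qed
  then show "\<rho> w * (case (D \<inter> sphere z0 r, f \<circ> (\<lambda>z. z)) of (\<Delta>, \<gamma>) \<Rightarrow> \<lambda>w. emeasure (count_space UNIV) {t \<in> \<Delta>. \<gamma> t = w}) w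
      = \<rho> w * indicator (f ` (D \<inter> sphere z0 r)) w"
    by (simp add: comp_def)
qed

text \<open>The exceptional sections are removed by adding to \<open>\<rho>\<close> a density \<open>\<sigma>\<close> of arbitrarily small
  norm that is admissible for them.\<close>

lemma ln_le_ext_admissible:
  assumes D[measurable]: "D \<in> sets borel" and ab: "0 < a" "a < b"
    and \<rho>: "\<rho> \<in> ext_admissible (circle_sections D z0 a b)"
  shows "ennreal (ln (b / a)) \<le> 4 * (\<integral>\<^sup>+z\<in>D \<inter> annulus z0 a b. \<rho> z / ennreal (cmod (z - z0)) \<partial>lebesgue)"
proof -
  define \<Gamma> where "\<Gamma> = {c \<in> circle_sections D z0 a b. \<not> 1 \<le> line_integral c \<rho>}"
  have \<rho>m: "\<rho> \<in> borel_measurable lebesgue" and mod0: "modulus \<Gamma> = 0"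
    using \<rho> by (auto simp: ext_admissible_def \<Gamma>_def)
  obtain \<rho>B where \<rho>B[measurable]: "\<rho>B \<in> borel_measurable borel" and ae: "AE z in lborel. \<rho> z = \<rho>B z"
    using completion_ex_borel_measurable[OF \<rho>m] by auto
  obtain N where N: "{z \<in> space lborel. \<not> \<rho> z = \<rho>B z} \<subseteq> N" "emeasure lborel N = 0" "N \<in> sets lborel"
    using AE_E[OF ae] by metis
  have [measurable]: "N \<in> sets borel" using N(3) by simp
  \<comment> \<open>\<open>\<rho>2\<close> is infinite on the null set, so it dominates
    \<open>\<rho>\<close> everywhere and along every section, while area integrals do not
    change.\<close>
  define \<rho>2 where "\<rho>2 z = (if z \<in> N then top else \<rho>B z)" for z
  have [measurable]: "\<rho>2 \<in> borel_measurable borel" unfolding \<rho>2_def by measurable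
  have \<rho>le: "\<rho> z \<le> \<rho>2 z" for z 
  proof (cases "z \<in> N")
    case False
    then have "\<rho> z = \<rho>B z" using N(1) by auto
    then show ?thesis by (simp add: \<rho>2_def)
  qed (simp add: \<rho>2_def)
  have ae2: "AE z in lborel. \<rho>2 z = \<rho> z"
  proof -
    have "AE z in lborel. z \<notin> N" using N by (intro AE_not_in) (auto simp: null_sets_def)
    then show ?thesis using ae by eventually_elim (simp add: \<rho>2_def)
  qed
  define A where "A = (\<integral>\<^sup>+z\<in>D \<inter> annulus z0 a b. \<rho> z / ennreal (cmod (z - z0)) \<partial>lebesgue)"
  have A2: "(\<integral>\<^sup>+z\<in>D \<inter> annulus z0 a b. \<rho>2 z / ennreal (cmod (z - z0)) \<partial>lborel) = A"
    unfolding A_def nn_integral_completion using ae2 by (intro nn_integral_cong_AE) auto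
  define K where "K = enn2real (Q_annulus (\<lambda>_. 1) z0 a b)"
  have K: "Q_annulus (\<lambda>_. 1) z0 a b = ennreal K" "0 \<le> K"
    using Q_annulus_1_finite[OF ab(1), of z0 b] by (auto simp: K_def)
  have "ennreal (ln (b / a)) \<le> 4 * A + ennreal e" if e: "0 < e" for e
  proof -
    \<comment> \<open>With energy below \<open>\<eta>\<close>, Cauchy-Schwarz bounds the
      contribution of \<open>\<sigma>\<close> by \<open>e / 4\<close>, which the coarea factor 4
      turns into \<open>e\<close>; \<open>K + 1\<close> avoids a zero denominator.\<close>
    define \<eta> where "\<eta> = (e / 4)\<^sup>2 / (K + 1)"
    have \<eta>: "0 < \<eta>" using e K by (simp add: \<eta>_def)
    have "modulus \<Gamma> < ennreal \<eta>" using mod0 \<eta> by simp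
    then obtain \<sigma> where \<sigma>: "\<sigma> \<in> admissible \<Gamma>" "(\<integral>\<^sup>+z. (\<sigma> z)\<^sup>2 \<partial>lborel) < ennreal \<eta>"
      unfolding modulus_def INF_less_iff by blast
    have \<sigma>m[measurable]: "\<sigma> \<in> borel_measurable borel" using \<sigma>(1) by (simp add: admissible_def)
    have ge: "1 \<le> (\<integral>\<^sup>+z\<in>D \<inter> sphere z0 r. \<rho>2 z + \<sigma> z \<partial>hausdorff1_borel)" if r: "a < r" "r < b" for r
    proof -
      define c where "c = (D \<inter> sphere z0 r, \<lambda>z::complex. z)"
      have c: "c \<in> circle_sections D z0 a b" using r by (auto simp: c_def circle_sections_def)
      have "c \<in> \<Gamma> \<Longrightarrow> 1 \<le> line_integral c \<sigma>" using \<sigma>(1) by (simp add: admissible_def)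
      moreover have "c \<notin> \<Gamma> \<Longrightarrow> 1 \<le> line_integral c \<rho>" using c by (simp add: \<Gamma>_def)
      ultimately have "(1 \<le> line_integral c \<rho>) \<or> 1 \<le> line_integral c \<sigma>" by (cases "c \<in> \<Gamma>") simp_all
      moreover have "line_integral c \<rho> \<le> line_integral c (\<lambda>z. \<rho>2 z + \<sigma> z)"
        "line_integral c \<sigma> \<le> line_integral c (\<lambda>z. \<rho>2 z + \<sigma> z)"
        unfolding line_integral_def using \<rho>le
        by (intro nn_integral_mono mult_right_mono; simp add: add_increasing add_increasing2)+
      ultimately have "1 \<le> line_integral c (\<lambda>z. \<rho>2 z + \<sigma> z)" by (meson order_trans)
      then show ?thesis
        unfolding c_def line_integral_section by (subst (asm) nn_integral_hausdorff1) measurable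
    qed
    have "ennreal (ln (b / a)) \<le> 4 * (\<integral>\<^sup>+z\<in>D \<inter> annulus z0 a b. (\<rho>2 z + \<sigma> z) / ennreal (cmod (z - z0)) \<partial>lborel)"
      using D ab ge by (intro ln_le_annulus_integral) auto
    also have "(\<integral>\<^sup>+z\<in>D \<inter> annulus z0 a b. (\<rho>2 z + \<sigma> z) / ennreal (cmod (z - z0)) \<partial>lborel)
      = (\<integral>\<^sup>+z\<in>D \<inter> annulus z0 a b. \<rho>2 z / ennreal (cmod (z - z0)) \<partial>lborel)
        + (\<integral>\<^sup>+z\<in>D \<inter> annulus z0 a b. \<sigma> z / ennreal (cmod (z - z0)) \<partial>lborel)"
      by (subst nn_integral_add[symmetric]) (auto simp: divide_ennreal_def distrib_right)
    also have "\<dots> \<le> A + ennreal (e / 4)"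
      unfolding A2
    proof (rule add_left_mono, rule ennreal_power2_le_imp_le)
      have "(\<integral>\<^sup>+z\<in>D \<inter> annulus z0 a b. \<sigma> z / ennreal (cmod (z - z0)) \<partial>lborel)\<^sup>2 \<le>
          (\<integral>\<^sup>+z\<in>D \<inter> annulus z0 a b. (\<sigma> z)\<^sup>2 / ennreal 1 \<partial>lebesgue) * Q_annulus (\<lambda>_. 1) z0 a b"
        using weighted_annulus_Cauchy_Schwarz[of \<sigma> D "\<lambda>_. 1" a z0 b] ab \<sigma>m D
        by (simp add: nn_integral_completion measurable_completion)
      also have "\<dots> \<le> ennreal \<eta> * ennreal K"
        unfolding K nn_integral_completion
        by (intro mult_right_mono order_trans[OF nn_integral_mono less_imp_le[OF \<sigma>(2)]])
           (auto simp: indicator_def divide_ennreal_def)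
      also have "\<dots> \<le> ennreal ((e / 4)\<^sup>2)"
        using K \<eta> by (auto simp: \<eta>_def field_simps simp flip: ennreal_mult intro!: ennreal_leI)
      also have "\<dots> = (ennreal (e / 4))\<^sup>2" using e by (simp add: ennreal_power)
      finally show "(\<integral>\<^sup>+z\<in>D \<inter> annulus z0 a b. \<sigma> z / ennreal (cmod (z - z0)) \<partial>lborel)\<^sup>2 \<le> (ennreal (e / 4))\<^sup>2" .
    qed
    finally have "ennreal (ln (b / a)) \<le> 4 * (A + ennreal (e / 4))"
      by (simp add: mult_left_mono)
    also have "\<dots> = 4 * A + ennreal e"
    proof -
      have "4 * ennreal (e / 4) = ennreal (4 * (e / 4))" using e by (subst ennreal_mult) auto
      then show ?thesis by (simp add: distrib_left)
    qed
    finally show ?thesis .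
  qed
  then show ?thesis unfolding A_def[symmetric] by (rule ennreal_le_epsilon)
qed

text \<open>Positivity allows division by the annulus integral in the lower bound for the
  modulus.\<close>

lemma Q_annulus_pos:
  assumes Q[measurable]: "Q \<in> borel_measurable lebesgue" and "\<And>z. 0 < Q z" "0 < a" "a < b"
  shows "0 < Q_annulus Q z0 a b"
proof (rule ccontr)
  have ann[measurable]: "annulus z0 a b \<in> sets lebesgue" by (simp add: annulus_in_borel)
  have cm[measurable]: "(\<lambda>z. cmod (z - z0)) \<in> borel_measurable lebesgue"
    by (rule measurable_completion) measurable
  assume "\<not> 0 < Q_annulus Q z0 a b"
  then have "(\<integral>\<^sup>+z\<in>annulus z0 a b. ennreal (Q z / (cmod (z - z0))\<^sup>2) \<partial>lebesgue) = 0"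
    by (simp add: Q_annulus_def)
  then have "AE z in lebesgue. ennreal (Q z / (cmod (z - z0))\<^sup>2) * indicator (annulus z0 a b) z = 0"
    by (subst (asm) nn_integral_0_iff_AE) measurable
  then have "AE z in lebesgue. z \<notin> annulus z0 a b"
  proof eventually_elim
    case (elim z)
    show ?case
    proof
      assume z: "z \<in> annulus z0 a b"
      then have "0 < cmod (z - z0)" using assms(3) by (simp add: annulus_def del: zero_less_norm_iff)
      then have "0 < Q z / (cmod (z - z0))\<^sup>2" using assms(2) by simp
      then have "0 < ennreal (Q z / (cmod (z - z0))\<^sup>2)" by (simp only: ennreal_less_zero_iff)
      then show False using elim z by (simp only: indicator_simps mult_1_right less_irrefl)
    qed
  qed
  then have "annulus z0 a b \<in> null_sets lebesgue"
    by (simp add: AE_iff_null_sets[symmetric])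
  then have "negligible (annulus z0 a b)" by (simp add: negligible_iff_null_sets)
  moreover have "open (annulus z0 a b)"
  proof -
    have "annulus z0 a b = ball z0 b - cball z0 a"
      by (auto simp: annulus_def dist_norm norm_minus_commute)
    then show ?thesis by (simp add: open_Diff)
  qed
  moreover have "z0 + of_real ((a + b) / 2) \<in> annulus z0 a b"
  proof -
    have "cmod (of_real ((a + b) / 2) :: complex) = (a + b) / 2"
      using assms(3,4) by (subst norm_of_real) simp
    then show ?thesis using assms(3,4) by (simp add: annulus_def)
  qed
  ultimately show False using open_not_negligible by blast
qed

text \<open>The constant is \<open>16 \<cdot> 18 \<pi>\<close>: the square of the factor 4 of the coarea inequality times the
  distortion of the conformal pullback.\<close>

definition length_area_bound ::
  "(complex \<Rightarrow> complex) \<Rightarrow> complex set \<Rightarrow> (complex \<Rightarrow> real) \<Rightarrow> complex \<Rightarrow> real \<Rightarrow> bool" where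
  "length_area_bound h D Q z0 b0 \<longleftrightarrow>
     (\<forall>a b P. 0 < a \<and> a < b \<and> b < b0 \<and> P \<in> borel_measurable borel \<and> Q_annulus Q z0 a b < top \<and>
        (\<forall>r\<in>{a<..<b}. 1 \<le> (\<integral>\<^sup>+w\<in>h ` (D \<inter> sphere z0 r). P w \<partial>hausdorff1_borel)) \<longrightarrow>
        ennreal ((ln (b / a))\<^sup>2) \<le> ennreal (288 * pi) * (\<integral>\<^sup>+w. (P w)\<^sup>2 \<partial>lborel) * Q_annulus Q z0 a b)"

text \<open>A density for the images pulls back to one for the sections themselves, so the modulus
  does not enter and Cauchy-Schwarz with weight 1 is enough.\<close>

lemma length_area_bound_conformal:
  assumes G: "G holomorphic_on D" "open D" "inj_on G D" "bounded (G ` D)"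
  shows "length_area_bound G D (\<lambda>_. 1) z0 b0"
  unfolding length_area_bound_def
proof (intro allI impI, elim conjE)
  fix a b P
  assume ab: "0 < a" "a < b" and P: "P \<in> borel_measurable borel"
    and ge: "\<forall>r\<in>{a<..<b}. 1 \<le> (\<integral>\<^sup>+w\<in>G ` (D \<inter> sphere z0 r). P w \<partial>hausdorff1_borel)"
  obtain T :: "(complex \<Rightarrow> ennreal) \<Rightarrow> complex \<Rightarrow> ennreal" where
    Tm: "\<And>P. P \<in> borel_measurable borel \<Longrightarrow> T P \<in> borel_measurable borel" and
    T2: "\<And>P. P \<in> borel_measurable borel \<Longrightarrow>
       (\<integral>\<^sup>+z. (T P z)\<^sup>2 \<partial>lborel) \<le> ennreal (18 * pi) * (\<integral>\<^sup>+w. (P w)\<^sup>2 \<partial>lborel)" and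
    T1: "\<And>P A. P \<in> borel_measurable borel \<Longrightarrow> A \<in> sets borel \<Longrightarrow> A \<subseteq> D \<Longrightarrow>
       (\<integral>\<^sup>+w\<in>G ` A. P w \<partial>hausdorff1_borel) \<le> (\<integral>\<^sup>+z\<in>A. T P z \<partial>hausdorff1_borel)"
    using conformal_pullback[OF G] by blast
  note [measurable] = Tm[OF P]
  have "1 \<le> (\<integral>\<^sup>+z\<in>D \<inter> sphere z0 r. T P z \<partial>hausdorff1_borel)" if "a < r" "r < b" for r
    using ge that G(2) by (intro order_trans[OF _ T1[OF P]]) auto
  then have "ennreal (ln (b / a)) \<le> 4 * (\<integral>\<^sup>+z\<in>D \<inter> annulus z0 a b. T P z / ennreal (cmod (z - z0)) \<partial>lborel)"
    using ab G(2) by (intro ln_le_annulus_integral) auto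
  moreover have "(\<integral>\<^sup>+z\<in>D \<inter> annulus z0 a b. T P z / ennreal (cmod (z - z0)) \<partial>lborel)\<^sup>2 \<le>
      (\<integral>\<^sup>+z\<in>D \<inter> annulus z0 a b. (T P z)\<^sup>2 / ennreal 1 \<partial>lebesgue) * Q_annulus (\<lambda>_. 1) z0 a b"
    using weighted_annulus_Cauchy_Schwarz[of "T P" D "\<lambda>_. 1" a z0 b] ab Tm[OF P] G(2)
    by (simp add: nn_integral_completion measurable_completion)
  ultimately have "ennreal ((ln (b / a))\<^sup>2) \<le>
      16 * ((\<integral>\<^sup>+z\<in>D \<inter> annulus z0 a b. (T P z)\<^sup>2 / ennreal 1 \<partial>lebesgue) * Q_annulus (\<lambda>_. 1) z0 a b)"
    using ab by (intro ennreal_ln_square_le) auto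
  also have "\<dots> \<le> 16 * ((ennreal (18 * pi) * (\<integral>\<^sup>+w. (P w)\<^sup>2 \<partial>lborel)) * Q_annulus (\<lambda>_. 1) z0 a b)"
    unfolding nn_integral_completion
    by (intro mult_left_mono mult_right_mono order_trans[OF nn_integral_mono T2[OF P]]) (auto simp: indicator_def divide_ennreal_def)
  also have "\<dots> = (16 * ennreal (18 * pi)) * (\<integral>\<^sup>+w. (P w)\<^sup>2 \<partial>lborel) * Q_annulus (\<lambda>_. 1) z0 a b"
    by (simp only: mult.assoc)
  also have "16 * ennreal (18 * pi) = ennreal (288 * pi)"
    by (subst ennreal_numeral[symmetric], subst ennreal_mult[symmetric]) (auto simp: mult.assoc)
  finally show "ennreal ((ln (b / a))\<^sup>2) \<le> ennreal (288 * pi) * (\<integral>\<^sup>+w. (P w)\<^sup>2 \<partial>lborel) * Q_annulus (\<lambda>_. 1) z0 a b" .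
qed

text \<open>The modulus of the images under \<open>f\<close> is estimated twice: from above by the
  pullback of \<open>P\<close> under \<open>G\<close>, which is admissible for them, and from below
  by the lower \<open>Q\<close> property, where Cauchy-Schwarz bounds every competing density. The
  bound on \<open>b0\<close> keeps \<open>b\<close> in the range of that property.\<close>

lemma length_area_bound_lower_Q:
  assumes low: "lower_Q_homeomorphism_at Q D D' f z0" and D: "open D" "open D'"
    and Q: "Q \<in> borel_measurable lebesgue" "\<And>z. 0 < Q z"
    and G: "G holomorphic_on D'" "inj_on G D'" "bounded (G ` D')"
    and b0: "b0 \<le> (SUP z\<in>D. cmod (z - z0))"
  shows "length_area_bound (G \<circ> f) D Q z0 b0"
  unfolding length_area_bound_def
proof (intro allI impI, elim conjE)
  fix a b P
  assume ab: "0 < a" "a < b" "b < b0" and P: "P \<in> borel_measurable borel" and fin: "Q_annulus Q z0 a b < top"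
    and ge: "\<forall>r\<in>{a<..<b}. 1 \<le> (\<integral>\<^sup>+w\<in>(G \<circ> f) ` (D \<inter> sphere z0 r). P w \<partial>hausdorff1_borel)"
  obtain f' where f': "homeomorphism D D' f f'"
    using low by (auto simp: lower_Q_homeomorphism_at_def)
  have inj: "inj_on f D" using f' by (metis homeomorphism_def inj_on_inverseI)
  obtain T :: "(complex \<Rightarrow> ennreal) \<Rightarrow> complex \<Rightarrow> ennreal" where
    Tm: "\<And>P. P \<in> borel_measurable borel \<Longrightarrow> T P \<in> borel_measurable borel" and
    T2: "\<And>P. P \<in> borel_measurable borel \<Longrightarrow>
       (\<integral>\<^sup>+z. (T P z)\<^sup>2 \<partial>lborel) \<le> ennreal (18 * pi) * (\<integral>\<^sup>+w. (P w)\<^sup>2 \<partial>lborel)" and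
    T1: "\<And>P A. P \<in> borel_measurable borel \<Longrightarrow> A \<in> sets borel \<Longrightarrow> A \<subseteq> D' \<Longrightarrow>
       (\<integral>\<^sup>+w\<in>G ` A. P w \<partial>hausdorff1_borel) \<le> (\<integral>\<^sup>+z\<in>A. T P z \<partial>hausdorff1_borel)"
    using conformal_pullback[OF G(1) D(2) G(2,3)] by blast
  have secB: "f ` (D \<inter> sphere z0 r) \<in> sets borel" for r
    using D by (intro homeomorphism_image_borel[OF f']) auto
  have fD: "f ` D = D'" using f' by (simp add: homeomorphism_def)
  have "T P \<in> admissible (image_family f (circle_sections D z0 a b))"
    unfolding admissible_def
  proof (intro CollectI conjI ballI)
    show "T P \<in> borel_measurable borel" by (rule Tm[OF P])
    fix c assume "c \<in> image_family f (circle_sections D z0 a b)"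
    then obtain r where r: "a < r" "r < b" "c = (D \<inter> sphere z0 r, f \<circ> (\<lambda>z. z))"
      by (auto simp: image_family_def circle_sections_def)
    have "1 \<le> (\<integral>\<^sup>+w\<in>G ` (f ` (D \<inter> sphere z0 r)). P w \<partial>hausdorff1_borel)"
      using ge r by (simp add: image_comp)
    also have "\<dots> \<le> (\<integral>\<^sup>+z\<in>f ` (D \<inter> sphere z0 r). T P z \<partial>hausdorff1_borel)"
      using fD by (intro T1 P secB) blast
    also have "\<dots> = (\<integral>\<^sup>+z\<in>f ` (D \<inter> sphere z0 r). T P z \<partial>hausdorff1)"
      using Tm[OF P] secB[of r] by (subst nn_integral_hausdorff1) auto
    also have "\<dots> = line_integral c (T P)"
      unfolding r(3) by (rule line_integral_image_section[OF inj, symmetric])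
    finally show "1 \<le> line_integral c (T P)" .
  qed
  then have "modulus (image_family f (circle_sections D z0 a b)) \<le> (\<integral>\<^sup>+z. (T P z)\<^sup>2 \<partial>lborel)"
    unfolding modulus_def by (rule INF_lower)
  also have "\<dots> \<le> ennreal (18 * pi) * (\<integral>\<^sup>+w. (P w)\<^sup>2 \<partial>lborel)" by (rule T2[OF P])
  finally have up: "modulus (image_family f (circle_sections D z0 a b)) \<le> ennreal (18 * pi) * (\<integral>\<^sup>+w. (P w)\<^sup>2 \<partial>lborel)" .
  define I where "I = enn2real (Q_annulus Q z0 a b)"
  have I: "Q_annulus Q z0 a b = ennreal I" "0 < I"
    using fin Q_annulus_pos[OF Q ab(1,2), of z0] by (auto simp: I_def enn2real_positive_iff)
  \<comment> \<open>A bound independent of \<open>\<rho>\<close>, hence one for the infimum; 16 is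
    the square of the coarea constant.\<close>
  have low2: "ennreal ((ln (b / a))\<^sup>2) / ennreal (16 * I) \<le>
      (\<integral>\<^sup>+z\<in>D \<inter> annulus z0 a b. (\<rho> z)\<^sup>2 / ennreal (Q z) \<partial>lebesgue)"
    if \<rho>: "\<rho> \<in> ext_admissible (circle_sections D z0 a b)" for \<rho>
  proof -
    have "\<rho> \<in> borel_measurable lebesgue" using \<rho> by (simp add: ext_admissible_def)
    then have "(\<integral>\<^sup>+z\<in>D \<inter> annulus z0 a b. \<rho> z / ennreal (cmod (z - z0)) \<partial>lebesgue)\<^sup>2 \<le>
        (\<integral>\<^sup>+z\<in>D \<inter> annulus z0 a b. (\<rho> z)\<^sup>2 / ennreal (Q z) \<partial>lebesgue) * ennreal I"
      using weighted_annulus_Cauchy_Schwarz[of \<rho> D Q a z0 b] D Q ab unfolding I by auto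
    moreover have "ennreal (ln (b / a)) \<le> 4 * (\<integral>\<^sup>+z\<in>D \<inter> annulus z0 a b. \<rho> z / ennreal (cmod (z - z0)) \<partial>lebesgue)"
      using D ab \<rho> by (intro ln_le_ext_admissible) auto
    ultimately have "ennreal ((ln (b / a))\<^sup>2) \<le>
        16 * ((\<integral>\<^sup>+z\<in>D \<inter> annulus z0 a b. (\<rho> z)\<^sup>2 / ennreal (Q z) \<partial>lebesgue) * ennreal I)"
      using ab by (intro ennreal_ln_square_le) auto
    also have "\<dots> = (\<integral>\<^sup>+z\<in>D \<inter> annulus z0 a b. (\<rho> z)\<^sup>2 / ennreal (Q z) \<partial>lebesgue) * ennreal (16 * I)"
      using I by (simp add: ennreal_mult mult_ac)
    finally show ?thesis using I by (intro divide_le_posI_ennreal) (simp_all add: mult.commute)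
  qed
  have "ennreal ((ln (b / a))\<^sup>2) / ennreal (16 * I) \<le> modulus (image_family f (circle_sections D z0 a b))"
  proof (rule order_trans[OF INF_greatest])
    show "(INF \<rho> \<in> ext_admissible (circle_sections D z0 a b).
       \<integral>\<^sup>+z \<in> D \<inter> annulus z0 a b. (\<rho> z)\<^sup>2 / ennreal (Q z) \<partial>lebesgue) \<le> modulus (image_family f (circle_sections D z0 a b))"
      using low ab b0 by (auto simp: lower_Q_homeomorphism_at_def)
  qed (rule low2)
  also note up
  finally have "ennreal ((ln (b / a))\<^sup>2) \<le> ennreal (16 * I) * (ennreal (18 * pi) * (\<integral>\<^sup>+w. (P w)\<^sup>2 \<partial>lborel))"
    by (rule ennreal_le_times_of_divide_le[rotated]) (use I in simp)
  also have "\<dots> = ennreal (16 * (18 * pi)) * (\<integral>\<^sup>+w. (P w)\<^sup>2 \<partial>lborel) * ennreal I"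
    using I by (simp add: ennreal_mult mult_ac)
  finally show "ennreal ((ln (b / a))\<^sup>2) \<le> ennreal (288 * pi) * (\<integral>\<^sup>+w. (P w)\<^sup>2 \<partial>lborel) * Q_annulus Q z0 a b"
    unfolding I by simp
qed


section \<open>Short images of circular sections\<close>

text \<open>The second clause is the divergence of the length-area bound as the inner radius
  shrinks, for every outer radius; it is written without a quotient.\<close>

definition slow_Q_growth :: "(complex \<Rightarrow> real) \<Rightarrow> complex \<Rightarrow> real \<Rightarrow> bool" where
  "slow_Q_growth Q z0 b0 \<longleftrightarrow>
     (\<forall>a b. 0 < a \<and> b < b0 \<longrightarrow> Q_annulus Q z0 a b < top) \<and>
     (\<forall>b N. 0 < b \<and> b < b0 \<and> 0 < N \<longrightarrow>
        (\<exists>a. 0 < a \<and> a < b \<and> ennreal N * Q_annulus Q z0 a b \<le> ennreal ((ln (b / a))\<^sup>2)))"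

lemma slow_Q_growth_mono: "slow_Q_growth Q z0 b0 \<Longrightarrow> b0' \<le> b0 \<Longrightarrow> slow_Q_growth Q z0 b0'"
  unfolding slow_Q_growth_def by (meson order_less_le_trans)

lemma slow_Q_growth_smallo:
  assumes Q: "\<And>z. 0 < Q z" and \<epsilon>0: "0 < \<epsilon>0"
    and int: "\<And>\<epsilon>. 0 < \<epsilon> \<Longrightarrow> \<epsilon> < \<epsilon>0 \<Longrightarrow>
       set_integrable lebesgue (annulus z0 \<epsilon> \<epsilon>0) (\<lambda>z. Q z / (cmod (z - z0))\<^sup>2)"
    and o: "(\<lambda>\<epsilon>. LINT z:annulus z0 \<epsilon> \<epsilon>0|lebesgue. Q z / (cmod (z - z0))\<^sup>2) \<in> o[at_right 0](\<lambda>\<epsilon>. (ln (1 / \<epsilon>))\<^sup>2)"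
  shows "slow_Q_growth Q z0 \<epsilon>0"
proof -
  define I where "I \<epsilon> = (LINT z:annulus z0 \<epsilon> \<epsilon>0|lebesgue. Q z / (cmod (z - z0))\<^sup>2)" for \<epsilon>
  have I: "Q_annulus Q z0 a \<epsilon>0 = ennreal (I a)" if a: "0 < a" "a < \<epsilon>0" for a
  proof -
    have "Q_annulus Q z0 a \<epsilon>0 =
        (\<integral>\<^sup>+z. ennreal (indicat_real (annulus z0 a \<epsilon>0) z *\<^sub>R (Q z / (cmod (z - z0))\<^sup>2)) \<partial>lebesgue)"
      unfolding Q_annulus_def by (intro nn_integral_cong) (auto simp: indicator_def)
    also have "\<dots> = ennreal (\<integral>z. indicat_real (annulus z0 a \<epsilon>0) z *\<^sub>R (Q z / (cmod (z - z0))\<^sup>2) \<partial>lebesgue)"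
      using int[OF a] Q unfolding set_integrable_def
      by (intro nn_integral_eq_integral) (auto intro!: AE_I2 mult_nonneg_nonneg divide_nonneg_nonneg less_imp_le[OF Q])
    finally show ?thesis by (simp add: I_def set_lebesgue_integral_def)
  qed
  show ?thesis
    unfolding slow_Q_growth_def
  proof (intro conjI allI impI; elim conjE)
    fix a b :: real assume ab: "0 < a" "b < \<epsilon>0"
    show "Q_annulus Q z0 a b < top"
    proof (cases "a < \<epsilon>0")
      case True
      then have "Q_annulus Q z0 a b \<le> ennreal (I a)"
        using ab I[of a] Q_annulus_mono[of a a b \<epsilon>0 Q z0] by simp
      then show ?thesis by (rule order.strict_trans1) simp
    next
      case False
      then have "annulus z0 a b = {}" using ab by (auto simp: annulus_def)
      then show ?thesis by (simp add: Q_annulus_def)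
    qed
  next
    fix b N :: real assume b: "0 < b" "b < \<epsilon>0" and N: "0 < N"
    have "\<forall>\<^sub>F \<epsilon> in at_right 0. norm (I \<epsilon>) \<le> (1 / (4 * N)) * norm ((ln (1 / \<epsilon>))\<^sup>2)"
      using landau_o.smallD[OF o, of "1 / (4 * N)"] N unfolding I_def by simp
    \<comment> \<open>\<open>a < b\<^sup>2\<close> gives
      \<open>ln (1 / a) \<le> 2 * ln (b / a)\<close>, whose square accounts for the 4 in
      \<open>4 * N\<close>; \<open>a < 1\<close> makes the logarithm nonnegative before
      squaring.\<close>
    moreover have "\<forall>\<^sub>F \<epsilon> in at_right 0. \<epsilon> < Min {b, b\<^sup>2, 1::real}"
      using b by (intro eventually_at_rightI[of 0 "Min {b, b\<^sup>2, 1}"]) auto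
    ultimately have "\<forall>\<^sub>F \<epsilon> in at_right 0. 0 < \<epsilon> \<and> \<epsilon> < Min {b, b\<^sup>2, 1::real} \<and>
        norm (I \<epsilon>) \<le> (1 / (4 * N)) * norm ((ln (1 / \<epsilon>))\<^sup>2)"
      using eventually_at_right_less[of 0] by eventually_elim auto
    then obtain a where a: "0 < a" "a < Min {b, b\<^sup>2, 1::real}" "norm (I a) \<le> (1 / (4 * N)) * norm ((ln (1 / a))\<^sup>2)"
      using eventually_happens'[OF trivial_limit_at_right_real] by blast
    have "ln a \<le> 2 * ln b"
      using a b ln_le_cancel_iff[of a "b\<^sup>2"] by (simp add: ln_realpow)
    moreover have "ln a \<le> 0" using a by (simp add: ln_le_zero_iff)
    ultimately have "0 \<le> ln (1 / a)" "ln (1 / a) \<le> 2 * ln (b / a)"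
      using a b by (auto simp: ln_div)
    then have "(ln (1 / a))\<^sup>2 \<le> (2 * ln (b / a))\<^sup>2" by (intro power_mono)
    then have sq: "(ln (1 / a))\<^sup>2 \<le> 4 * (ln (b / a))\<^sup>2" by (simp add: power_mult_distrib)
    have "I a \<le> (1 / (4 * N)) * (ln (1 / a))\<^sup>2" using a(3) by simp
    also have "\<dots> \<le> (1 / (4 * N)) * (4 * (ln (b / a))\<^sup>2)" using sq N by (intro mult_left_mono) auto
    finally have "N * I a \<le> (ln (b / a))\<^sup>2" using N by (simp add: field_simps)
    then have "ennreal N * ennreal (I a) \<le> ennreal ((ln (b / a))\<^sup>2)"
      using N by (simp add: ennreal_leI flip: ennreal_mult')
    moreover have "Q_annulus Q z0 a b \<le> ennreal (I a)"
      using a b I[of a] Q_annulus_mono[of a a b \<epsilon>0 Q z0] by simp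
    ultimately have "ennreal N * Q_annulus Q z0 a b \<le> ennreal ((ln (b / a))\<^sup>2)"
      by (meson mult_left_mono order_trans zero_le)
    then show "\<exists>a. 0 < a \<and> a < b \<and> ennreal N * Q_annulus Q z0 a b \<le> ennreal ((ln (b / a))\<^sup>2)"
      using a by auto
  qed
qed

text \<open>A dyadic shell with outer radius \<open>c\<close> has area at most
  \<open>pi * c\<^sup>2\<close> and integrand at most \<open>4 / c\<^sup>2\<close>, hence
  contributes at most \<open>4 * pi\<close>.\<close>

lemma Q_annulus_1_le:
  assumes b: "0 < b"
  shows "Q_annulus (\<lambda>_. 1) z0 (b / 2 ^ K) b \<le> ennreal (4 * pi * real K)"
proof -
  \<comment> \<open>Shells closed on the inside fit together without losing a circle.\<close>
  define H where "H K = {z. b / 2 ^ K \<le> cmod (z - z0) \<and> cmod (z - z0) < b}" for K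
  have [measurable]: "H K \<in> sets borel" for K unfolding H_def by measurable
  have "(\<integral>\<^sup>+z\<in>H K. ennreal (1 / (cmod (z - z0))\<^sup>2) \<partial>lborel) \<le> ennreal (4 * pi * real K)" for K
  proof (induction K)
    case 0
    have "H 0 = {}" by (auto simp: H_def)
    then show ?case by simp
  next
    case (Suc K)
    define c where "c = b / 2 ^ K"
    have c: "0 < c" using b by (simp add: c_def)
    have "(\<integral>\<^sup>+z\<in>H (Suc K). ennreal (1 / (cmod (z - z0))\<^sup>2) \<partial>lborel) \<le>
       (\<integral>\<^sup>+z. ennreal (1 / (cmod (z - z0))\<^sup>2) * indicator (H K) z + ennreal (4 / c\<^sup>2) * indicator (ball z0 c) z \<partial>lborel)"
    proof (rule nn_integral_mono)
      fix z
      show "ennreal (1 / (cmod (z - z0))\<^sup>2) * indicator (H (Suc K)) z \<le>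
        ennreal (1 / (cmod (z - z0))\<^sup>2) * indicator (H K) z + ennreal (4 / c\<^sup>2) * indicator (ball z0 c) z"
      proof (cases "z \<in> H (Suc K) - H K")
        case True
        then have z: "c / 2 \<le> cmod (z - z0)" "cmod (z - z0) < c" by (auto simp: H_def c_def)
        have "1 / (cmod (z - z0))\<^sup>2 \<le> 1 / (c / 2)\<^sup>2"
          using z c by (intro frac_le power_mono) auto
        then have "1 / (cmod (z - z0))\<^sup>2 \<le> 4 / c\<^sup>2" by (simp add: power_divide)
        then show ?thesis using True z by (simp add: ennreal_leI dist_norm norm_minus_commute)
      next
        case False
        have "H K \<subseteq> H (Suc K)"
        proof
          fix z assume "z \<in> H K"
          moreover have "b / 2 ^ Suc K \<le> b / 2 ^ K" using b by (intro divide_left_mono) auto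
          ultimately show "z \<in> H (Suc K)" unfolding H_def by auto
        qed
        then have "indicator (H (Suc K)) z = (indicator (H K) z :: ennreal)"
          using False by (auto simp: indicator_def)
        then show ?thesis by simp
      qed
    qed
    also have "\<dots> = (\<integral>\<^sup>+z\<in>H K. ennreal (1 / (cmod (z - z0))\<^sup>2) \<partial>lborel)
        + (\<integral>\<^sup>+z. ennreal (4 / c\<^sup>2) * indicator (ball z0 c) z \<partial>lborel)"
      by (rule nn_integral_add) (measurable, simp)
    also have "(\<integral>\<^sup>+z. ennreal (4 / c\<^sup>2) * indicator (ball z0 c) z \<partial>lborel) = ennreal (4 / c\<^sup>2) * emeasure lborel (ball z0 c)"
      by (rule nn_integral_cmult_indicator) simp
    also have "emeasure lborel (ball z0 c) = ennreal (pi * c\<^sup>2)"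
      using c by (simp add: emeasure_ball unit_ball_vol_2)
    also have "ennreal (4 / c\<^sup>2) * ennreal (pi * c\<^sup>2) = ennreal (4 * pi)"
      using c by (simp flip: ennreal_mult)
    also have "(\<integral>\<^sup>+z\<in>H K. ennreal (1 / (cmod (z - z0))\<^sup>2) \<partial>lborel) + ennreal (4 * pi)
        \<le> ennreal (4 * pi * real K) + ennreal (4 * pi)"
      by (rule add_right_mono) fact
    also have "\<dots> = ennreal (4 * pi * real (Suc K))"
      by (subst ennreal_plus[symmetric]) (auto simp: algebra_simps)
    finally show ?case .
  qed
  moreover have "Q_annulus (\<lambda>_. 1) z0 (b / 2 ^ K) b \<le> (\<integral>\<^sup>+z\<in>H K. ennreal (1 / (cmod (z - z0))\<^sup>2) \<partial>lborel)"
    unfolding Q_annulus_def nn_integral_completion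
    by (intro nn_integral_mono) (auto simp: annulus_def H_def indicator_def)
  ultimately show ?thesis using order_trans by blast
qed

text \<open>At inner radius \<open>b / 2 ^ K\<close> the integral grows at most linearly in
  \<open>K\<close>, the squared logarithm quadratically.\<close>

lemma slow_Q_growth_1: "slow_Q_growth (\<lambda>_. 1) z0 b0"
  unfolding slow_Q_growth_def
proof (intro conjI allI impI; elim conjE)
  fix a b :: real assume "0 < a"
  then show "Q_annulus (\<lambda>_. 1) z0 a b < top" by (rule Q_annulus_1_finite)
next
  fix b N :: real assume b: "0 < b" and N: "0 < N"
  obtain K where K: "N * (4 * pi) / (ln 2)\<^sup>2 < real K" using reals_Archimedean2 by blast
  have "0 < N * (4 * pi) / (ln 2)\<^sup>2" using N by simp
  then have K0: "0 < K" using K by (cases K) auto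
  have "N * (4 * pi) \<le> real K * (ln 2)\<^sup>2" using K by (simp add: field_simps)
  then have le: "N * (4 * pi * real K) \<le> (real K * ln 2)\<^sup>2"
    using K0 by (simp add: power2_eq_square mult_ac)
  have "ennreal N * Q_annulus (\<lambda>_. 1) z0 (b / 2 ^ K) b \<le> ennreal N * ennreal (4 * pi * real K)"
    by (intro mult_left_mono Q_annulus_1_le b) simp
  also have "\<dots> = ennreal (N * (4 * pi * real K))" using N by (subst ennreal_mult[symmetric]) auto
  also have "\<dots> \<le> ennreal ((real K * ln 2)\<^sup>2)" using le by (rule ennreal_leI)
  also have "real K * ln 2 = ln (b / (b / 2 ^ K))" using b by (simp add: ln_realpow)
  finally have "ennreal N * Q_annulus (\<lambda>_. 1) z0 (b / 2 ^ K) b \<le> ennreal ((ln (b / (b / 2 ^ K)))\<^sup>2)" .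
  moreover have "0 < b / 2 ^ K" "b / 2 ^ K < b" using b K0 by (auto simp: field_simps)
  ultimately show "\<exists>a. 0 < a \<and> a < b \<and> ennreal N * Q_annulus (\<lambda>_. 1) z0 a b \<le> ennreal ((ln (b / a))\<^sup>2)" by blast
qed

text \<open>In terms of moduli, the images of all sections of radius below \<open>b\<close> form a
  family of infinite modulus: a finite energy contradicts the divergence in
  \<open>slow_Q_growth\<close>.\<close>

lemma length_area_bound_large:
  assumes lab: "length_area_bound h D Q z0 b0" and slow: "slow_Q_growth Q z0 b0" and b: "0 < b" "b < b0"
    and P: "P \<in> borel_measurable borel"
    and ge: "\<And>r. 0 < r \<Longrightarrow> r < b \<Longrightarrow> 1 \<le> (\<integral>\<^sup>+w\<in>h ` (D \<inter> sphere z0 r). P w \<partial>hausdorff1_borel)"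
  shows "(\<integral>\<^sup>+w. (P w)\<^sup>2 \<partial>lborel) = top"
proof (rule ccontr)
  assume fin: "(\<integral>\<^sup>+w. (P w)\<^sup>2 \<partial>lborel) \<noteq> top"
  define X where "X = enn2real (\<integral>\<^sup>+w. (P w)\<^sup>2 \<partial>lborel)"
  have X: "(\<integral>\<^sup>+w. (P w)\<^sup>2 \<partial>lborel) = ennreal X" "0 \<le> X" using fin by (auto simp: X_def less_top)
  \<comment> \<open>The summand 1 makes \<open>N * I\<close> exceed the upper bound
    \<open>288 * pi * X * I\<close> unless \<open>I = 0\<close>, and then the logarithm would
    vanish.\<close>
  define N where "N = 288 * pi * X + 1"
  have N: "0 < N" using X by (simp add: N_def add_nonneg_pos)
  obtain a where a: "0 < a" "a < b" and le: "ennreal N * Q_annulus Q z0 a b \<le> ennreal ((ln (b / a))\<^sup>2)"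
    using slow b N unfolding slow_Q_growth_def by meson
  have finI: "Q_annulus Q z0 a b < top" using slow a b unfolding slow_Q_growth_def by blast
  define I where "I = enn2real (Q_annulus Q z0 a b)"
  have I: "Q_annulus Q z0 a b = ennreal I" "0 \<le> I" using finI by (auto simp: I_def)
  have "ennreal ((ln (b / a))\<^sup>2) \<le> ennreal (288 * pi) * (\<integral>\<^sup>+w. (P w)\<^sup>2 \<partial>lborel) * Q_annulus Q z0 a b"
    using lab a b P finI ge unfolding length_area_bound_def by auto
  also have "\<dots> = ennreal (288 * pi * X * I)"
    unfolding X I using X I by (simp add: ennreal_mult)
  finally have up: "(ln (b / a))\<^sup>2 \<le> 288 * pi * X * I"
    using X I by (subst (asm) ennreal_le_iff) auto
  have "N * I \<le> (ln (b / a))\<^sup>2"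
    using le N I by (simp add: ennreal_le_iff flip: ennreal_mult)
  then have "(288 * pi * X + 1) * I \<le> 288 * pi * X * I" using up by (simp add: N_def)
  then have "I \<le> 0" by (simp add: algebra_simps)
  then have "I = 0" using I by simp
  then have "(ln (b / a))\<^sup>2 \<le> 0" using up by simp
  moreover have "0 < ln (b / a)" using a by simp
  ultimately show False by (simp add: power2_eq_square mult_le_0_iff)
qed

definition small_sections :: "(complex \<Rightarrow> complex) \<Rightarrow> complex set \<Rightarrow> complex \<Rightarrow> bool" where
  "small_sections h D z0 \<longleftrightarrow>
     (\<forall>\<epsilon>>0. \<exists>r. 0 < r \<and> r < \<epsilon> \<and> hausdorff1_outer (h ` (D \<inter> sphere z0 r)) < ennreal \<epsilon>)"

text \<open>If all images of sections of radius below \<open>\<epsilon>\<close> had length at least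
  \<open>\<epsilon>\<close>, the constant \<open>1 / \<epsilon>\<close> on the bounded set
  \<open>D1\<close> would be an admissible density of finite energy.\<close>

lemma small_sections_length_area:
  assumes lab: "length_area_bound h D Q z0 b0" and slow: "slow_Q_growth Q z0 b0" and b0: "0 < b0"
    and h: "homeomorphism D D1 h k" and D: "open D" "open D1" "bounded D1"
  shows "small_sections h D z0"
  unfolding small_sections_def
proof (intro allI impI, rule ccontr)
  fix \<epsilon> :: real assume \<epsilon>: "0 < \<epsilon>"
  assume "\<nexists>r. 0 < r \<and> r < \<epsilon> \<and> hausdorff1_outer (h ` (D \<inter> sphere z0 r)) < ennreal \<epsilon>"
  then have big: "ennreal \<epsilon> \<le> hausdorff1_outer (h ` (D \<inter> sphere z0 r))" if "0 < r" "r < \<epsilon>" for r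
    using that not_less by blast
  define b where "b = min \<epsilon> (b0 / 2)"
  have b: "0 < b" "b < b0" "b \<le> \<epsilon>" using \<epsilon> b0 by (auto simp: b_def)
  define P where "P w = ennreal (1 / \<epsilon>) * indicator D1 w" for w :: complex
  have [measurable]: "D1 \<in> sets borel" using D by simp
  have Pm: "P \<in> borel_measurable borel" unfolding P_def by measurable
  have "(\<integral>\<^sup>+w. (P w)\<^sup>2 \<partial>lborel) = top"
  proof (rule length_area_bound_large[OF lab slow b(1,2) Pm])
    fix r assume r: "0 < r" "r < b"
    define E where "E = h ` (D \<inter> sphere z0 r)"
    have E[measurable]: "E \<in> sets borel"
      unfolding E_def using D by (intro homeomorphism_image_borel[OF h]) auto
    have ED: "E \<subseteq> D1" using h by (auto simp: E_def homeomorphism_def)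
    have "1 = ennreal (1 / \<epsilon>) * ennreal \<epsilon>" using \<epsilon> by (simp flip: ennreal_mult)
    also have "\<dots> \<le> ennreal (1 / \<epsilon>) * hausdorff1_outer E"
      unfolding E_def using r b by (intro mult_left_mono big) auto
    also have "\<dots> = (\<integral>\<^sup>+w. ennreal (1 / \<epsilon>) * indicator E w \<partial>hausdorff1_borel)"
      using E by (simp add: nn_integral_cmult_indicator emeasure_hausdorff1_borel)
    also have "\<dots> = (\<integral>\<^sup>+w\<in>E. P w \<partial>hausdorff1_borel)"
      using ED by (intro nn_integral_cong) (auto simp: P_def indicator_def)
    finally show "1 \<le> (\<integral>\<^sup>+w\<in>h ` (D \<inter> sphere z0 r). P w \<partial>hausdorff1_borel)" unfolding E_def .
  qed
  moreover have "(\<integral>\<^sup>+w. (P w)\<^sup>2 \<partial>lborel) = (\<integral>\<^sup>+w. (ennreal (1 / \<epsilon>))\<^sup>2 * indicator D1 w \<partial>lborel)"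
    by (intro nn_integral_cong) (auto simp: P_def indicator_def)
  moreover have "\<dots> = (ennreal (1 / \<epsilon>))\<^sup>2 * emeasure lborel D1"
    by (rule nn_integral_cmult_indicator) simp
  moreover have "\<dots> < top"
    using emeasure_bounded_finite[OF D(3)] by (subst ennreal_power) (use \<epsilon> in \<open>auto simp: ennreal_mult_less_top\<close>)
  ultimately show False by simp
qed


section \<open>Circular domains\<close>

lemma connected_cos_gt: "connected {\<theta>::real. \<bar>\<theta>\<bar> \<le> pi \<and> c < cos \<theta>}"
proof -
  have "x \<in> {\<theta>. \<bar>\<theta>\<bar> \<le> pi \<and> c < cos \<theta>}"
    if ab: "a \<in> {\<theta>. \<bar>\<theta>\<bar> \<le> pi \<and> c < cos \<theta>}" "b \<in> {\<theta>. \<bar>\<theta>\<bar> \<le> pi \<and> c < cos \<theta>}" and x: "a \<le> x" "x \<le> b" for a b x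
  proof -
    have "\<bar>x\<bar> \<le> \<bar>a\<bar> \<or> \<bar>x\<bar> \<le> \<bar>b\<bar>" using x by linarith
    then obtain y where y: "y = a \<or> y = b" "\<bar>x\<bar> \<le> \<bar>y\<bar>" by blast
    then have "\<bar>y\<bar> \<le> pi" "c < cos y" using ab by auto
    moreover have "cos \<bar>y\<bar> \<le> cos \<bar>x\<bar>"
      using y(2) \<open>\<bar>y\<bar> \<le> pi\<close> by (intro cos_monotone_0_pi_le) auto
    ultimately show ?thesis using y(2) by simp
  qed
  then show ?thesis
    unfolding is_interval_connected_1[symmetric] is_interval_1 by blast
qed

text \<open>In the angle measured from the point where the inner product is smallest, the condition
  becomes a lower bound on the cosine and cuts out an interval.\<close>

lemma connected_circle_halfplane:
  fixes v \<omega> :: complex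
  assumes t: "0 < t"
  shows "connected {w \<in> sphere \<omega> t. v \<bullet> (w - \<omega>) < c}"
proof (cases "v = 0")
  case True
  have "connected (sphere \<omega> t)" by (rule connected_sphere) simp
  then show ?thesis using True by (cases "0 < c") (auto simp: sphere_def)
next
  case False
  define \<phi> where "\<phi> \<theta> = \<omega> - of_real t * (sgn v * cis \<theta>)" for \<theta>
  have inner: "v \<bullet> (\<phi> \<theta> - \<omega>) = - (t * cmod v * cos \<theta>)" for \<theta>
  proof -
    have "v \<bullet> (sgn v * cis \<theta>) = Re (cnj v * (sgn v * cis \<theta>))" by (simp add: inner_complex_def)
    also have "cnj v * (sgn v * cis \<theta>) = of_real (cmod v) * cis \<theta>"
    proof -
      have "cnj v * sgn v = of_real (cmod v)"
      proof -
        have "cnj v * v = of_real (cmod v) * of_real (cmod v)"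
          using complex_norm_square[of v] by (simp add: power2_eq_square mult.commute)
        then show ?thesis using False by (simp add: sgn_eq)
      qed
      then show ?thesis by (simp add: mult.assoc[symmetric])
    qed
    also have "Re (of_real (cmod v) * cis \<theta>) = cmod v * cos \<theta>" by simp
    finally show ?thesis by (simp add: \<phi>_def scaleR_conv_of_real[symmetric] mult.assoc)
  qed
  have "{w \<in> sphere \<omega> t. v \<bullet> (w - \<omega>) < c} = \<phi> ` {\<theta>. \<bar>\<theta>\<bar> \<le> pi \<and> - c / (t * cmod v) < cos \<theta>}"
  proof (intro equalityI subsetI)
    fix w assume w: "w \<in> {w \<in> sphere \<omega> t. v \<bullet> (w - \<omega>) < c}"
    define z where "z = - (w - \<omega>) / (of_real t * sgn v)"
    have "cmod z = 1"
      using w t False by (simp add: z_def norm_divide norm_mult norm_sgn dist_norm norm_minus_commute)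
    then have "z \<noteq> 0" "sgn z = z" by (auto simp: sgn_eq)
    then have z: "z = cis (Arg z)" using cis_Arg[of z] by simp
    have "w = \<omega> - of_real t * (sgn v * z)"
      using t False by (simp add: z_def sgn_zero_iff field_simps)
    then have w': "w = \<phi> (Arg z)" using z by (simp add: \<phi>_def)
    moreover have "\<bar>Arg z\<bar> \<le> pi" using Arg_bounded[of z] by auto
    moreover have "- c / (t * cmod v) < cos (Arg z)"
    proof -
      have "- (t * cmod v * cos (Arg z)) < c" using w inner[of "Arg z"] w' by simp
      then show ?thesis using t False by (simp add: field_simps)
    qed
    ultimately show "w \<in> \<phi> ` {\<theta>. \<bar>\<theta>\<bar> \<le> pi \<and> - c / (t * cmod v) < cos \<theta>}" by blast
  next
    fix w assume "w \<in> \<phi> ` {\<theta>. \<bar>\<theta>\<bar> \<le> pi \<and> - c / (t * cmod v) < cos \<theta>}"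
    then obtain \<theta> where \<theta>: "w = \<phi> \<theta>" "- c / (t * cmod v) < cos \<theta>" by blast
    have "dist \<omega> w = t" using t False by (simp add: \<theta> \<phi>_def dist_norm norm_mult norm_sgn)
    moreover have "v \<bullet> (w - \<omega>) < c" using \<theta>(2) t False by (simp add: \<theta>(1) inner field_simps)
    ultimately show "w \<in> {w \<in> sphere \<omega> t. v \<bullet> (w - \<omega>) < c}" by simp
  qed
  moreover have "continuous_on UNIV \<phi>" unfolding \<phi>_def by (intro continuous_intros)
  then have "connected (\<phi> ` {\<theta>. \<bar>\<theta>\<bar> \<le> pi \<and> - c / (t * cmod v) < cos \<theta>})"
    by (intro connected_continuous_image connected_cos_gt) (rule continuous_on_subset, auto)
  ultimately show ?thesis by (simp only:)
qed

text \<open>On a circle the squared distance to \<open>a\<close> is an affine function of the point,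
  so a disk cuts it in the same arc as a half-plane.\<close>

lemma connected_circle_ball:
  fixes a \<omega> :: complex
  assumes t: "0 < t"
  shows "connected (sphere \<omega> t \<inter> ball a R)" "connected (sphere \<omega> t - cball a R)"
proof -
  have sq: "(cmod (w - a))\<^sup>2 = t\<^sup>2 + 2 * ((\<omega> - a) \<bullet> (w - \<omega>)) + (cmod (\<omega> - a))\<^sup>2" if "w \<in> sphere \<omega> t" for w
  proof -
    have "(cmod (w - a))\<^sup>2 = (norm ((w - \<omega>) + (\<omega> - a)))\<^sup>2" by simp
    also have "\<dots> = (cmod (w - \<omega>))\<^sup>2 + (cmod (\<omega> - a))\<^sup>2 + 2 * ((w - \<omega>) \<bullet> (\<omega> - a))"
      unfolding power2_norm_eq_inner inner_add_left inner_add_right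
      by (simp add: inner_commute[of "\<omega> - a" "w - \<omega>"])
    finally show ?thesis using that by (simp add: dist_norm norm_minus_commute inner_commute)
  qed
  define c where "c = R\<^sup>2 - t\<^sup>2 - (cmod (\<omega> - a))\<^sup>2"
  show "connected (sphere \<omega> t \<inter> ball a R)"
  proof (cases "0 \<le> R")
    case True
    have "sphere \<omega> t \<inter> ball a R = {w \<in> sphere \<omega> t. (2 *\<^sub>R (\<omega> - a)) \<bullet> (w - \<omega>) < c}"
    proof (rule set_eqI)
      fix w
      have "w \<in> ball a R \<longleftrightarrow> (cmod (w - a))\<^sup>2 < R\<^sup>2"
        using True power_mono_iff[of R "cmod (w - a)" 2]
        by (simp add: dist_norm norm_minus_commute not_le[symmetric])
      then show "w \<in> sphere \<omega> t \<inter> ball a R \<longleftrightarrow> w \<in> {w \<in> sphere \<omega> t. (2 *\<^sub>R (\<omega> - a)) \<bullet> (w - \<omega>) < c}"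
        using sq[of w] by (auto simp: c_def)
    qed
    then show ?thesis by (simp only: connected_circle_halfplane[OF t])
  next
    case False
    then have "ball a R = {}" by simp
    then show ?thesis by (simp only: Int_empty_right connected_empty)
  qed
  show "connected (sphere \<omega> t - cball a R)"
  proof (cases "0 \<le> R")
    case True
    have "sphere \<omega> t - cball a R = {w \<in> sphere \<omega> t. (- (2 *\<^sub>R (\<omega> - a))) \<bullet> (w - \<omega>) < - c}"
    proof (rule set_eqI)
      fix w
      have "w \<notin> cball a R \<longleftrightarrow> R\<^sup>2 < (cmod (w - a))\<^sup>2"
        using True power_mono_iff[of "cmod (w - a)" R 2]
        by (simp add: dist_norm norm_minus_commute not_le[symmetric])
      then show "w \<in> sphere \<omega> t - cball a R \<longleftrightarrow> w \<in> {w \<in> sphere \<omega> t. (- (2 *\<^sub>R (\<omega> - a))) \<bullet> (w - \<omega>) < - c}"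
        using sq[of w] by (auto simp: c_def)
    qed
    then show ?thesis by (simp only: connected_circle_halfplane[OF t])
  next
    case False
    then have "cball a R = {}" by simp
    moreover have "connected (sphere \<omega> t)" by (rule connected_sphere) simp
    ultimately show ?thesis by simp
  qed
qed

text \<open>The region is swept out by arcs of circles about \<open>\<omega>\<close>, and a segment
  from \<open>\<omega>\<close> pointing away from \<open>a\<close> meets all of them.\<close>

lemma connected_ball_diff_cball:
  fixes a \<omega> :: complex
  assumes R: "0 \<le> R" and \<omega>: "dist a \<omega> = R" and t: "0 < t"
  shows "connected (ball \<omega> t - cball a R)"
proof -
  \<comment> \<open>For \<open>R = 0\<close> the disk is punctured at its centre, and any direction
    serves.\<close>
  define u where "u = (if R = 0 then 1 else (\<omega> - a) / of_real R)"
  have u: "cmod u = 1" "\<omega> - a = of_real R * u"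
    using R \<omega> by (auto simp: u_def norm_divide dist_norm norm_minus_commute)
  have out: "\<omega> + of_real s * u \<notin> cball a R" "dist \<omega> (\<omega> + of_real s * u) = s" if "0 < s" for s
  proof -
    have "\<omega> + of_real s * u - a = of_real (R + s) * u" using u(2) by (simp add: algebra_simps)
    then have "cmod (\<omega> + of_real s * u - a) = R + s" using u(1) R that by (simp add: norm_mult del: of_real_add)
    then show "\<omega> + of_real s * u \<notin> cball a R" using that by (simp add: dist_norm norm_minus_commute)
    show "dist \<omega> (\<omega> + of_real s * u) = s" using u(1) that by (simp add: dist_norm norm_mult)
  qed
  define L where "L = (\<lambda>s. \<omega> + of_real s * u) ` {0<..<t}"
  have L: "connected L" unfolding L_def
    by (intro connected_continuous_image continuous_intros) auto
  have eq: "ball \<omega> t - cball a R = (\<Union>s\<in>{0<..<t}. (sphere \<omega> s - cball a R) \<union> L)"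
  proof (intro equalityI subsetI)
    fix w assume w: "w \<in> ball \<omega> t - cball a R"
    then have "w \<noteq> \<omega>" using \<omega> by auto
    then show "w \<in> (\<Union>s\<in>{0<..<t}. (sphere \<omega> s - cball a R) \<union> L)"
      using w by (intro UN_I[of "dist \<omega> w"]) auto
  next
    fix w assume "w \<in> (\<Union>s\<in>{0<..<t}. (sphere \<omega> s - cball a R) \<union> L)"
    then obtain s where s: "s \<in> {0<..<t}" "w \<in> sphere \<omega> s - cball a R \<or> w \<in> L" by blast
    from s(2) show "w \<in> ball \<omega> t - cball a R"
    proof
      assume "w \<in> L"
      then show ?thesis using out unfolding L_def by auto
    qed (use s(1) in auto)
  qed
  have "connected ((sphere \<omega> s - cball a R) \<union> L)" if "s \<in> {0<..<t}" for s
  proof -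
    have "\<omega> + of_real s * u \<in> (sphere \<omega> s - cball a R) \<inter> L" using that out[of s] by (auto simp: L_def)
    then show ?thesis using that connected_circle_ball(2)[of s \<omega> a R] by (intro connected_Un L) auto
  qed
  moreover have "\<omega> + of_real (t / 2) * u \<in> L" using t unfolding L_def by (intro imageI) auto
  ultimately show ?thesis unfolding eq by (intro connected_Union) auto
qed

text \<open>Circles have arbitrary centres because \<open>main_component\<close> draws them about
  points of arbitrary connected sets; disks are needed only about boundary points.\<close>

definition connected_sections :: "complex set \<Rightarrow> real \<Rightarrow> bool" where
  "connected_sections D t0 \<longleftrightarrow> 0 < t0 \<and>
     (\<forall>\<omega> t. 0 < t \<and> t < t0 \<longrightarrow> connected (D \<inter> sphere \<omega> t)) \<and>
     (\<forall>\<omega>\<in>frontier D. \<forall>t. 0 < t \<and> t < t0 \<longrightarrow> connected (D \<inter> ball \<omega> t))"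

text \<open>Below half the least distance between boundary circles, a circle, or a disk about a
  boundary point, meets at most one of them, and \<open>D\<close> lies on one side of that one; the
  rest is plane geometry.\<close>

lemma bounded_circular_domain_connected_sections:
  assumes "bounded_circular_domain D"
  obtains t0 where "connected_sections D t0"
proof -
  obtain \<C> where D: "open D" "connected D" "D \<noteq> {}" "bounded D" and C: "finite \<C>" "\<And>a r. (a, r) \<in> \<C> \<Longrightarrow> (0::real) \<le> r"
    and dj: "disjoint_family_on (\<lambda>(a, r). sphere a r) \<C>" and fr: "frontier D = (\<Union>(a, r) \<in> \<C>. sphere a r)"
    using assms unfolding bounded_circular_domain_def by auto
  define S where "S = (\<lambda>(a, r). sphere a (r :: real) :: complex set)"
  have disjS: "S i \<inter> S j = {}" if "i \<in> \<C>" "j \<in> \<C>" "i \<noteq> j" for i j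
    using dj that unfolding disjoint_family_on_def S_def by blast
  have frS: "frontier D = (\<Union>i\<in>\<C>. S i)" using fr by (simp add: S_def)
  obtain e where e: "0 < e" "\<And>i j x y. i \<in> \<C> \<Longrightarrow> j \<in> \<C> \<Longrightarrow> i \<noteq> j \<Longrightarrow> x \<in> S i \<Longrightarrow> y \<in> S j \<Longrightarrow> e \<le> dist x y"
  proof -
    have "\<forall>p. \<exists>d>0. p \<in> \<C> \<times> \<C> \<and> fst p \<noteq> snd p \<longrightarrow> (\<forall>x\<in>S (fst p). \<forall>y\<in>S (snd p). d \<le> dist x y)"
    proof
      fix p :: "(complex \<times> real) \<times> (complex \<times> real)"
      show "\<exists>d>0. p \<in> \<C> \<times> \<C> \<and> fst p \<noteq> snd p \<longrightarrow> (\<forall>x\<in>S (fst p). \<forall>y\<in>S (snd p). d \<le> dist x y)"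
      proof (cases "p \<in> \<C> \<times> \<C> \<and> fst p \<noteq> snd p")
        case True
        then have "S (fst p) \<inter> S (snd p) = {}" by (intro disjS) auto
        moreover have "compact (S (fst p))" "closed (S (snd p))" by (auto simp: S_def case_prod_beta)
        ultimately show ?thesis using separate_compact_closed by metis
      qed (auto intro: exI[of _ 1])
    qed
    then obtain d where d: "\<And>p. 0 < d p"
      "\<And>p x y. p \<in> \<C> \<times> \<C> \<Longrightarrow> fst p \<noteq> snd p \<Longrightarrow> x \<in> S (fst p) \<Longrightarrow> y \<in> S (snd p) \<Longrightarrow> d p \<le> dist x y"
      by metis
    define e where "e = Min (insert 1 (d ` (\<C> \<times> \<C>)))"
    have fin: "finite (d ` (\<C> \<times> \<C>))" using C by simp
    have "0 < e" unfolding e_def using fin d(1) by (subst Min_gr_iff) auto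
    moreover have "e \<le> dist x y" if "i \<in> \<C>" "j \<in> \<C>" "i \<noteq> j" "x \<in> S i" "y \<in> S j" for i j x y
    proof -
      have "e \<le> d (i, j)" unfolding e_def using fin that by (intro Min_le) auto
      also have "\<dots> \<le> dist x y" using d(2)[of "(i, j)"] that by simp
      finally show ?thesis .
    qed
    ultimately show ?thesis by (rule that)
  qed
  have disjD: "D \<inter> frontier D = {}" using D(1) frontier_disjoint_eq by (metis Int_commute)
  have side: "D \<subseteq> ball a R \<or> D \<subseteq> - cball a R" if "(a, R) \<in> \<C>" for a R
  proof (rule ccontr)
    assume no: "\<not> ?thesis"
    have "D \<inter> sphere a R = {}" using disjD frS that by (auto simp: S_def)
    then have cov: "D \<subseteq> ball a R \<union> - cball a R" by (auto simp: set_eq_iff)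
    have "ball a R \<inter> D = {} \<or> (- cball a R) \<inter> D = {}"
      by (rule connectedD[OF D(2)]) (use cov in auto)
    then show False using no cov by blast
  qed
  \<comment> \<open>A connected set that misses the frontier lies inside \<open>D\<close> or misses
    \<open>D\<close>; in both cases its part in \<open>D\<close> is connected.\<close>
  have dich: "connected (D \<inter> X)" if "connected X" "X \<inter> frontier D = {}" for X
  proof -
    have "X \<inter> D = {} \<or> X - D = {}" using connected_Int_frontier[OF that(1), of D] that(2) by blast
    then have "D \<inter> X = {} \<or> D \<inter> X = X" by blast
    then show ?thesis using that(1) by (elim disjE) simp_all
  qed
  have "connected_sections D (e / 2)"
    unfolding connected_sections_def
  proof (intro conjI allI impI ballI; (elim conjE)?)
    fix \<omega> t assume t: "0 < t" "t < e / 2"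
    show "connected (D \<inter> sphere \<omega> t)"
    proof (cases "sphere \<omega> t \<inter> frontier D = {}")
      case True
      have "connected (sphere \<omega> t)" by (rule connected_sphere) simp
      then show ?thesis using True by (rule dich)
    next
      case False
      then obtain p i where p: "p \<in> sphere \<omega> t" and i: "i \<in> \<C>" "p \<in> S i" unfolding frS by blast
      obtain a R where iaR: "i = (a, R)" by (cases i)
      note aR = i(1)[unfolded iaR] and pS = i(2)[unfolded iaR]
      have only: "x \<in> sphere a R" if "x \<in> sphere \<omega> t" "x \<in> frontier D" for x
      proof -
        obtain j where j: "j \<in> \<C>" "x \<in> S j" using \<open>x \<in> frontier D\<close> frS by blast
        have "dist p x \<le> dist \<omega> p + dist \<omega> x" by (rule dist_triangle3)
        then have "dist p x < e" using p \<open>x \<in> sphere \<omega> t\<close> t by simp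
        then have "j = (a, R)" using e(2)[OF aR j(1) _ pS j(2)] by force
        then show ?thesis using j(2) by (simp add: S_def)
      qed
      from side[OF aR] show ?thesis
      proof
        assume sub: "D \<subseteq> ball a R"
        have "connected (D \<inter> (sphere \<omega> t \<inter> ball a R))"
          using only by (intro dich connected_circle_ball t) auto
        moreover have "D \<inter> (sphere \<omega> t \<inter> ball a R) = D \<inter> sphere \<omega> t" using sub by blast
        ultimately show ?thesis by simp
      next
        assume sub: "D \<subseteq> - cball a R"
        have "connected (D \<inter> (sphere \<omega> t - cball a R))"
          using only by (intro dich connected_circle_ball t) auto
        moreover have "D \<inter> (sphere \<omega> t - cball a R) = D \<inter> sphere \<omega> t" using sub by blast
        ultimately show ?thesis by simp
      qed
    qed
  next
    fix \<omega> t assume \<omega>: "\<omega> \<in> frontier D" and t: "0 < t" "t < e / 2"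
    then obtain i where i: "i \<in> \<C>" "\<omega> \<in> S i" unfolding frS by blast
    obtain a R where iaR: "i = (a, R)" by (cases i)
    note aR = i(1)[unfolded iaR] and p = i(2)[unfolded iaR]
    have only: "x \<in> sphere a R" if "x \<in> ball \<omega> t" "x \<in> frontier D" for x
    proof -
      obtain j where j: "j \<in> \<C>" "x \<in> S j" using \<open>x \<in> frontier D\<close> frS by blast
      have "dist \<omega> x < e" using \<open>x \<in> ball \<omega> t\<close> t by simp
      then have "j = (a, R)" using e(2)[OF aR j(1) _ p j(2)] by force
      then show ?thesis using j(2) by (simp add: S_def)
    qed
    from side[OF aR] show "connected (D \<inter> ball \<omega> t)"
    proof
      assume sub: "D \<subseteq> ball a R"
      have "connected (D \<inter> (ball \<omega> t \<inter> ball a R))"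
        using only by (intro dich convex_connected convex_Int convex_ball) auto
      moreover have "D \<inter> (ball \<omega> t \<inter> ball a R) = D \<inter> ball \<omega> t" using sub by blast
      ultimately show ?thesis by simp
    next
      assume sub: "D \<subseteq> - cball a R"
      have "connected (D \<inter> (ball \<omega> t - cball a R))"
        using only p C(2)[OF aR] by (intro dich connected_ball_diff_cball t) (auto simp: S_def)
      moreover have "D \<inter> (ball \<omega> t - cball a R) = D \<inter> ball \<omega> t" using sub by blast
      ultimately show ?thesis by simp
    qed
  qed (use e in auto)
  then show ?thesis by (rule that)
qed

section \<open>Components left by a set of small length\<close>

lemma connected_meets_sphere:
  assumes "connected K" "p \<in> K" "q \<in> K" "dist x p \<le> t" "t \<le> dist x q"
  shows "K \<inter> sphere x t \<noteq> {}"
proof -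
  have "connected (dist x ` K)"
    using assms(1) by (intro connected_continuous_image continuous_intros)
  then have "{dist x p..dist x q} \<subseteq> dist x ` K"
    by (rule connected_contains_Icc) (use assms in simp_all)
  then have "t \<in> dist x ` K" using assms(4,5) by auto
  then show ?thesis by auto
qed

text \<open>The points \<open>p + t * u\<close> and \<open>p - t * u\<close> have distances
  \<open>\<bar>dist y p - t\<bar>\<close> and \<open>dist y p + t\<close> from \<open>y\<close>; the
  connected circle about \<open>p\<close> attains every distance in between.\<close>

lemma circles_meet:
  fixes p y :: complex
  assumes "0 \<le> t" "\<bar>dist y p - t\<bar> \<le> \<tau>" "\<tau> \<le> dist y p + t"
  shows "sphere p t \<inter> sphere y \<tau> \<noteq> {}"
proof -
  define u where "u = (if y = p then 1 else sgn (y - p))"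
  have u: "cmod u = 1" by (simp add: u_def norm_sgn)
  have u: "cmod u = 1" "y - p = of_real (dist y p) * u"
    using u by (auto simp: u_def sgn_eq dist_norm)
  have "dist y (p + of_real t * u) \<le> \<tau>"
  proof -
    have "y - (p + of_real t * u) = of_real (dist y p - t) * u" using u(2) by (simp add: algebra_simps)
    then show ?thesis using u(1) assms by (simp add: dist_norm norm_mult del: of_real_diff)
  qed
  moreover have "\<tau> \<le> dist y (p - of_real t * u)"
  proof -
    have "y - (p - of_real t * u) = of_real (dist y p + t) * u" using u(2) by (simp add: algebra_simps)
    then show ?thesis using u(1) assms by (simp add: dist_norm norm_mult del: of_real_add)
  qed
  moreover have "p + of_real t * u \<in> sphere p t" "p - of_real t * u \<in> sphere p t"
    using u(1) assms(1) by (auto simp: dist_norm norm_mult)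
  moreover have "connected (sphere p t)" by (rule connected_sphere) simp
  ultimately show ?thesis by (metis connected_meets_sphere)
qed

text \<open>The radii of circles about \<open>x\<close> that meet \<open>A\<close> form the
  projection of \<open>A\<close> under the distance to \<open>x\<close>, which is too short to cover
  the interval.\<close>

lemma exists_radius_avoiding:
  assumes "2 * hausdorff1_outer A < ennreal (\<beta> - \<alpha>)"
  obtains t where "\<alpha> < t" "t < \<beta>" "sphere x t \<inter> A = {}"
proof (rule ccontr)
  assume no: "\<not> thesis"
  have "{\<alpha><..<\<beta>} \<subseteq> dist x ` A"
  proof
    fix t assume "t \<in> {\<alpha><..<\<beta>}"
    then have "sphere x t \<inter> A \<noteq> {}" using no that by auto
    then show "t \<in> dist x ` A" by auto
  qed
  moreover have "\<bar>dist x y - dist x z\<bar> \<le> dist y z" for y z 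
    using abs_dist_diff_le[of y x z] by (simp add: dist_commute)
  ultimately have "emeasure lborel {\<alpha><..<\<beta>} \<le> 2 * hausdorff1_outer A"
    by (intro emeasure_projection_le_hausdorff1_outer[where u = "dist x"]) auto
  moreover have "\<alpha> < \<beta>" using assms by (cases "\<alpha> < \<beta>") (auto simp: ennreal_neg)
  ultimately show False using assms by simp
qed

text \<open>Finitely many closed disks in \<open>D\<close> cover \<open>C\<close>, and paths in
  \<open>D\<close> join their centres to one point.\<close>

lemma compact_connected_superset:
  fixes D :: "complex set"
  assumes D: "open D" "connected D" and C: "compact C" "C \<subseteq> D" "C \<noteq> {}"
  obtains E where "compact E" "connected E" "C \<subseteq> E" "E \<subseteq> D"
proof -
  obtain p0 where p0: "p0 \<in> C" using C by blast
  have "\<forall>p. \<exists>e>0. p \<in> C \<longrightarrow> cball p e \<subseteq> D"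
    using D(1) C(2) unfolding open_contains_cball by (metis subsetD zero_less_one)
  then obtain e where e: "\<And>p. 0 < e p" "\<And>p. p \<in> C \<Longrightarrow> cball p (e p) \<subseteq> D" by metis
  have "path_connected D" using D by (simp add: connected_open_path_connected)
  then have "\<forall>p. \<exists>\<gamma>. p \<in> C \<longrightarrow> path \<gamma> \<and> path_image \<gamma> \<subseteq> D \<and> pathstart \<gamma> = p0 \<and> pathfinish \<gamma> = p"
    unfolding path_connected_def using C(2) p0 by blast
  then obtain \<gamma> where \<gamma>: "\<And>p. p \<in> C \<Longrightarrow> path (\<gamma> p) \<and> path_image (\<gamma> p) \<subseteq> D \<and> pathstart (\<gamma> p) = p0 \<and> pathfinish (\<gamma> p) = p"
    by metis
  have "C \<subseteq> (\<Union>p\<in>C. ball p (e p))" using e(1) by auto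
  then obtain F where F: "F \<subseteq> C" "finite F" "C \<subseteq> (\<Union>p\<in>F. ball p (e p))"
    using compactE_image[OF C(1), of C "\<lambda>p. ball p (e p)"] by auto
  define E where "E = (\<Union>p\<in>F. cball p (e p) \<union> path_image (\<gamma> p))"
  show ?thesis
  proof (rule that[of E])
    show "compact E" unfolding E_def
      using F \<gamma> by (intro compact_UN compact_Un compact_cball compact_path_image) auto
    have cp: "connected (cball p (e p) \<union> path_image (\<gamma> p))" "p0 \<in> cball p (e p) \<union> path_image (\<gamma> p)" if "p \<in> F" for p
    proof -
      have g: "path (\<gamma> p)" "pathstart (\<gamma> p) = p0" "pathfinish (\<gamma> p) = p" using \<gamma> F that by auto
      have "p \<in> cball p (e p) \<inter> path_image (\<gamma> p)"
        using pathfinish_in_path_image[of "\<gamma> p"] e(1)[of p] g by simp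
      then show "connected (cball p (e p) \<union> path_image (\<gamma> p))"
        by (intro connected_Un connected_cball connected_path_image g) blast
      show "p0 \<in> cball p (e p) \<union> path_image (\<gamma> p)"
        using pathstart_in_path_image[of "\<gamma> p"] g by simp
    qed
    then have "p0 \<in> (\<Inter>p\<in>F. cball p (e p) \<union> path_image (\<gamma> p))" by blast
    then show "connected E" unfolding E_def using cp(1) by (intro connected_Union) blast+
    show "C \<subseteq> E" unfolding E_def using F(3) by (force simp: subset_iff)
    show "E \<subseteq> D" unfolding E_def using F(1) e(2) \<gamma> by blast
  qed
qed

text \<open>Compactness makes the depth in \<open>D\<close> uniform: otherwise centres and radii
  subconverge, and a point of \<open>D\<close> on the limit circle has neighbours on the
  approximating circles.\<close>

lemma circle_meets_core:
  fixes D :: "complex set"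
  assumes D: "open D" "bounded D" and \<sigma>: "0 < \<sigma>"
    and meet: "\<forall>x\<in>closure D. \<forall>t\<in>{\<sigma>..2 * \<sigma>}. D \<inter> sphere x t \<noteq> {}"
  obtains \<eta> where "0 < \<eta>"
    "\<And>x t. x \<in> closure D \<Longrightarrow> \<sigma> \<le> t \<Longrightarrow> t \<le> 2 * \<sigma> \<Longrightarrow> \<exists>p\<in>sphere x t. ball p \<eta> \<subseteq> D"
proof (rule ccontr)
  assume no: "\<not> thesis"
  have "\<exists>x t. x \<in> closure D \<and> \<sigma> \<le> t \<and> t \<le> 2 * \<sigma> \<and> (\<forall>p\<in>sphere x t. \<not> ball p (1 / real (Suc n)) \<subseteq> D)" for n
  proof (rule ccontr)
    assume "\<not> ?thesis"
    then show False using that[of "1 / real (Suc n)"] no by auto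
  qed
  then obtain x t where xt: "\<And>n. x n \<in> closure D" "\<And>n. \<sigma> \<le> t n" "\<And>n. t n \<le> 2 * \<sigma>"
    "\<And>n p. p \<in> sphere (x n) (t n) \<Longrightarrow> \<not> ball p (1 / real (Suc n)) \<subseteq> D" by metis
  have "compact (closure D \<times> {\<sigma>..2 * \<sigma>})" using D by (intro compact_Times) auto
  moreover have "\<forall>n. (x n, t n) \<in> closure D \<times> {\<sigma>..2 * \<sigma>}" using xt by auto
  ultimately obtain l r where l: "l \<in> closure D \<times> {\<sigma>..2 * \<sigma>}" and r: "strict_mono r"
    and lim: "((\<lambda>n. (x n, t n)) \<circ> r) \<longlonglongrightarrow> l"
    unfolding compact_def by meson
  obtain x' t' where l': "l = (x', t')" by (cases l)
  have limx: "(\<lambda>n. x (r n)) \<longlonglongrightarrow> x'" and limt: "(\<lambda>n. t (r n)) \<longlonglongrightarrow> t'"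
    using tendsto_fst[OF lim] tendsto_snd[OF lim] by (auto simp: l' comp_def)
  have t': "\<sigma> \<le> t'" "t' \<le> 2 * \<sigma>" "x' \<in> closure D" using l l' by auto
  obtain p where p: "p \<in> D" "p \<in> sphere x' t'" using meet t' by (meson atLeastAtMost_iff disjoint_iff)
  obtain e where e: "0 < e" "ball p e \<subseteq> D" using D(1) p(1) openE by blast
  \<comment> \<open>\<open>p\<close> is carried to the circle about \<open>x (r n)\<close> by moving
    the centre and rescaling the radius.\<close>
  define q where "q n = x (r n) + of_real (t (r n) / t') * (p - x')" for n
  have "q \<longlonglongrightarrow> x' + of_real (t' / t') * (p - x')"
    unfolding q_def using t' \<sigma> by (intro tendsto_intros limx limt) auto
  then have "q \<longlonglongrightarrow> p" using t' \<sigma> by simp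
  then have "\<forall>\<^sub>F n in sequentially. dist (q n) p < e / 2" using e tendstoD half_gt_zero by blast
  moreover have "\<forall>\<^sub>F n in sequentially. 1 / real (Suc n) < e / 2"
    using e(1) order_tendstoD(2)[OF LIMSEQ_Suc[OF lim_1_over_n], of "e / 2"] by simp
  ultimately have "\<forall>\<^sub>F n in sequentially. False"
  proof eventually_elim
    case (elim n)
    have "dist x' p = t'" using p(2) by simp
    then have "dist (x (r n)) (q n) = t (r n)"
      using t' \<sigma> xt(2)[of "r n"] by (simp add: q_def dist_norm norm_mult norm_divide norm_minus_commute)
    then have "\<not> ball (q n) (1 / real (Suc (r n))) \<subseteq> D" by (intro xt(4)) simp
    moreover have "ball (q n) (1 / real (Suc (r n))) \<subseteq> ball p e"
    proof
      fix z assume "z \<in> ball (q n) (1 / real (Suc (r n)))"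
      moreover have "1 / real (Suc (r n)) \<le> 1 / real (Suc n)"
        using seq_suble[OF r, of n] by (simp add: frac_le)
      ultimately have "dist (q n) z < e / 2" using elim by simp
      then show "z \<in> ball p e" using elim dist_triangle2[of p z "q n"] by (simp add: dist_commute)
    qed
    ultimately show False using e by blast
  qed
  then show False by simp
qed

text \<open>Concentric circles that avoid \<open>A\<close> exist at every scale, and they link everything to a fixed
  compact core of \<open>D\<close>.\<close>

lemma main_component:
  assumes D: "open D" "connected D" "D \<noteq> {}" "bounded D" and t0: "connected_sections D t0" and s: "0 < s"
  obtains \<delta> where "0 < \<delta>"
    "\<And>A. hausdorff1_outer A < ennreal \<delta> \<Longrightarrow> \<exists>W. connected W \<and> W \<subseteq> D - A \<and>
        (\<forall>K. connected K \<and> K \<subseteq> D \<and> s \<le> diameter K \<longrightarrow> K \<inter> W \<noteq> {})"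
proof -
  obtain y1 y2 where y12: "y1 \<in> D" "y2 \<in> D" "y1 \<noteq> y2"
  proof -
    obtain y e where "y \<in> D" "0 < e" "ball y e \<subseteq> D" using D openE by (metis equals0I)
    moreover from this have "y + of_real (e / 2) \<in> ball y e" by (simp add: dist_norm)
    ultimately show ?thesis using that[of y "y + of_real (e / 2)"] by auto
  qed
  \<comment> \<open>The radius \<open>2 * \<sigma>\<close> stays below half of
    \<open>dist y1 y2\<close>, so that no such circle encloses both points; below
    \<open>s / 3\<close>, so that a connected set of diameter at least \<open>s\<close> crosses such
    circles about any of its points; and below \<open>t0\<close>.\<close>
  define \<sigma> where "\<sigma> = min (dist y1 y2) (min s t0) / 8"
  have "0 < t0" using t0 by (simp add: connected_sections_def)
  then have \<sigma>: "0 < \<sigma>" "2 * \<sigma> < dist y1 y2 / 2" "2 * \<sigma> < s / 3" "2 * \<sigma> < t0"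
    using y12(3) s by (auto simp: \<sigma>_def min_def)
  have meet: "D \<inter> sphere x t \<noteq> {}" if x: "x \<in> closure D" and t: "\<sigma> \<le> t" "t \<le> 2 * \<sigma>" for x t
  proof -
    obtain p where p: "p \<in> D" "dist p x < t" using x t \<sigma> closure_approachable[of x D] by auto
    have "dist y1 y2 \<le> dist x y1 + dist x y2" by (rule dist_triangle3)
    then have "t \<le> dist x y1 \<or> t \<le> dist x y2" using t \<sigma> by linarith
    then obtain q where "q \<in> D" "t \<le> dist x q" using y12 by blast
    then show ?thesis using p by (intro connected_meets_sphere[OF D(2), of p q]) (auto simp: dist_commute)
  qed
  obtain \<eta> where \<eta>: "0 < \<eta>"
    "\<And>x t. x \<in> closure D \<Longrightarrow> \<sigma> \<le> t \<Longrightarrow> t \<le> 2 * \<sigma> \<Longrightarrow> \<exists>p\<in>sphere x t. ball p \<eta> \<subseteq> D"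
  proof (rule circle_meets_core[OF D(1,4) \<sigma>(1)])
    show "\<forall>x\<in>closure D. \<forall>t\<in>{\<sigma>..2 * \<sigma>}. D \<inter> sphere x t \<noteq> {}" using meet by simp
  qed blast
  define C where "C = {p. ball p \<eta> \<subseteq> D}"
  have CD: "C \<subseteq> D" using \<eta>(1) by (auto simp: C_def)
  have "compact C"
  proof -
    have "C = (\<Inter>w\<in>-D. {p. \<eta> \<le> dist p w})"
    proof (intro equalityI subsetI)
      fix p assume "p \<in> C"
      then show "p \<in> (\<Inter>w\<in>-D. {p. \<eta> \<le> dist p w})" by (auto simp: C_def subset_iff not_less[symmetric])
    next
      fix p assume p: "p \<in> (\<Inter>w\<in>-D. {p. \<eta> \<le> dist p w})"
      have "w \<in> D" if "dist p w < \<eta>" for w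
      proof (rule ccontr)
        assume "w \<notin> D"
        then have "\<eta> \<le> dist p w" using p by blast
        then show False using that by linarith
      qed
      then show "p \<in> C" by (auto simp: C_def)
    qed
    moreover have "closed (\<Inter>w\<in>-D. {p. \<eta> \<le> dist p w})"
      by (intro closed_INT ballI closed_Collect_le continuous_intros)
    ultimately show ?thesis using bounded_subset[OF D(4) CD] by (simp add: compact_eq_bounded_closed)
  qed
  moreover have "C \<noteq> {}"
    using \<eta>(2)[of y1 \<sigma>] y12 \<sigma> closure_subset[of D] by (auto simp: C_def)
  ultimately obtain E where E: "compact E" "connected E" "C \<subseteq> E" "E \<subseteq> D"
    using compact_connected_superset[OF D(1,2) _ CD] by metis
  have "E \<inter> -D = {}" "closed (-D)" using E D by auto
  then obtain d where d: "0 < d" "\<And>p w. p \<in> E \<Longrightarrow> w \<in> -D \<Longrightarrow> d \<le> dist p w"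
    using separate_compact_closed[OF E(1), of "-D"] by blast
  \<comment> \<open>Circles of radius below \<open>\<eta>'\<close> about points of \<open>E\<close>
    lie in \<open>D\<close>, and so do the auxiliary circles with displaced centres, whence the
    factor 2. The bound \<open>\<eta>' < \<sigma>\<close> makes the small circles cross any circle
    of radius above \<open>\<sigma>\<close> through their centre.\<close>
  define \<eta>' where "\<eta>' = min (min d \<eta>) \<sigma> / 2"
  have \<eta>': "0 < \<eta>'" "2 * \<eta>' \<le> d" "\<eta>' < \<eta>" "\<eta>' < \<sigma>" using d(1) \<eta>(1) \<sigma> by (auto simp: \<eta>'_def min_def)
  have inD: "z \<in> D" if "p \<in> E" "dist p z < 2 * \<eta>'" for p z
    using d(2)[OF that(1), of z] that(2) \<eta>' by fastforce
  \<comment> \<open>\<open>2 * \<delta>\<close> fits into both windows of radii, from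
    \<open>\<sigma>\<close> to \<open>2 * \<sigma>\<close> and from \<open>\<eta>' / 2\<close> to
    \<open>\<eta>'\<close>.\<close>
  define \<delta> where "\<delta> = min \<sigma> (\<eta>' / 2) / 2"
  show ?thesis
  proof (rule that[of \<delta>])
    show "0 < \<delta>" using \<sigma> \<eta>' by (simp add: \<delta>_def)
    fix A assume A: "hausdorff1_outer A < ennreal \<delta>"
    have "2 * hausdorff1_outer A < 2 * ennreal \<delta>"
      using A by (intro ennreal_mult_strict_left_mono) auto
    also have "\<dots> = ennreal (min \<sigma> (\<eta>' / 2))"
      using \<sigma> \<eta>' by (subst ennreal_numeral[symmetric], subst ennreal_mult[symmetric]) (auto simp: \<delta>_def)
    finally have A2: "2 * hausdorff1_outer A < ennreal (min \<sigma> (\<eta>' / 2))" .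
    have A\<sigma>: "2 * hausdorff1_outer A < ennreal (2 * \<sigma> - \<sigma>)"
      by (rule order.strict_trans2[OF A2]) (auto intro: ennreal_leI)
    have A\<eta>: "2 * hausdorff1_outer A < ennreal (\<eta>' - \<eta>' / 2)"
      by (rule order.strict_trans2[OF A2]) (auto intro!: ennreal_leI)
    define good where "good p t \<longleftrightarrow> \<eta>' / 2 < t \<and> t < \<eta>' \<and> sphere p t \<inter> A = {}" for p :: complex and t
    have ex: "\<exists>t. good p t" for p
      using exists_radius_avoiding[OF A\<eta>, of p] unfolding good_def by metis
    have conn: "connected (sphere p t)" for p :: complex and t by (rule connected_sphere) simp
    \<comment> \<open>Quantifying over all good radii makes the relation independent of the circle
      chosen about each centre.\<close>
    define R where "R p p' \<longleftrightarrow> (\<forall>t t'. good p t \<and> good p' t' \<longrightarrow>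
        (\<forall>x\<in>sphere p t. \<forall>y\<in>sphere p' t'. connected_component (D - A) x y))" for p p'
    have goodD: "sphere p t \<subseteq> D - A" if "p \<in> E" "good p t" for p t
      using that inD[of p] \<eta>'(1) by (auto simp: good_def)
    have ne: "sphere p t \<noteq> {}" if "good p t" for p t
      using that \<eta>'(1) by (auto simp: good_def)
    have Rnear: "R p p'" if p: "p \<in> E" "p' \<in> E" "dist p p' < \<eta>' / 4" for p p'
      unfolding R_def
    proof (intro allI impI ballI, elim conjE)
      fix t t' x x' assume g: "good p t" "good p' t'" and x: "x \<in> sphere p t" "x' \<in> sphere p' t'"
      \<comment> \<open>Circles about the nearby centres \<open>p\<close> and \<open>p'\<close> may
        be nested. At distance three quarters of \<open>\<eta>'\<close> from \<open>p\<close>, a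
        good circle about \<open>y\<close> crosses both, for all radii in the window.\<close>
      define y where "y = p + of_real (3 / 4 * \<eta>')"
      have yp: "dist y p = 3 / 4 * \<eta>'" using \<eta>'(1) by (simp add: y_def dist_norm del: of_real_mult of_real_divide)
      have yp': "\<eta>' / 2 \<le> dist y p'" "dist y p' \<le> \<eta>'"
        using dist_triangle[of y p p'] dist_triangle2[of y p' p] dist_triangle[of y p' p] yp p(3) by (auto simp: dist_commute)
      obtain \<tau> where \<tau>: "good y \<tau>" using ex by blast
      have b: "\<eta>' / 2 < t" "t < \<eta>'" "\<eta>' / 2 < t'" "t' < \<eta>'" "\<eta>' / 2 < \<tau>" "\<tau> < \<eta>'"
        using g \<tau> by (auto simp: good_def)
      have "sphere p t \<inter> sphere y \<tau> \<noteq> {}" by (rule circles_meet) (use b yp in \<open>auto simp: abs_le_iff\<close>)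
      then obtain a where a: "a \<in> sphere p t" "a \<in> sphere y \<tau>" by blast
      have "sphere p' t' \<inter> sphere y \<tau> \<noteq> {}" by (rule circles_meet) (use b yp' in \<open>auto simp: abs_le_iff\<close>)
      then obtain a' where a': "a' \<in> sphere p' t'" "a' \<in> sphere y \<tau>" by blast
      have "sphere y \<tau> \<subseteq> D - A"
      proof
        fix z assume z: "z \<in> sphere y \<tau>"
        have "dist p z < 2 * \<eta>'"
          using dist_triangle2[of p z y] dist_triangle[of p z y] z yp b by (simp add: dist_commute)
        then show "z \<in> D - A" using inD[OF p(1)] z \<tau> by (auto simp: good_def)
      qed
      then have "connected_component (D - A) a a'"
        unfolding connected_component_def using conn[of y \<tau>] a a' by blast
      moreover have "connected_component (D - A) x a"
        unfolding connected_component_def using conn[of p t] goodD[OF p(1) g(1)] x a by blast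
      moreover have "connected_component (D - A) a' x'"
        unfolding connected_component_def using conn[of p' t'] goodD[OF p(2) g(2)] x a' by blast
      ultimately show "connected_component (D - A) x x'"
        using connected_component_trans by metis
    qed
    \<comment> \<open>A transitive symmetric relation that holds locally holds throughout the
      connected set \<open>E\<close>.\<close>
    have Rall: "R p p'" if "p \<in> E" "p' \<in> E" for p p'
    proof (rule connected_equivalence_relation[OF E(2) that])
      show "R y x" if "R x y" for x y
        using that unfolding R_def by (metis connected_component_sym)
      show "R x z" if "R x y" "R y z" for x y z
        unfolding R_def
      proof (intro allI impI ballI, elim conjE)
        fix t t' u w assume g: "good x t" "good z t'" and u: "u \<in> sphere x t" "w \<in> sphere z t'"
        obtain \<tau> where \<tau>: "good y \<tau>" using ex by blast
        obtain v where v: "v \<in> sphere y \<tau>" using ne[OF \<tau>] by blast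
        have "connected_component (D - A) u v" "connected_component (D - A) v w"
          using that g \<tau> u v unfolding R_def by blast+
        then show "connected_component (D - A) u w" by (rule connected_component_trans)
      qed
      show "\<exists>T. openin (top_of_set E) T \<and> a \<in> T \<and> (\<forall>x\<in>T. R a x)" if "a \<in> E" for a
      proof (intro exI conjI ballI)
        show "openin (top_of_set E) (E \<inter> ball a (\<eta>' / 4))" by (intro openin_open_Int) simp
        show "a \<in> E \<inter> ball a (\<eta>' / 4)" using that \<eta>' by simp
        fix x assume "x \<in> E \<inter> ball a (\<eta>' / 4)"
        then show "R a x" using that by (intro Rnear) auto
      qed
    qed
    obtain p0 where p0: "p0 \<in> E" using \<open>C \<noteq> {}\<close> E(3) by blast
    obtain \<tau>0 where \<tau>0: "good p0 \<tau>0" using ex by blast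
    obtain x0 where x0: "x0 \<in> sphere p0 \<tau>0" using ne[OF \<tau>0] by blast
    define W where "W = connected_component_set (D - A) x0"
    show "\<exists>W. connected W \<and> W \<subseteq> D - A \<and> (\<forall>K. connected K \<and> K \<subseteq> D \<and> s \<le> diameter K \<longrightarrow> K \<inter> W \<noteq> {})"
    proof (intro exI[of _ W] conjI allI impI; (elim conjE)?)
      show "connected W" "W \<subseteq> D - A" unfolding W_def by (auto simp: connected_component_subset)
      fix K assume K: "connected K" "K \<subseteq> D" "s \<le> diameter K"
      have "K \<noteq> {}" using K(3) s by auto
      then obtain x where x: "x \<in> K" by blast
      obtain y where y: "y \<in> K" "s / 3 \<le> dist x y"
      proof (rule ccontr)
        assume no: "\<not> thesis"
        then have lt: "dist x y < s / 3" if "y \<in> K" for y using \<open>\<And>y. \<lbrakk>y \<in> K; s / 3 \<le> dist x y\<rbrakk> \<Longrightarrow> thesis\<close> that by force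
        have "diameter K \<le> 2 * (s / 3)"
        proof (rule diameter_le)
          fix u v assume "u \<in> K" "v \<in> K"
          then show "norm (u - v) \<le> 2 * (s / 3)"
            using lt[of u] lt[of v] dist_triangle3[of u v x] by (simp add: dist_norm)
        qed (use s in auto)
        then show False using K(3) s by linarith
      qed
      \<comment> \<open>This circle about \<open>x\<close> avoids \<open>A\<close> and carries a
        point of \<open>K\<close> and a point of the core; its part in \<open>D\<close> is connected
        and joins \<open>K\<close> to the good circles.\<close>
      obtain t where t: "\<sigma> < t" "t < 2 * \<sigma>" "sphere x t \<inter> A = {}"
        using exists_radius_avoiding[OF A\<sigma>, of x] by metis
      have "K \<inter> sphere x t \<noteq> {}"
        using x y t \<sigma> by (intro connected_meets_sphere[OF K(1) x y(1)]) auto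
      then obtain k where k: "k \<in> K" "k \<in> sphere x t" by blast
      have xc: "x \<in> closure D" using x K(2) closure_subset by blast
      obtain p where p: "p \<in> sphere x t" "ball p \<eta> \<subseteq> D" using \<eta>(2)[OF xc, of t] t by auto
      then have pE: "p \<in> E" using E(3) by (auto simp: C_def)
      obtain \<tau> where \<tau>: "good p \<tau>" using ex by blast
      have "sphere p \<tau> \<inter> sphere x t \<noteq> {}"
        by (rule circles_meet) (use p(1) \<tau> \<eta>' t in \<open>auto simp: good_def\<close>)
      then obtain a where a: "a \<in> sphere p \<tau>" "a \<in> sphere x t" by blast
      have aD: "a \<in> D" using a(1) \<tau> \<eta>' p(2) by (auto simp: good_def)
      have "connected (D \<inter> sphere x t)" using t0 t \<sigma> unfolding connected_sections_def by auto
      then have "connected_component (D - A) a k"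
        unfolding connected_component_def using a aD k K(2) t(3) by (intro exI[of _ "D \<inter> sphere x t"]) auto
      moreover have "connected_component (D - A) x0 a"
        using Rall[OF p0 pE] \<tau>0 \<tau> x0 a(1) unfolding R_def by blast
      ultimately have "k \<in> W" unfolding W_def by (auto intro: connected_component_trans)
      then show "K \<inter> W \<noteq> {}" using k by blast
    qed
  qed
qed


section \<open>Images of circles shrinking to a boundary point\<close>

definition shrinking_circles :: "(complex \<Rightarrow> complex) \<Rightarrow> complex set \<Rightarrow> complex \<Rightarrow> bool" where
  "shrinking_circles k D1 \<omega> \<longleftrightarrow>
     (\<forall>\<epsilon>>0. \<exists>t. 0 < t \<and> t < \<epsilon> \<and> diameter (k ` (D1 \<inter> sphere \<omega> t)) < \<epsilon>)"

text \<open>Only positivity of the bound for one fixed annulus is recorded; \<open>I + 1\<close>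
  replaces \<open>I\<close> so that the denominator is positive.\<close>

lemma length_area_bound_pos:
  assumes lab: "length_area_bound h D Q z0 b0" and ab: "0 < a" "a < b" "b < b0" and fin: "Q_annulus Q z0 a b < top"
  obtains c where "0 < c"
    "\<forall>P. P \<in> borel_measurable borel \<and>
       (\<forall>r. a < r \<and> r < b \<longrightarrow> 1 \<le> (\<integral>\<^sup>+w\<in>h ` (D \<inter> sphere z0 r). P w \<partial>hausdorff1_borel)) \<longrightarrow>
       ennreal c \<le> (\<integral>\<^sup>+w. (P w)\<^sup>2 \<partial>lborel)"
proof -
  define I where "I = enn2real (Q_annulus Q z0 a b)"
  have I: "Q_annulus Q z0 a b = ennreal I" "0 \<le> I" using fin by (auto simp: I_def)
  define L where "L = (ln (b / a))\<^sup>2"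
  have "ln (b / a) \<noteq> 0" using ab by (simp add: ln_eq_zero_iff)
  then have L: "0 < L" by (simp add: L_def)
  have cpos: "0 < 288 * pi * (I + 1)" using I by (simp add: add_nonneg_pos)
  show ?thesis
  proof (rule that[of "L / (288 * pi * (I + 1))"], goal_cases)
    case 1
    show ?case using L cpos by simp
  next
    case 2
    show ?case
    proof (intro allI impI, elim conjE)
      fix P :: "complex \<Rightarrow> ennreal" assume P: "P \<in> borel_measurable borel"
        "\<forall>r. a < r \<and> r < b \<longrightarrow> 1 \<le> (\<integral>\<^sup>+w\<in>h ` (D \<inter> sphere z0 r). P w \<partial>hausdorff1_borel)"
      have "ennreal L \<le> ennreal (288 * pi) * (\<integral>\<^sup>+w. (P w)\<^sup>2 \<partial>lborel) * Q_annulus Q z0 a b"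
        using lab ab fin P unfolding length_area_bound_def L_def by auto
      also have "\<dots> \<le> ennreal (288 * pi) * (\<integral>\<^sup>+w. (P w)\<^sup>2 \<partial>lborel) * ennreal (I + 1)"
        unfolding I by (intro mult_left_mono ennreal_leI) auto
      also have "\<dots> = (\<integral>\<^sup>+w. (P w)\<^sup>2 \<partial>lborel) * ennreal (288 * pi * (I + 1))"
      proof -
        have "ennreal (288 * pi * (I + 1)) = ennreal (288 * pi) * ennreal (I + 1)"
          using I(2) by (intro ennreal_mult) auto
        then show ?thesis by (simp only: mult_ac)
      qed
      finally have "ennreal L / ennreal (288 * pi * (I + 1)) \<le> (\<integral>\<^sup>+w. (P w)\<^sup>2 \<partial>lborel)"
        using cpos by (intro divide_le_posI_ennreal) (auto simp: mult.commute)
      then show "ennreal (L / (288 * pi * (I + 1))) \<le> (\<integral>\<^sup>+w. (P w)\<^sup>2 \<partial>lborel)"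
        using cpos L by (subst divide_ennreal[symmetric]) auto
    qed
  qed
qed

text \<open>Points are moved radially from \<open>\<omega>\<close>. Openness later makes the sets of
  radii in \<open>shrinking_circles_length_area\<close> Borel.\<close>

lemma open_dist_image:
  fixes X :: "complex set"
  assumes "open X" "\<omega> \<notin> X"
  shows "open (dist \<omega> ` X)"
  unfolding open_dist
proof (intro ballI)
  fix t assume "t \<in> dist \<omega> ` X"
  then obtain w where w: "w \<in> X" "t = dist \<omega> w" by blast
  then obtain e where e: "0 < e" "ball w e \<subseteq> X" using assms(1) openE by blast
  have t: "0 < t" using w assms(2) by auto
  show "\<exists>e>0. \<forall>y. dist y t < e \<longrightarrow> y \<in> dist \<omega> ` X"
  proof (intro exI[of _ "min e t"] conjI allI impI)
    fix y assume y: "dist y t < min e t"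
    define v where "v = \<omega> + of_real (y / t) * (w - \<omega>)"
    have y0: "0 < y" using y by (auto simp: dist_real_def)
    have "w - v = of_real (1 - y / t) * (w - \<omega>)" by (simp add: v_def algebra_simps)
    then have "dist w v = \<bar>1 - y / t\<bar> * t"
      using w(2) by (simp add: dist_norm norm_mult norm_minus_commute del: of_real_diff of_real_divide)
    also have "\<dots> = \<bar>t - y\<bar>" using t by (simp add: field_simps flip: abs_mult_pos)
    finally have "v \<in> ball w e" using y by (simp add: dist_real_def abs_minus_commute)
    moreover have "dist \<omega> v = y" using w(2) t y0
      by (simp add: v_def dist_norm norm_mult norm_divide norm_minus_commute)
    ultimately show "y \<in> dist \<omega> ` X" using e by (metis image_eqI subsetD)
  qed (use e t in auto)
qed

lemma dyadic_annulus_unique: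
  fixes T :: real
  assumes "T / 2 ^ Suc i < d" "d < T / 2 ^ i" "T / 2 ^ Suc j < d" "d < T / 2 ^ j" "0 < T"
  shows "i = j"
proof -
  have "\<not> i < j" if "T / 2 ^ Suc i < d" "d < T / 2 ^ j" for i j
  proof
    assume "i < j"
    then have "T / 2 ^ j \<le> T / 2 ^ Suc i"
      using assms(5) by (intro divide_left_mono power_increasing) auto
    then show False using that by linarith
  qed
  then show ?thesis using assms by (meson linorder_neqE_nat)
qed

lemma measure_pigeonhole:
  fixes Y :: "'a \<Rightarrow> real set"
  assumes Z: "finite Z" and Y: "\<And>z. z \<in> Z \<Longrightarrow> Y z \<in> sets borel"
    and cov: "{\<alpha><..<\<beta>} \<subseteq> (\<Union>z\<in>Z. Y z)" and ab: "\<alpha> < \<beta>"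
  obtains z where "z \<in> Z" "ennreal ((\<beta> - \<alpha>) / real (card Z)) \<le> emeasure lborel (Y z \<inter> {\<alpha><..<\<beta>})"
proof -
  have ne: "Z \<noteq> {}"
  proof
    assume "Z = {}"
    then have "{\<alpha><..<\<beta>} = {}" using cov by simp
    then show False using ab by simp
  qed
  then have n: "0 < real (card Z)" using Z by (simp add: card_gt_0_iff)
  show ?thesis
  proof (rule ccontr)
    assume "\<not> thesis"
    then have lt: "emeasure lborel (Y z \<inter> {\<alpha><..<\<beta>}) < ennreal ((\<beta> - \<alpha>) / real (card Z))" if "z \<in> Z" for z
      using that \<open>\<And>z. z \<in> Z \<Longrightarrow> _ \<Longrightarrow> thesis\<close> not_less by blast
    define m where "m z = enn2real (emeasure lborel (Y z \<inter> {\<alpha><..<\<beta>}))" for z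
    have m: "emeasure lborel (Y z \<inter> {\<alpha><..<\<beta>}) = ennreal (m z)" "m z < (\<beta> - \<alpha>) / real (card Z)" if "z \<in> Z" for z
    proof -
      have "emeasure lborel (Y z \<inter> {\<alpha><..<\<beta>}) < top"
        using lt[OF that] by (rule order.strict_trans) simp
      then show eq: "emeasure lborel (Y z \<inter> {\<alpha><..<\<beta>}) = ennreal (m z)" by (simp add: m_def)
      show "m z < (\<beta> - \<alpha>) / real (card Z)"
        using lt[OF that] unfolding eq by (subst (asm) ennreal_less_iff) (auto simp: m_def)
    qed
    have "ennreal (\<beta> - \<alpha>) = emeasure lborel {\<alpha><..<\<beta>}" using ab by simp
    also have "\<dots> \<le> emeasure lborel (\<Union>z\<in>Z. Y z \<inter> {\<alpha><..<\<beta>})"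
      using cov Y Z by (intro emeasure_mono) auto
    also have "\<dots> \<le> (\<Sum>z\<in>Z. emeasure lborel (Y z \<inter> {\<alpha><..<\<beta>}))"
      using Z Y by (intro emeasure_subadditive_finite) auto
    also have "\<dots> = ennreal (\<Sum>z\<in>Z. m z)"
      using m(1) by (subst sum_ennreal[symmetric]) (auto simp: m_def)
    finally have "\<beta> - \<alpha> \<le> (\<Sum>z\<in>Z. m z)"
      by (subst (asm) ennreal_le_iff) (auto simp: m_def intro: sum_nonneg)
    also have "\<dots> < (\<Sum>z\<in>Z. (\<beta> - \<alpha>) / real (card Z))"
      using m(2) Z ne by (intro sum_strict_mono) auto
    also have "\<dots> = \<beta> - \<alpha>" using n by simp
    finally show False by simp
  qed
qed

text \<open>If every small circle about \<open>\<omega>\<close> had an image of diameter at least \<open>\<epsilon>\<close>, then for some \<open>z0\<close> all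
  sections near one fixed radius would have images crossing, at infinitely many dyadic scales, a fixed
  proportion of the circles about \<open>\<omega>\<close>; spreading a density evenly over \<open>M\<close> such scales gives the
  family of sections a modulus of order \<open>1 / M\<close>.\<close>

lemma shrinking_circles_length_area:
  assumes h: "homeomorphism D D1 h k" and D: "open D" "bounded D" and D1: "open D1"
    and t0: "connected_sections D1 t0" and \<omega>: "\<omega> \<in> frontier D1"
    and lab: "\<And>z0. z0 \<in> frontier D \<Longrightarrow> \<exists>Q b0. 0 < b0 \<and> length_area_bound h D Q z0 b0 \<and> slow_Q_growth Q z0 b0"
  shows "shrinking_circles k D1 \<omega>"
  unfolding shrinking_circles_def
proof (intro allI impI, rule ccontr)
  fix \<epsilon> :: real assume \<epsilon>: "0 < \<epsilon>"
  assume "\<nexists>t. 0 < t \<and> t < \<epsilon> \<and> diameter (k ` (D1 \<inter> sphere \<omega> t)) < \<epsilon>"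
  then have big: "\<epsilon> \<le> diameter (k ` (D1 \<inter> sphere \<omega> t))" if "0 < t" "t < \<epsilon>" for t
    using that not_less by blast
  have kD: "k ` D1 = D" "h ` D = D1" and kc: "continuous_on D1 k" and hc: "continuous_on D h"
    and hk: "\<And>w. w \<in> D1 \<Longrightarrow> h (k w) = w" and kh: "\<And>z. z \<in> D \<Longrightarrow> k (h z) = z"
    using h by (auto simp: homeomorphism_def)
  have \<omega>D1: "\<omega> \<notin> D1" using \<omega> D1 frontier_disjoint_eq by blast
  define pos where "pos z b c \<longleftrightarrow> 0 < b \<and> 2 * b < \<epsilon> \<and> 0 < c \<and>
      (\<forall>P. P \<in> borel_measurable borel \<and>
         (\<forall>r. b / 2 < r \<and> r < b \<longrightarrow> 1 \<le> (\<integral>\<^sup>+w\<in>h ` (D \<inter> sphere z r). P w \<partial>hausdorff1_borel)) \<longrightarrow>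
         ennreal c \<le> (\<integral>\<^sup>+w. (P w)\<^sup>2 \<partial>lborel))" for z b c
  have "\<exists>b c. pos z b c" if "z \<in> frontier D" for z
  proof -
    from that obtain Q b0 where b0: "0 < b0" "length_area_bound h D Q z b0" "slow_Q_growth Q z b0"
      using lab by blast
    \<comment> \<open>With \<open>2 * b < \<epsilon>\<close>, a set of diameter at least
      \<open>\<epsilon>\<close> does not fit into the disk of radius \<open>b\<close>.\<close>
    define b where "b = min b0 \<epsilon> / 3"
    have b: "0 < b" "b < b0" "2 * b < \<epsilon>" using b0(1) \<epsilon> by (auto simp: b_def min_def)
    have fin: "Q_annulus Q z (b / 2) b < top" using b0(3) b unfolding slow_Q_growth_def by simp
    have b2: "0 < b / 2" "b / 2 < b" using b by auto
    obtain c where "0 < c"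
      "\<forall>P. P \<in> borel_measurable borel \<and>
         (\<forall>r. b / 2 < r \<and> r < b \<longrightarrow> 1 \<le> (\<integral>\<^sup>+w\<in>h ` (D \<inter> sphere z r). P w \<partial>hausdorff1_borel)) \<longrightarrow>
         ennreal c \<le> (\<integral>\<^sup>+w. (P w)\<^sup>2 \<partial>lborel)"
      by (rule length_area_bound_pos[OF b0(2) b2 b(2) fin])
    then have "pos z b c" unfolding pos_def using b by simp
    then show ?thesis by blast
  qed
  then obtain b c where "\<And>z. z \<in> frontier D \<Longrightarrow> pos z (b z) (c z)" by metis
  then have bc: "\<And>z. z \<in> frontier D \<Longrightarrow> 0 < b z" "\<And>z. z \<in> frontier D \<Longrightarrow> 2 * b z < \<epsilon>"
    "\<And>z. z \<in> frontier D \<Longrightarrow> 0 < c z" and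
    cP: "\<And>z P. z \<in> frontier D \<Longrightarrow> P \<in> borel_measurable borel \<Longrightarrow>
         (\<And>r. b z / 2 < r \<Longrightarrow> r < b z \<Longrightarrow> 1 \<le> (\<integral>\<^sup>+w\<in>h ` (D \<inter> sphere z r). P w \<partial>hausdorff1_borel)) \<Longrightarrow>
         ennreal (c z) \<le> (\<integral>\<^sup>+w. (P w)\<^sup>2 \<partial>lborel)"
    by (simp_all add: pos_def)
  have "compact (frontier D)" using D(2) by (rule compact_frontier_bounded)
  moreover have "frontier D \<subseteq> (\<Union>z\<in>frontier D. ball z (b z / 2))" using bc(1) by auto
  ultimately obtain Z where Z: "Z \<subseteq> frontier D" "finite Z" "frontier D \<subseteq> (\<Union>z\<in>Z. ball z (b z / 2))"
    using compactE_image[of "frontier D" "frontier D" "\<lambda>z. ball z (b z / 2)"] by auto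
  \<comment> \<open>\<open>D - V\<close> is compact, so its image keeps a distance \<open>t1\<close>
    from \<open>\<omega>\<close>; smaller circles have their preimages inside the half-size
    disks.\<close>
  define V where "V = (\<Union>z\<in>Z. ball z (b z / 2))"
  have V: "open V" "frontier D \<subseteq> V" using Z(3) by (auto simp: V_def)
  have "D - V = closure D - V"
    using V(2) D(1) closure_subset[of D] by (auto simp: frontier_def interior_open)
  moreover have "compact (closure D - V)"
    using D(2) V(1) by (intro compact_diff) auto
  ultimately have "compact (h ` (D - V))"
    using hc by (intro compact_continuous_image continuous_on_subset[OF hc]) auto
  moreover have "\<omega> \<notin> h ` (D - V)" using \<omega>D1 kD by blast
  ultimately obtain t1 where t1: "0 < t1" "\<And>w. w \<in> h ` (D - V) \<Longrightarrow> t1 \<le> dist \<omega> w"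
    using separate_point_closed[OF compact_imp_closed] by metis
  define T where "T = min (min t1 \<epsilon>) t0"
  have T: "0 < T" "T \<le> t1" "T \<le> \<epsilon>" "T \<le> t0"
    using t1(1) \<epsilon> t0 by (auto simp: T_def connected_sections_def)
  \<comment> \<open>For these radii the preimage of the circle has points on both sides of the
    annulus about \<open>z\<close>, so connectedness makes it cross every circle in between.\<close>
  define Y where "Y z = dist \<omega> ` (h ` (D \<inter> ball z (b z / 2))) \<inter> dist \<omega> ` (h ` (D - cball z (b z)))" for z
  have oph: "open (h ` X)" if "open X" "X \<subseteq> D" for X
  proof -
    have "openin (top_of_set D1) (h ` X)"
      using homeomorphism_imp_open_map[OF h, of X] that D(1) kD by (simp add: openin_open_eq)
    then show ?thesis using D1 openin_open_eq by blast
  qed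
  have Yb: "Y z \<in> sets borel" for z
    unfolding Y_def using D(1) \<omega>D1 kD
    by (intro borel_open open_Int open_dist_image oph) auto
  have cover: "\<exists>z\<in>Z. t \<in> Y z" if t: "0 < t" "t < T" for t
  proof -
    define q where "q = k ` (D1 \<inter> sphere \<omega> t)"
    have dq: "\<epsilon> \<le> diameter q" unfolding q_def using big t T by auto
    then have "q \<noteq> {}" using \<epsilon> by auto
    then obtain w where "w \<in> D1 \<inter> sphere \<omega> t" unfolding q_def by blast
    then have w: "w \<in> D1" "dist \<omega> w = t" by auto
    have "k w \<in> V"
    proof (rule ccontr)
      assume "k w \<notin> V"
      then have "w \<in> h ` (D - V)" using w(1) kD hk[OF w(1)] by (intro image_eqI[of _ _ "k w"]) auto
      then show False using t1(2)[of w] w t T by simp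
    qed
    then obtain z where z: "z \<in> Z" "k w \<in> ball z (b z / 2)" by (auto simp: V_def)
    have zf: "z \<in> frontier D" using z Z by blast
    have "t \<in> dist \<omega> ` (h ` (D \<inter> ball z (b z / 2)))"
      using w z kD hk[OF w(1)] by (intro image_eqI[of _ _ w] image_eqI[of _ _ "k w"]) auto
    moreover have "\<not> q \<subseteq> cball z (b z)"
    proof
      assume "q \<subseteq> cball z (b z)"
      then have "diameter q \<le> diameter (cball z (b z))" by (intro diameter_subset) auto
      then show False using dq bc(1,2)[OF zf] by simp
    qed
    then obtain v where "v \<in> D1 \<inter> sphere \<omega> t" and v3: "k v \<notin> cball z (b z)" unfolding q_def by blast
    then have v: "v \<in> D1" "dist \<omega> v = t" "k v \<notin> cball z (b z)" by auto
    then have "t \<in> dist \<omega> ` (h ` (D - cball z (b z)))"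
      using kD hk[OF v(1)] by (intro image_eqI[of _ _ v] image_eqI[of _ _ "k v"]) auto
    ultimately show ?thesis using z(1) by (auto simp: Y_def)
  qed
  have cross: "t \<in> dist \<omega> ` (h ` (D \<inter> sphere z r))"
    if t: "0 < t" "t < T" "t \<in> Y z" and r: "b z / 2 < r" "r < b z" for t z r
  proof -
    obtain p where p: "p \<in> D" "dist z p < b z / 2" "dist \<omega> (h p) = t" using t(3) by (auto simp: Y_def)
    obtain q where q: "q \<in> D" "b z < dist z q" "dist \<omega> (h q) = t" using t(3) by (auto simp: Y_def)
    have "connected (D1 \<inter> sphere \<omega> t)" using t0 t T by (auto simp: connected_sections_def)
    then have "connected (k ` (D1 \<inter> sphere \<omega> t))"
      by (intro connected_continuous_image continuous_on_subset[OF kc]) auto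
    moreover have "p \<in> k ` (D1 \<inter> sphere \<omega> t)" using p kD kh by (intro image_eqI[of _ _ "h p"]) auto
    moreover have "q \<in> k ` (D1 \<inter> sphere \<omega> t)" using q kD kh by (intro image_eqI[of _ _ "h q"]) auto
    ultimately have "k ` (D1 \<inter> sphere \<omega> t) \<inter> sphere z r \<noteq> {}"
      using p(2) q(2) r by (intro connected_meets_sphere[where p=p and q=q]) auto
    then obtain w where "w \<in> D1 \<inter> sphere \<omega> t" and w3: "k w \<in> sphere z r" by blast
    then have w: "w \<in> D1" "dist \<omega> w = t" "k w \<in> sphere z r" by auto
    then have "w = h (k w)" "k w \<in> D" using hk kD by auto
    then show ?thesis using w by (intro image_eqI[of _ _ w] image_eqI[of _ _ "k w"]) auto
  qed
  define \<tau> where "\<tau> i = T / 2 ^ Suc i" for i :: nat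
  have \<tau>: "0 < \<tau> i" "2 * \<tau> i = T / 2 ^ i" "2 * \<tau> i \<le> T" for i
    using T(1) by (auto simp: \<tau>_def field_simps)
  define n where "n = real (card Z)"
  \<comment> \<open>First pigeonhole: at each dyadic scale some \<open>z\<close> owns a share of at
    least \<open>1 / n\<close> of the radii. A second one then fixes a \<open>z\<close> that serves
    infinitely many scales.\<close>
  have "\<exists>z. z \<in> Z \<and> ennreal (\<tau> i / n) \<le> emeasure lborel (Y z \<inter> {\<tau> i<..<2 * \<tau> i})" for i
  proof -
    have cov: "{\<tau> i<..<2 * \<tau> i} \<subseteq> (\<Union>z\<in>Z. Y z)"
    proof
      fix t assume "t \<in> {\<tau> i<..<2 * \<tau> i}"
      then have "0 < t" "t < T" using \<tau>[of i] by auto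
      then show "t \<in> (\<Union>z\<in>Z. Y z)" using cover by auto
    qed
    have "\<tau> i < 2 * \<tau> i" using \<tau>(1)[of i] by simp
    then obtain z where "z \<in> Z" "ennreal ((2 * \<tau> i - \<tau> i) / real (card Z)) \<le> emeasure lborel (Y z \<inter> {\<tau> i<..<2 * \<tau> i})"
      by (rule measure_pigeonhole[OF Z(2) Yb cov])
    then show ?thesis by (auto simp: n_def)
  qed
  then obtain zz where zz: "\<And>i. zz i \<in> Z" "\<And>i. ennreal (\<tau> i / n) \<le> emeasure lborel (Y (zz i) \<inter> {\<tau> i<..<2 * \<tau> i})"
    by metis
  have n: "0 < n" using zz(1)[of 0] Z(2) by (auto simp: n_def card_gt_0_iff)
  have "finite (zz ` UNIV)" using zz(1) Z(2) by (meson finite_subset image_subsetI)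
  then obtain i0 where "infinite {i \<in> UNIV. zz i = zz i0}"
    using pigeonhole_infinite[of "UNIV :: nat set" zz] by auto
  then have inf: "infinite {i. zz i = zz i0}" by simp
  define z where "z = zz i0"
  have zf: "z \<in> frontier D" using zz(1) Z(1) by (auto simp: z_def)
  \<comment> \<open>The energy of the density below is at most
    \<open>16 * pi * n\<^sup>2 / M\<close>; this \<open>M\<close> pushes it under
    \<open>c z\<close>.\<close>
  obtain M where M: "16 * pi * n\<^sup>2 / c z < real M" using reals_Archimedean2 by blast
  have "0 < 16 * pi * n\<^sup>2 / c z" using n bc(3)[OF zf] by simp
  then have M0: "0 < real M" using M by linarith
  obtain F where F: "finite F" "card F = M" "F \<subseteq> {i. zz i = zz i0}"
    using infinite_arbitrarily_large[OF inf] by metis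
  \<comment> \<open>In one annulus the image of a section has length at least
    \<open>\<tau> i / (2 * n)\<close>, and the weight \<open>\<beta> i\<close> turns this into a
    contribution of at least \<open>1 / M\<close>.\<close>
  define \<beta> where "\<beta> i = 2 * n / (real M * \<tau> i)" for i
  have \<beta>: "0 < \<beta> i" for i using n M0 \<tau>(1)[of i] by (simp add: \<beta>_def)
  define B where "B i = annulus \<omega> (\<tau> i) (2 * \<tau> i)" for i
  have [measurable]: "B i \<in> sets borel" for i by (simp add: B_def annulus_in_borel)
  define P where "P w = (\<Sum>i\<in>F. ennreal (\<beta> i) * indicator (B i) w)" for w
  have Pm[measurable]: "P \<in> borel_measurable borel" unfolding P_def by measurable
  have Buniq: "i = j" if "w \<in> B i" "w \<in> B j" for w i j
    using dyadic_annulus_unique[of T i "cmod (w - \<omega>)" j] that T(1) \<tau>(2)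
    by (auto simp: B_def annulus_def \<tau>_def)
  have "ennreal (c z) \<le> (\<integral>\<^sup>+w. (P w)\<^sup>2 \<partial>lborel)"
  proof (rule cP[OF zf Pm])
    fix r assume r: "b z / 2 < r" "r < b z"
    define E where "E = h ` (D \<inter> sphere z r)"
    have Eb[measurable]: "E \<in> sets borel"
      unfolding E_def using D D1 by (intro homeomorphism_image_borel[OF h]) auto
    have le: "ennreal (1 / real M) \<le> ennreal (\<beta> i) * hausdorff1_outer (E \<inter> B i)" if i: "i \<in> F" for i
    proof -
      have zi: "zz i = z" using F(3) i by (auto simp: z_def)
      have "Y z \<inter> {\<tau> i<..<2 * \<tau> i} \<subseteq> dist \<omega> ` (E \<inter> B i)"
      proof
        fix t assume t: "t \<in> Y z \<inter> {\<tau> i<..<2 * \<tau> i}"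
        then have "t \<in> dist \<omega> ` E" unfolding E_def using \<tau>[of i] r by (intro cross) auto
        then obtain w where w: "w \<in> E" "t = dist \<omega> w" by blast
        then have "w \<in> B i" using t by (auto simp: B_def annulus_def dist_norm norm_minus_commute)
        then show "t \<in> dist \<omega> ` (E \<inter> B i)" using w by blast
      qed
      then have "emeasure lborel (Y z \<inter> {\<tau> i<..<2 * \<tau> i}) \<le> 2 * hausdorff1_outer (E \<inter> B i)"
        using Yb[of z] abs_dist_diff_le[of _ \<omega>]
        by (intro emeasure_projection_le_hausdorff1_outer[where u = "dist \<omega>"]) (auto simp: dist_commute)
      with zz(2)[of i] have "ennreal (\<tau> i / n) \<le> 2 * hausdorff1_outer (E \<inter> B i)"
        unfolding zi by (rule order_trans)
      then have "ennreal (\<beta> i / 2) * ennreal (\<tau> i / n) \<le> ennreal (\<beta> i / 2) * (2 * hausdorff1_outer (E \<inter> B i))"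
        by (rule mult_left_mono) simp
      also have "\<dots> = (ennreal (\<beta> i / 2) * 2) * hausdorff1_outer (E \<inter> B i)" by (simp only: mult.assoc)
      also have "ennreal (\<beta> i / 2) * 2 = ennreal (\<beta> i)"
        using \<beta>[of i] by (subst ennreal_numeral[symmetric], subst ennreal_mult[symmetric]) auto
      also have "ennreal (\<beta> i / 2) * ennreal (\<tau> i / n) = ennreal (1 / real M)"
        using \<beta>[of i] \<tau>(1)[of i] n M0 by (subst ennreal_mult[symmetric]) (auto simp: \<beta>_def)
      finally show ?thesis .
    qed
    have "1 = ennreal (\<Sum>i\<in>F. 1 / real M)" using F M0 by simp
    also have "\<dots> = (\<Sum>i\<in>F. ennreal (1 / real M))" by (subst sum_ennreal) auto
    also have "\<dots> \<le> (\<Sum>i\<in>F. ennreal (\<beta> i) * hausdorff1_outer (E \<inter> B i))"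
      by (intro sum_mono le)
    also have "\<dots> = (\<Sum>i\<in>F. \<integral>\<^sup>+w. ennreal (\<beta> i) * indicator (E \<inter> B i) w \<partial>hausdorff1_borel)"
      by (intro sum.cong refl) (simp add: nn_integral_cmult_indicator emeasure_hausdorff1_borel)
    also have "\<dots> = (\<integral>\<^sup>+w. (\<Sum>i\<in>F. ennreal (\<beta> i) * indicator (E \<inter> B i) w) \<partial>hausdorff1_borel)"
      by (rule nn_integral_sum[symmetric], rule borel_measurable_hausdorff1_borel) measurable
    also have "\<dots> = (\<integral>\<^sup>+w\<in>E. P w \<partial>hausdorff1_borel)"
      by (intro nn_integral_cong) (auto simp: P_def indicator_def intro!: sum.cong)
    finally show "1 \<le> (\<integral>\<^sup>+w\<in>h ` (D \<inter> sphere z r). P w \<partial>hausdorff1_borel)" unfolding E_def .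
  qed
  also have "(\<integral>\<^sup>+w. (P w)\<^sup>2 \<partial>lborel) = (\<integral>\<^sup>+w. (\<Sum>i\<in>F. ennreal ((\<beta> i)\<^sup>2) * indicator (B i) w) \<partial>lborel)"
  proof (rule nn_integral_cong)
    fix w
    show "(P w)\<^sup>2 = (\<Sum>i\<in>F. ennreal ((\<beta> i)\<^sup>2) * indicator (B i) w)"
    proof (cases "\<exists>i\<in>F. w \<in> B i")
      case True
      then obtain i where i: "i \<in> F" "w \<in> B i" by blast
      have "w \<notin> B j" if "j \<noteq> i" for j using Buniq[of w j i] i that by blast
      then have single: "(\<Sum>j\<in>F. ennreal (x j) * indicator (B j) w) = ennreal (x i)" for x
        using i F(1) by (subst sum.remove[of _ i]) (auto intro!: sum.neutral)
      show ?thesis unfolding P_def single using \<beta>[of i] by (simp add: ennreal_power)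
    next
      case False
      then show ?thesis by (simp add: P_def)
    qed
  qed
  also have "\<dots> = (\<Sum>i\<in>F. \<integral>\<^sup>+w. ennreal ((\<beta> i)\<^sup>2) * indicator (B i) w \<partial>lborel)"
    by (rule nn_integral_sum) measurable
  also have "\<dots> \<le> (\<Sum>i\<in>F. ennreal (16 * pi * n\<^sup>2 / (real M)\<^sup>2))"
  proof (rule sum_mono)
    fix i
    have "(\<integral>\<^sup>+w. ennreal ((\<beta> i)\<^sup>2) * indicator (B i) w \<partial>lborel) = ennreal ((\<beta> i)\<^sup>2) * emeasure lborel (B i)"
      by (rule nn_integral_cmult_indicator) simp
    also have "\<dots> \<le> ennreal ((\<beta> i)\<^sup>2) * emeasure lborel (ball \<omega> (2 * \<tau> i))"
      by (intro mult_left_mono emeasure_mono) (auto simp: B_def annulus_def dist_norm norm_minus_commute)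
    also have "emeasure lborel (ball \<omega> (2 * \<tau> i)) = ennreal (pi * (2 * \<tau> i)\<^sup>2)"
      using \<tau>(1)[of i] by (simp add: emeasure_ball unit_ball_vol_2)
    also have "ennreal ((\<beta> i)\<^sup>2) * ennreal (pi * (2 * \<tau> i)\<^sup>2) = ennreal ((\<beta> i)\<^sup>2 * (pi * (2 * \<tau> i)\<^sup>2))"
      by (subst ennreal_mult) auto
    also have "(\<beta> i)\<^sup>2 * (pi * (2 * \<tau> i)\<^sup>2) = 16 * pi * n\<^sup>2 / (real M)\<^sup>2"
      using \<tau>(1)[of i] M0 by (simp add: \<beta>_def field_simps power2_eq_square)
    finally show "(\<integral>\<^sup>+w. ennreal ((\<beta> i)\<^sup>2) * indicator (B i) w \<partial>lborel) \<le> ennreal (16 * pi * n\<^sup>2 / (real M)\<^sup>2)" .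
  qed
  also have "\<dots> = ennreal (\<Sum>i\<in>F. 16 * pi * n\<^sup>2 / (real M)\<^sup>2)" by (subst sum_ennreal) auto
  also have "(\<Sum>i\<in>F. 16 * pi * n\<^sup>2 / (real M)\<^sup>2) = 16 * pi * n\<^sup>2 / real M"
    using F M0 by (simp add: power2_eq_square)
  finally have "c z \<le> 16 * pi * n\<^sup>2 / real M" using M0 by (subst (asm) ennreal_le_iff) auto
  moreover have "16 * pi * n\<^sup>2 / real M < c z" using M M0 bc(3)[OF zf] by (simp add: field_simps)
  ultimately show False by simp
qed


section \<open>Extension to the boundary\<close>

text \<open>A crosscut \<open>k1 (S(\<omega>, t))\<close> of small diameter lies inside a disk about some \<open>z0\<close> whose boundary
  has a short image under \<open>h2\<close>. The main component left by that image corresponds to points outside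
  the disk, hence on the far side of the crosscut.\<close>

lemma boundary_oscillation:
  assumes h1: "homeomorphism D D1 h1 k1" and h2: "homeomorphism D D2 h2 k2"
    and D: "open D" "connected D" "D \<noteq> {}" "bounded D" and D1: "open D1"
    and D2: "open D2" "connected D2" "bounded D2"
    and t1: "connected_sections D1 t1" and t2: "connected_sections D2 t2"
    and shr: "shrinking_circles k1 D1 \<omega>" and \<omega>: "\<omega> \<in> frontier D1"
    and sml: "\<And>z0. z0 \<in> frontier D \<Longrightarrow> small_sections h2 D z0" and s: "0 < s"
  obtains t where "0 < t" "diameter (h2 ` k1 ` (D1 \<inter> ball \<omega> t)) < s"
proof -
  have k1D: "k1 ` D1 = D" "h1 ` D = D1" and k1c: "continuous_on D1 k1" and h1c: "continuous_on D h1"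
    and hk1: "\<And>w. w \<in> D1 \<Longrightarrow> h1 (k1 w) = w" and kh1: "\<And>z. z \<in> D \<Longrightarrow> k1 (h1 z) = z"
    using h1 by (auto simp: homeomorphism_def)
  have k2D: "k2 ` D2 = D" "h2 ` D = D2" and k2c: "continuous_on D2 k2" and h2c: "continuous_on D h2"
    and hk2: "\<And>w. w \<in> D2 \<Longrightarrow> h2 (k2 w) = w" and kh2: "\<And>z. z \<in> D \<Longrightarrow> k2 (h2 z) = z"
    using h2 by (auto simp: homeomorphism_def)
  have \<omega>D1: "\<omega> \<notin> D1" using \<omega> D1 frontier_disjoint_eq by blast
  \<comment> \<open>The disk marks the far side: it stays away from boundary points of
    \<open>D\<close>, and its image from \<open>\<omega>\<close>.\<close>
  obtain a0 \<kappa> where a0: "0 < \<kappa>" "cball a0 \<kappa> \<subseteq> D" using D(1,3) open_contains_cball by (metis ex_in_conv)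
  define K where "K = cball a0 \<kappa>"
  have K: "compact K" "connected K" "K \<subseteq> D" "a0 \<in> K" using a0 by (auto simp: K_def)
  have bh2K: "bounded (h2 ` K)" by (rule bounded_subset[OF D2(3)]) (use k2D(2) K(3) in blast)
  have "0 < diameter (h2 ` K)"
  proof -
    have "a0 + of_real \<kappa> \<in> K" using a0 by (simp add: K_def dist_norm)
    then have "dist (h2 a0) (h2 (a0 + of_real \<kappa>)) \<le> diameter (h2 ` K)"
      using K by (intro diameter_bounded_bound bh2K) auto
    moreover have "h2 a0 \<noteq> h2 (a0 + of_real \<kappa>)"
      using kh2[of a0] kh2[of "a0 + of_real \<kappa>"] K \<open>a0 + of_real \<kappa> \<in> K\<close> a0(1) by force
    ultimately show ?thesis using zero_less_dist_iff by (meson order_less_le_trans)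
  qed
  \<comment> \<open>With \<open>s'\<close> at most the diameter of the image of \<open>K\<close>,
    the main component has to meet that image and can be enlarged by it.\<close>
  define s' where "s' = min s (diameter (h2 ` K))"
  have s': "0 < s'" "s' \<le> s" "s' \<le> diameter (h2 ` K)" using s \<open>0 < diameter (h2 ` K)\<close> by (auto simp: s'_def)
  have D2ne: "D2 \<noteq> {}" using k2D D(3) by blast
  obtain \<delta> where \<delta>: "0 < \<delta>"
    "\<And>A. hausdorff1_outer A < ennreal \<delta> \<Longrightarrow> \<exists>W. connected W \<and> W \<subseteq> D2 - A \<and>
        (\<forall>K. connected K \<and> K \<subseteq> D2 \<and> s' \<le> diameter K \<longrightarrow> K \<inter> W \<noteq> {})"
    by (rule main_component[OF D2(1,2) D2ne D2(3) t2 s'(1)]) blast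
  have "compact (h1 ` K)" using K by (intro compact_continuous_image continuous_on_subset[OF h1c])
  moreover have "\<omega> \<notin> h1 ` K" using \<omega>D1 k1D K(3) by blast
  ultimately obtain m0 where m0: "0 < m0" "\<And>w. w \<in> h1 ` K \<Longrightarrow> m0 \<le> dist \<omega> w"
    using separate_point_closed[OF compact_imp_closed] by metis
  define m where "m = min m0 t1"
  have m: "0 < m" "\<And>w. w \<in> h1 ` K \<Longrightarrow> m \<le> dist \<omega> w" "m \<le> t1"
    using m0 t1 by (auto simp: m_def connected_sections_def intro: min.coboundedI1)
  have "\<exists>t. 0 < t \<and> t < m \<and> t < 1 / real (Suc n) \<and> diameter (k1 ` (D1 \<inter> sphere \<omega> t)) < 1 / real (Suc n)" for n
  proof -
    have "0 < min m (1 / real (Suc n))" using m by simp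
    then obtain t where "0 < t" "t < min m (1 / real (Suc n))"
      "diameter (k1 ` (D1 \<inter> sphere \<omega> t)) < min m (1 / real (Suc n))"
      using shr unfolding shrinking_circles_def by blast
    then show ?thesis by auto
  qed
  then obtain t where t: "\<And>n. 0 < t n" "\<And>n. t n < m" "\<And>n. t n < 1 / real (Suc n)"
    "\<And>n. diameter (k1 ` (D1 \<inter> sphere \<omega> (t n))) < 1 / real (Suc n)" by metis
  define q where "q n = k1 ` (D1 \<inter> sphere \<omega> (t n))" for n
  have cD1: "connected D1" using connected_continuous_image[OF h1c D(2)] k1D by simp
  have "\<exists>x. x \<in> q n" for n
  proof -
    have "\<omega> \<in> closure D1" using \<omega> by (simp add: frontier_def)
    then obtain p where p: "p \<in> D1" "dist p \<omega> < t n" using t(1) closure_approachable by blast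
    have "h1 a0 \<in> D1" "t n \<le> dist \<omega> (h1 a0)" using K k1D m(2)[of "h1 a0"] t(2)[of n] by auto
    then have "D1 \<inter> sphere \<omega> (t n) \<noteq> {}"
      using p by (intro connected_meets_sphere[OF cD1 p(1)]) (auto simp: dist_commute)
    then show ?thesis by (auto simp: q_def)
  qed
  then obtain x where x: "\<And>n. x n \<in> q n" by metis
  have qD: "q n \<subseteq> D" for n using k1D by (auto simp: q_def)
  have "\<forall>n. x n \<in> closure D" using x qD closure_subset by blast
  moreover have "compact (closure D)" using D(4) by simp
  ultimately obtain z0 r where z0: "z0 \<in> closure D" and r: "strict_mono r" and lim: "(x \<circ> r) \<longlonglongrightarrow> z0"
    unfolding compact_def by meson
  have hx: "dist \<omega> (h1 (x n)) = t n" for n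
  proof -
    obtain w where "w \<in> D1" "dist \<omega> w = t n" "x n = k1 w" using x[of n] by (auto simp: q_def)
    then show ?thesis using hk1 by simp
  qed
  \<comment> \<open>The radii \<open>t n\<close> tend to 0, so a limit inside \<open>D\<close> would
    be mapped by \<open>h1\<close> to \<open>\<omega>\<close>, which is not in
    \<open>D1\<close>.\<close>
  have "z0 \<notin> D"
  proof
    assume z0D: "z0 \<in> D"
    have "(\<lambda>n. h1 ((x \<circ> r) n)) \<longlonglongrightarrow> h1 z0"
      by (rule continuous_on_tendsto_compose[OF h1c lim z0D]) (use x qD in \<open>auto intro!: always_eventually\<close>)
    then have "(\<lambda>n. dist \<omega> (h1 ((x \<circ> r) n))) \<longlonglongrightarrow> dist \<omega> (h1 z0)" by (intro tendsto_intros)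
    then have "(\<lambda>n. t (r n)) \<longlonglongrightarrow> dist \<omega> (h1 z0)" by (simp add: hx)
    moreover have "(\<lambda>n. t (r n)) \<longlonglongrightarrow> 0"
    proof -
      have "t \<longlonglongrightarrow> 0"
      proof (rule tendsto_sandwich[of "\<lambda>_. 0" _ _ "\<lambda>n. 1 / real (Suc n)"])
        show "(\<lambda>n. 1 / real (Suc n)) \<longlonglongrightarrow> 0" by (rule LIMSEQ_Suc[OF lim_1_over_n])
      qed (use t in \<open>auto intro!: always_eventually less_imp_le\<close>)
      then show ?thesis using LIMSEQ_subseq_LIMSEQ[OF _ r, of t] by (simp add: comp_def)
    qed
    ultimately have "dist \<omega> (h1 z0) = 0" by (rule LIMSEQ_unique)
    then have "\<omega> \<in> D1" using z0D k1D by auto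
    then show False using \<omega>D1 by blast
  qed
  then have z0f: "z0 \<in> frontier D" using z0 D(1) by (simp add: frontier_def interior_open)
  have "z0 \<notin> K" using \<open>z0 \<notin> D\<close> K(3) by blast
  then obtain \<rho>0 where \<rho>0: "0 < \<rho>0" "\<And>y. y \<in> K \<Longrightarrow> \<rho>0 \<le> dist z0 y"
    using separate_point_closed[OF compact_imp_closed[OF K(1)]] by metis
  \<comment> \<open>A radius below \<open>\<rho>0\<close> leaves \<open>K\<close> outside the disk;
    a length below \<open>\<delta>\<close> leaves a main component.\<close>
  have "0 < min \<rho>0 \<delta>" using \<rho>0 \<delta> by simp
  then obtain \<rho> where \<rho>: "0 < \<rho>" "\<rho> < min \<rho>0 \<delta>" "hausdorff1_outer (h2 ` (D \<inter> sphere z0 \<rho>)) < ennreal (min \<rho>0 \<delta>)"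
    using sml[OF z0f] unfolding small_sections_def by blast
  define A where "A = h2 ` (D \<inter> sphere z0 \<rho>)"
  have "hausdorff1_outer A < ennreal \<delta>"
    unfolding A_def by (rule order.strict_trans2[OF \<rho>(3)]) (simp add: ennreal_leI)
  then obtain W where W: "connected W" "W \<subseteq> D2 - A"
    "\<And>K. connected K \<Longrightarrow> K \<subseteq> D2 \<Longrightarrow> s' \<le> diameter K \<Longrightarrow> K \<inter> W \<noteq> {}"
    using \<delta>(2) by meson
  have ch2K: "connected (h2 ` K)" using K by (intro connected_continuous_image continuous_on_subset[OF h2c])
  have h2KD: "h2 ` K \<subseteq> D2" using K(3) k2D by blast
  have "h2 ` K \<inter> A = {}"
  proof (rule ccontr)
    assume "h2 ` K \<inter> A \<noteq> {}"
    then obtain y z where "y \<in> K" "z \<in> D \<inter> sphere z0 \<rho>" "h2 y = h2 z" unfolding A_def by blast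
    then have yz: "y \<in> K" "z \<in> D" "dist z0 z = \<rho>" "h2 y = h2 z" by auto
    then have "y = z" using kh2[of y] kh2[of z] K(3) by auto
    then show False using \<rho>0(2)[OF yz(1)] yz(3) \<rho>(2) by simp
  qed
  define W' where "W' = W \<union> h2 ` K"
  have W': "connected W'" "W' \<subseteq> D2 - A"
    unfolding W'_def using W ch2K W(3)[OF ch2K h2KD s'(3)] h2KD \<open>h2 ` K \<inter> A = {}\<close>
    by (auto intro!: connected_Un)
  define V where "V = k2 ` W'"
  have cV: "connected V" unfolding V_def
    using W' by (intro connected_continuous_image continuous_on_subset[OF k2c]) auto
  have VD: "V \<subseteq> D" using W'(2) k2D by (auto simp: V_def)
  have a0V: "a0 \<in> V"
  proof -
    have "a0 = k2 (h2 a0)" using kh2[of a0] K by auto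
    then show ?thesis using K by (auto simp: V_def W'_def)
  qed
  have V\<rho>: "V \<inter> sphere z0 \<rho> = {}"
  proof (rule ccontr)
    assume "V \<inter> sphere z0 \<rho> \<noteq> {}"
    then obtain w where w: "w \<in> W'" "k2 w \<in> sphere z0 \<rho>" unfolding V_def by blast
    then have "w \<in> D2" "k2 w \<in> D" "h2 (k2 w) = w" using W'(2) k2D hk2 by auto
    then have "w \<in> A" unfolding A_def using w by (metis IntI image_eqI)
    then show False using w W'(2) by blast
  qed
  have Vout: "\<rho> < dist z0 v" if v: "v \<in> V" for v
  proof (rule ccontr)
    assume "\<not> \<rho> < dist z0 v"
    moreover have "\<rho> \<le> dist z0 a0" using \<rho>0(2)[OF K(4)] \<rho>(2) by simp
    ultimately have "V \<inter> sphere z0 \<rho> \<noteq> {}" by (intro connected_meets_sphere[OF cV v a0V]) auto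
    then show False using V\<rho> by blast
  qed
  \<comment> \<open>Far along the subsequence the crosscut has a point within
    \<open>\<rho> / 2\<close> of \<open>z0\<close> and diameter below \<open>\<rho> / 2\<close>, so
    it lies inside the circle that \<open>V\<close> cannot cross.\<close>
  have "\<forall>\<^sub>F n in sequentially. dist ((x \<circ> r) n) z0 < \<rho> / 2" using lim \<rho>(1) tendstoD half_gt_zero by blast
  moreover have "\<forall>\<^sub>F n in sequentially. 1 / real (Suc n) < \<rho> / 2"
    using \<rho>(1) order_tendstoD(2)[OF LIMSEQ_Suc[OF lim_1_over_n], of "\<rho> / 2"] by simp
  ultimately have "\<forall>\<^sub>F n in sequentially. dist ((x \<circ> r) n) z0 < \<rho> / 2 \<and> 1 / real (Suc n) < \<rho> / 2"
    by (rule eventually_conj)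
  from eventually_happens'[OF sequentially_bot this]
  obtain n where n: "dist (x (r n)) z0 < \<rho> / 2" "1 / real (Suc n) < \<rho> / 2"
    unfolding comp_def by blast
  define N where "N = r n"
  have qin: "dist z0 y < \<rho>" if y: "y \<in> q N" for y
  proof -
    have "bounded (q N)" by (rule bounded_subset[OF D(4) qD])
    then have "dist (x N) y \<le> diameter (q N)" by (intro diameter_bounded_bound x y)
    also have "\<dots> < 1 / real (Suc N)" using t(4) by (simp add: q_def)
    also have "\<dots> \<le> 1 / real (Suc n)" using seq_suble[OF r, of n] by (simp add: N_def frac_le)
    finally have "dist (x N) y < \<rho> / 2" using n by simp
    then show ?thesis using n(1) dist_triangle[of z0 y "x N"] by (simp add: N_def dist_commute)
  qed
  define \<theta> where "\<theta> = t N"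
  have \<theta>: "0 < \<theta>" "\<theta> < m" using t by (auto simp: \<theta>_def)
  have ch1V: "connected (h1 ` V)" using VD by (intro connected_continuous_image cV continuous_on_subset[OF h1c])
  have h1V: "h1 ` V \<inter> sphere \<omega> \<theta> = {}"
  proof (rule ccontr)
    assume "h1 ` V \<inter> sphere \<omega> \<theta> \<noteq> {}"
    then obtain v where "v \<in> V" "h1 v \<in> sphere \<omega> \<theta>" by blast
    then have v: "v \<in> V" "dist \<omega> (h1 v) = \<theta>" by auto
    then have "v \<in> q N" unfolding q_def \<theta>_def using kh1[of v] VD k1D by (intro image_eqI[of _ _ "h1 v"]) auto
    then show False using qin Vout[OF v(1)] by force
  qed
  \<comment> \<open>The same connectedness argument in \<open>D1\<close>: the image of
    \<open>V\<close> avoids the circle of radius \<open>\<theta>\<close>, and the image of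
    \<open>a0\<close> is not inside it.\<close>
  have h1Vout: "\<theta> < dist \<omega> (h1 v)" if v: "v \<in> V" for v
  proof (rule ccontr)
    assume "\<not> \<theta> < dist \<omega> (h1 v)"
    moreover have "\<theta> \<le> dist \<omega> (h1 a0)" using m(2)[of "h1 a0"] K(4) \<theta> by auto
    ultimately have "h1 ` V \<inter> sphere \<omega> \<theta> \<noteq> {}"
      using v a0V by (intro connected_meets_sphere[OF ch1V, of "h1 v" "h1 a0"]) auto
    then show False using h1V by blast
  qed
  define X where "X = D1 \<inter> ball \<omega> \<theta>"
  have "connected X" using t1 \<omega> \<theta> m unfolding X_def connected_sections_def by auto
  then have "connected (k1 ` X)" by (intro connected_continuous_image continuous_on_subset[OF k1c]) (auto simp: X_def)
  moreover have kXD: "k1 ` X \<subseteq> D" using k1D by (auto simp: X_def)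
  ultimately have cX: "connected (h2 ` k1 ` X)"
    by (intro connected_continuous_image[OF continuous_on_subset[OF h2c]])
  have XD2: "h2 ` k1 ` X \<subseteq> D2" using kXD k2D by blast
  \<comment> \<open>A connected subset of \<open>D2\<close> that misses \<open>W\<close> has
    diameter below \<open>s'\<close>, so disjointness is all that remains.\<close>
  have "h2 ` k1 ` X \<inter> W = {}"
  proof (rule ccontr)
    assume "h2 ` k1 ` X \<inter> W \<noteq> {}"
    then obtain w where w: "w \<in> X" "h2 (k1 w) \<in> W" by blast
    then have wD: "w \<in> D1" "k1 w \<in> D" "dist \<omega> w < \<theta>" using k1D by (auto simp: X_def)
    have "k2 (h2 (k1 w)) \<in> V" using w(2) by (auto simp: V_def W'_def)
    then have "k1 w \<in> V" using kh2 wD by simp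
    then show False using h1Vout[of "k1 w"] hk1[OF wD(1)] wD by simp
  qed
  then have "diameter (h2 ` k1 ` X) < s'" using W(3)[OF cX XD2] by force
  then show ?thesis using that[of \<theta>] \<theta> s'(2) by (auto simp: X_def)
qed

text \<open>Small oscillation near each point of the closure, by continuity inside and by
  \<open>boundary_oscillation\<close> on the frontier, becomes uniform through a Lebesgue number of
  the compact closure.\<close>

lemma uniformly_continuous_transition:
  assumes h1: "homeomorphism D D1 h1 k1" and h2: "homeomorphism D D2 h2 k2"
    and D: "open D" "connected D" "D \<noteq> {}" "bounded D" and D1: "open D1" "bounded D1"
    and D2: "open D2" "connected D2" "bounded D2"
    and t1: "connected_sections D1 t1" and t2: "connected_sections D2 t2"
    and shr: "\<And>\<omega>. \<omega> \<in> frontier D1 \<Longrightarrow> shrinking_circles k1 D1 \<omega>"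
    and sml: "\<And>z0. z0 \<in> frontier D \<Longrightarrow> small_sections h2 D z0"
  shows "uniformly_continuous_on D1 (h2 \<circ> k1)"
proof -
  have k1D: "k1 ` D1 = D" and k1c: "continuous_on D1 k1" and k2D: "h2 ` D = D2" and h2c: "continuous_on D h2"
    using h1 h2 by (auto simp: homeomorphism_def)
  have \<phi>c: "continuous_on D1 (h2 \<circ> k1)"
    using k1c h2c k1D by (intro continuous_on_compose) auto
  have osc: "\<exists>t>0. \<forall>x\<in>D1 \<inter> ball \<zeta> t. \<forall>y\<in>D1 \<inter> ball \<zeta> t. dist ((h2 \<circ> k1) x) ((h2 \<circ> k1) y) < e"
    if \<zeta>: "\<zeta> \<in> closure D1" and e: "0 < e" for \<zeta> e
  proof (cases "\<zeta> \<in> D1")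
    case True
    then obtain d where d: "0 < d" "\<And>x. x \<in> D1 \<Longrightarrow> dist x \<zeta> < d \<Longrightarrow> dist ((h2 \<circ> k1) x) ((h2 \<circ> k1) \<zeta>) < e / 2"
      using \<phi>c e unfolding continuous_on_iff by (meson half_gt_zero)
    show ?thesis
    proof (intro exI[of _ d] conjI ballI d(1))
      fix x y assume "x \<in> D1 \<inter> ball \<zeta> d" "y \<in> D1 \<inter> ball \<zeta> d"
      then have "dist ((h2 \<circ> k1) x) ((h2 \<circ> k1) \<zeta>) < e / 2" "dist ((h2 \<circ> k1) y) ((h2 \<circ> k1) \<zeta>) < e / 2"
        using d(2)[of x] d(2)[of y] by (auto simp: dist_commute[of \<zeta>])
      then show "dist ((h2 \<circ> k1) x) ((h2 \<circ> k1) y) < e" by (rule dist_triangle_half_l)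
    qed
  next
    case False
    then have f: "\<zeta> \<in> frontier D1" using \<zeta> D1(1) by (simp add: frontier_def interior_open)
    obtain t where t: "0 < t" "diameter (h2 ` k1 ` (D1 \<inter> ball \<zeta> t)) < e"
      by (rule boundary_oscillation[OF h1 h2 D D1(1) D2 t1 t2 shr[OF f] f sml e])
    have "bounded (h2 ` k1 ` (D1 \<inter> ball \<zeta> t))"
      by (rule bounded_subset[OF D2(3)]) (use k1D k2D in blast)
    then have "dist ((h2 \<circ> k1) x) ((h2 \<circ> k1) y) < e" if "x \<in> D1 \<inter> ball \<zeta> t" "y \<in> D1 \<inter> ball \<zeta> t" for x y
      using that by (intro order.strict_trans1[OF diameter_bounded_bound t(2)]) auto
    then show ?thesis using t(1) by blast
  qed
  show ?thesis
    unfolding uniformly_continuous_on_def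
  proof (intro allI impI)
    fix e :: real assume e: "0 < e"
    obtain t where t: "\<And>\<zeta>. \<zeta> \<in> closure D1 \<Longrightarrow> 0 < t \<zeta>"
      "\<And>\<zeta> x y. \<zeta> \<in> closure D1 \<Longrightarrow> x \<in> D1 \<inter> ball \<zeta> (t \<zeta>) \<Longrightarrow> y \<in> D1 \<inter> ball \<zeta> (t \<zeta>) \<Longrightarrow> dist ((h2 \<circ> k1) x) ((h2 \<circ> k1) y) < e"
      using osc[OF _ e] by metis
    have cov: "closure D1 \<subseteq> \<Union>((\<lambda>\<zeta>. ball \<zeta> (t \<zeta>)) ` closure D1)" using t(1) by auto
    have cpt: "compact (closure D1)" using D1(2) by simp
    obtain d where d: "0 < d" "\<And>x. x \<in> closure D1 \<Longrightarrow> \<exists>G\<in>(\<lambda>\<zeta>. ball \<zeta> (t \<zeta>)) ` closure D1. ball x d \<subseteq> G"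
    proof (rule Heine_Borel_lemma[OF cpt cov])
      show "open G" if "G \<in> (\<lambda>\<zeta>. ball \<zeta> (t \<zeta>)) ` closure D1" for G using that by auto
    qed blast
    show "\<exists>d>0. \<forall>x\<in>D1. \<forall>x'\<in>D1. dist x' x < d \<longrightarrow> dist ((h2 \<circ> k1) x') ((h2 \<circ> k1) x) < e"
    proof (intro exI[of _ d] conjI ballI impI d(1))
      fix x x' assume x: "x \<in> D1" "x' \<in> D1" "dist x' x < d"
      then have "x \<in> closure D1" using closure_subset by blast
      then obtain \<zeta> where \<zeta>: "\<zeta> \<in> closure D1" "ball x d \<subseteq> ball \<zeta> (t \<zeta>)" using d(2) by blast
      have "x \<in> ball x d" "x' \<in> ball x d" using x d(1) by (auto simp: dist_commute)
      then have "x \<in> ball \<zeta> (t \<zeta>)" "x' \<in> ball \<zeta> (t \<zeta>)" using \<zeta>(2) by blast+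
      then show "dist ((h2 \<circ> k1) x') ((h2 \<circ> k1) x) < e" using x \<zeta> by (intro t(2)[OF \<zeta>(1)]) auto
    qed
  qed
qed

section \<open>From the circular domains to the completions\<close>

lemma extend_homeomorphism_closure:
  fixes \<phi> \<psi> :: "complex \<Rightarrow> complex"
  assumes \<phi>: "uniformly_continuous_on S \<phi>" "\<phi> ` S = T" and \<psi>: "uniformly_continuous_on T \<psi>" "\<psi> ` T = S"
    and inv: "\<And>x. x \<in> S \<Longrightarrow> \<psi> (\<phi> x) = x" "\<And>y. y \<in> T \<Longrightarrow> \<phi> (\<psi> y) = y"
  obtains \<Phi> \<Psi> where "homeomorphism (closure S) (closure T) \<Phi> \<Psi>" "\<And>x. x \<in> S \<Longrightarrow> \<Phi> x = \<phi> x"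
proof -
  obtain \<Phi> where \<Phi>: "uniformly_continuous_on (closure S) \<Phi>" "\<And>x. x \<in> S \<Longrightarrow> \<phi> x = \<Phi> x"
    using uniformly_continuous_on_extension_on_closure[OF \<phi>(1)] by metis
  obtain \<Psi> where \<Psi>: "uniformly_continuous_on (closure T) \<Psi>" "\<And>x. x \<in> T \<Longrightarrow> \<psi> x = \<Psi> x"
    using uniformly_continuous_on_extension_on_closure[OF \<psi>(1)] by metis
  have c: "continuous_on (closure S) \<Phi>" "continuous_on (closure T) \<Psi>"
    using \<Phi> \<Psi> uniformly_continuous_imp_continuous by blast+
  have sub: "F ` closure A \<subseteq> closure B"
    if "continuous_on (closure A) F" "\<And>x. x \<in> A \<Longrightarrow> f x = F x" "f ` A = B" for A B :: "complex set" and f F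
  proof (rule image_closure_subset[OF that(1)])
    show "F ` A \<subseteq> closure B" using that(2,3) closure_subset by force
  qed simp
  note s1 = sub[OF c(1) \<Phi>(2) \<phi>(2)] and s2 = sub[OF c(2) \<Psi>(2) \<psi>(2)]
  \<comment> \<open>The inverse relations hold on dense subsets and pass to the closures by
    continuity.\<close>
  have id: "G (F x) = x"
    if "continuous_on (closure A) F" "continuous_on (closure B) G" "F ` closure A \<subseteq> closure B"
      "\<And>x. x \<in> A \<Longrightarrow> G (F x) = x" "x \<in> closure A" for A B :: "complex set" and F G x
  proof -
    have "continuous_on (closure A) (\<lambda>x. G (F x) - x)"
      using that(1-3) by (intro continuous_intros continuous_on_compose2[OF that(2)])
    then have "G (F x) - x = 0"
      by (rule continuous_constant_on_closure) (use that(4,5) in auto)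
    then show ?thesis by simp
  qed
  have on1: "\<Psi> (\<Phi> x) = x" if "x \<in> S" for x
  proof -
    have "\<phi> x \<in> T" using \<phi>(2) that by blast
    then show ?thesis using \<Phi>(2)[OF that] \<Psi>(2)[of "\<phi> x"] inv(1)[OF that] by simp
  qed
  have on2: "\<Phi> (\<Psi> y) = y" if "y \<in> T" for y
  proof -
    have "\<psi> y \<in> S" using \<psi>(2) that by blast
    then show ?thesis using \<Psi>(2)[OF that] \<Phi>(2)[of "\<psi> y"] inv(2)[OF that] by simp
  qed
  have i1: "\<Psi> (\<Phi> x) = x" if "x \<in> closure S" for x by (rule id[OF c s1 on1 that])
  have i2: "\<Phi> (\<Psi> y) = y" if "y \<in> closure T" for y by (rule id[OF c(2,1) s2 on2 that])
  have "homeomorphism (closure S) (closure T) \<Phi> \<Psi>"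
    using c s1 s2 i1 i2 by (intro homeomorphismI) auto
  then show ?thesis using \<Phi>(2) by (intro that) auto
qed

text \<open>\<open>prime_end_dist\<close> is by definition the distance of the images, so the
  bijection onto the closure is an isometry.\<close>

lemma homeomorphic_map_prime_end_map:
  "homeomorphic_map (prime_end_topology g D) (top_of_set (closure (g ` D))) (prime_end_map g)"
proof -
  interpret S: Submetric UNIV dist "closure (g ` D)"
    by unfold_locales auto
  interpret Metric_space12 "prime_end_completion g D" "prime_end_dist g" "closure (g ` D)" dist
    using Metric_space_prime_end_completion S.sub.Metric_space_axioms by (simp add: Metric_space12_def)
  have "S.sub.mtopology = top_of_set (closure (g ` D))"
    using S.mtopology_submetric by simp
  moreover have "homeomorphic_map M1.mtopology S.sub.mtopology (prime_end_map g)"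
    using bij_betw_prime_end_map[of g D]
    by (intro isometry_imp_homeomorphic_map) (auto simp: bij_betw_def prime_end_dist_def)
  ultimately show ?thesis unfolding prime_end_topology_def by simp
qed

text \<open>\<open>\<Phi>\<close> is conjugated by the identifications of the completions with
  closed circular domains; points of \<open>D\<close> are followed through the classes of their
  constant sequences.\<close>

lemma extends_to_prime_end_homeomorphismI:
  assumes \<Phi>: "homeomorphism (closure (g ` D)) (closure (g' ` D')) \<Phi> \<Psi>"
    and f: "f ` D \<subseteq> D'" and eq: "\<And>z. z \<in> D \<Longrightarrow> \<Phi> (g z) = g' (f z)"
  shows "extends_to_prime_end_homeomorphism f g D g' D'"
proof -
  note h = homeomorphic_map_prime_end_map[of g D] and h' = homeomorphic_map_prime_end_map[of g' D']
  obtain j where j: "homeomorphic_maps (prime_end_topology g' D') (top_of_set (closure (g' ` D'))) (prime_end_map g') j"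
    using h' homeomorphic_map_maps by metis
  have "homeomorphic_maps (top_of_set (closure (g ` D))) (top_of_set (closure (g' ` D'))) \<Phi> \<Psi>"
    using \<Phi> by (auto simp: homeomorphic_maps_def homeomorphism_def continuous_map_in_subtopology)
  then have \<Phi>m: "homeomorphic_map (top_of_set (closure (g ` D))) (top_of_set (closure (g' ` D'))) \<Phi>"
    using homeomorphic_maps_map by blast
  have jm: "homeomorphic_map (top_of_set (closure (g' ` D'))) (prime_end_topology g' D') j"
    using j homeomorphic_maps_map by blast
  define F where "F = j \<circ> (\<Phi> \<circ> prime_end_map g)"
  have "homeomorphic_map (prime_end_topology g D) (prime_end_topology g' D') F"
    unfolding F_def by (intro homeomorphic_map_compose[OF homeomorphic_map_compose[OF h \<Phi>m] jm])
  moreover have "F (prime_end_embed g D z) = prime_end_embed g' D' (f z)" if z: "z \<in> D" for z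
  proof -
    have fz: "f z \<in> D'" using f z by blast
    have "topspace (prime_end_topology g' D') = prime_end_completion g' D'"
      unfolding prime_end_topology_def
      using Metric_space.topspace_mtopology[OF Metric_space_prime_end_completion] by metis
    moreover have "prime_end_embed g' D' (f z) \<in> prime_end_completion g' D'"
      unfolding prime_end_embed_def prime_end_completion_def using fz
      by (intro quotientI) (auto simp: prime_end_sequences_def intro: LIMSEQ_imp_Cauchy[OF tendsto_const])
    ultimately have "j (prime_end_map g' (prime_end_embed g' D' (f z))) = prime_end_embed g' D' (f z)"
      using j by (simp add: homeomorphic_maps_def)
    then show ?thesis using eq[OF z] by (simp add: F_def prime_end_map_embed z fz)
  qed
  ultimately show ?thesis unfolding extends_to_prime_end_homeomorphism_def by blast
qed

theorem theorem7p3: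
  fixes D D' :: "complex set" and Q :: "complex \<Rightarrow> real" and f g g' :: "complex \<Rightarrow> complex"
  assumes "bounded_finitely_connected_domain D"
    and "bounded_finitely_connected_domain D'"
    and "circular_uniformization g D"
    and "circular_uniformization g' D'"
    and "Q \<in> borel_measurable lebesgue"
    and "\<And>z. 0 < Q z"
    and "lower_Q_homeomorphism Q D D' f"
    and "\<And>z0. z0 \<in> frontier D \<Longrightarrow> \<exists>\<epsilon>0>0.
           (\<forall>\<epsilon>\<in>{0<..<\<epsilon>0}.
              set_integrable lebesgue (annulus z0 \<epsilon> \<epsilon>0) (\<lambda>z. Q z / (cmod (z - z0))\<^sup>2)) \<and>
           (\<lambda>\<epsilon>. LINT z:annulus z0 \<epsilon> \<epsilon>0|lebesgue. Q z / (cmod (z - z0))\<^sup>2)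
             \<in> o[at_right 0](\<lambda>\<epsilon>. (ln (1 / \<epsilon>))\<^sup>2)"
  shows "extends_to_prime_end_homeomorphism f g D g' D'"
proof -
  have D: "open D" "connected D" "D \<noteq> {}" "bounded D" and D': "open D'"
    using assms(1,2) by (auto simp: bounded_finitely_connected_domain_def)
  have g: "g holomorphic_on D" "inj_on g D" and circ: "bounded_circular_domain (g ` D)"
    using assms(3) by (auto simp: circular_uniformization_def)
  have g': "g' holomorphic_on D'" "inj_on g' D'" and circ': "bounded_circular_domain (g' ` D')"
    using assms(4) by (auto simp: circular_uniformization_def)
  have C: "open (g ` D)" "connected (g ` D)" "bounded (g ` D)"
    using circ by (auto simp: bounded_circular_domain_def)
  have C': "open (g' ` D')" "connected (g' ` D')" "bounded (g' ` D')"
    using circ' by (auto simp: bounded_circular_domain_def)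
  obtain t0 where t0: "connected_sections (g ` D) t0"
    using bounded_circular_domain_connected_sections[OF circ] by metis
  obtain t0' where t0': "connected_sections (g' ` D') t0'"
    using bounded_circular_domain_connected_sections[OF circ'] by metis
  obtain k where k: "homeomorphism D (g ` D) g k"
    using holomorphic_injective_homeomorphism[OF g(1) D(1) g(2)] by metis
  obtain k' where k': "homeomorphism D' (g' ` D') g' k'"
    using holomorphic_injective_homeomorphism[OF g'(1) D' g'(2)] by metis
  obtain z1 where z1: "z1 \<in> D" using D(3) by blast
  have "z1 \<in> closure D" using z1 closure_subset by blast
  then obtain f' where f': "homeomorphism D D' f f'"
    using assms(7) unfolding lower_Q_homeomorphism_def lower_Q_homeomorphism_at_def by blast
  have h: "homeomorphism D (g' ` D') (g' \<circ> f) (f' \<circ> k')"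
    by (rule homeomorphism_compose[OF f' k'])
  have labg: "length_area_bound g D (\<lambda>_. 1) z0 b0" for z0 b0
    by (rule length_area_bound_conformal[OF g(1) D(1) g(2) C(3)])
  have labh: "\<exists>b0. 0 < b0 \<and> length_area_bound (g' \<circ> f) D Q z0 b0 \<and> slow_Q_growth Q z0 b0" if z0: "z0 \<in> frontier D" for z0
  proof -
    obtain \<epsilon>0 where \<epsilon>0: "0 < \<epsilon>0"
      "\<forall>\<epsilon>\<in>{0<..<\<epsilon>0}. set_integrable lebesgue (annulus z0 \<epsilon> \<epsilon>0) (\<lambda>z. Q z / (cmod (z - z0))\<^sup>2)"
      "(\<lambda>\<epsilon>. LINT z:annulus z0 \<epsilon> \<epsilon>0|lebesgue. Q z / (cmod (z - z0))\<^sup>2) \<in> o[at_right 0](\<lambda>\<epsilon>. (ln (1 / \<epsilon>))\<^sup>2)"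
      using assms(8)[OF z0] by blast
    have slow: "slow_Q_growth Q z0 \<epsilon>0"
      using \<epsilon>0 assms(6) by (intro slow_Q_growth_smallo) auto
    \<comment> \<open>The lower \<open>Q\<close> property covers only radii below \<open>d0\<close>,
      so the range of the bound is cut down to the smaller of \<open>\<epsilon>0\<close> and
      \<open>d0\<close>; \<open>d0\<close> is positive because \<open>z0\<close> is not in
      \<open>D\<close>.\<close>
    define d0 where "d0 = (SUP z\<in>D. cmod (z - z0))"
    have z0D: "z0 \<in> closure D" "z0 \<notin> D" using z0 D(1) by (auto simp: frontier_def interior_open)
    have "bdd_above ((\<lambda>z. cmod (z - z0)) ` D)"
    proof -
      have "bounded ((\<lambda>z. z - z0) ` D)" using D(4) by (rule bounded_translation_minus)
      then obtain B where "\<forall>w\<in>(\<lambda>z. z - z0) ` D. cmod w \<le> B" unfolding bounded_iff by blast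
      then show ?thesis by (intro bdd_aboveI2[of _ _ B]) auto
    qed
    then have "cmod (z1 - z0) \<le> d0" unfolding d0_def using z1 by (rule cSUP_upper2) simp
    moreover have "0 < cmod (z1 - z0)" using z1 z0D(2) by auto
    ultimately have d0: "0 < d0" by linarith
    have "lower_Q_homeomorphism_at Q D D' f z0"
      using assms(7) z0D(1) by (simp add: lower_Q_homeomorphism_def)
    then have "length_area_bound (g' \<circ> f) D Q z0 (min \<epsilon>0 d0)"
      by (rule length_area_bound_lower_Q) (use D D' assms g' C' in \<open>auto simp: d0_def\<close>)
    moreover have "slow_Q_growth Q z0 (min \<epsilon>0 d0)" by (rule slow_Q_growth_mono[OF slow]) simp
    ultimately show ?thesis using \<epsilon>0(1) d0 by (intro exI[of _ "min \<epsilon>0 d0"]) simp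
  qed
  have smallg: "small_sections g D z0" for z0
    by (rule small_sections_length_area[OF labg slow_Q_growth_1 zero_less_one k D(1) C(1,3)])
  have smallh: "small_sections (g' \<circ> f) D z0" if "z0 \<in> frontier D" for z0
    using labh[OF that] small_sections_length_area[OF _ _ _ h D(1) C'(1,3)] by blast
  have shrg: "shrinking_circles k (g ` D) \<omega>" if "\<omega> \<in> frontier (g ` D)" for \<omega>
    by (rule shrinking_circles_length_area[OF k D(1,4) C(1) t0 that])
       (use labg slow_Q_growth_1 zero_less_one in blast)
  have shrh: "shrinking_circles (f' \<circ> k') (g' ` D') \<omega>" if "\<omega> \<in> frontier (g' ` D')" for \<omega>
    by (rule shrinking_circles_length_area[OF h D(1,4) C'(1) t0' that]) (use labh in blast)
  \<comment> \<open>Each direction combines shrinking circles for one map with short sections for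
    the other, so both properties are needed for both maps.\<close>
  have uc: "uniformly_continuous_on (g ` D) ((g' \<circ> f) \<circ> k)"
    by (rule uniformly_continuous_transition[OF k h D C(1,3) C' t0 t0' shrg smallh])
  have uc': "uniformly_continuous_on (g' ` D') (g \<circ> (f' \<circ> k'))"
    by (rule uniformly_continuous_transition[OF h k D C'(1,3) C t0' t0 shrh smallg])
  have kD: "k ` g ` D = D" "\<And>z. z \<in> D \<Longrightarrow> k (g z) = z"
    and hD: "(g' \<circ> f) ` D = g' ` D'" "(f' \<circ> k') ` g' ` D' = D"
      "\<And>z. z \<in> D \<Longrightarrow> (f' \<circ> k') ((g' \<circ> f) z) = z" "\<And>w. w \<in> g' ` D' \<Longrightarrow> (g' \<circ> f) ((f' \<circ> k') w) = w"
    using k h unfolding homeomorphism_def by blast+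
  have im: "((g' \<circ> f) \<circ> k) ` (g ` D) = g' ` D'" "(g \<circ> (f' \<circ> k')) ` (g' ` D') = g ` D"
    using kD(1) hD(1,2) by (metis image_comp)+
  obtain \<Phi> \<Psi> where \<Phi>: "homeomorphism (closure (g ` D)) (closure (g' ` D')) \<Phi> \<Psi>"
    "\<And>x. x \<in> g ` D \<Longrightarrow> \<Phi> x = ((g' \<circ> f) \<circ> k) x"
  proof (rule extend_homeomorphism_closure[OF uc im(1) uc' im(2)])
    show "(g \<circ> (f' \<circ> k')) (((g' \<circ> f) \<circ> k) x) = x" if "x \<in> g ` D" for x
      using that kD(2) hD(3) by auto
    show "((g' \<circ> f) \<circ> k) ((g \<circ> (f' \<circ> k')) y) = y" if y: "y \<in> g' ` D'" for y
    proof -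
      have "(f' \<circ> k') y \<in> D" using hD(2) y by blast
      then show ?thesis using kD(2)[of "(f' \<circ> k') y"] hD(4)[OF y] by simp
    qed
  qed blast
  show ?thesis
  proof (rule extends_to_prime_end_homeomorphismI[OF \<Phi>(1)])
    show "f ` D \<subseteq> D'" using f' by (simp add: homeomorphism_def)
    show "\<Phi> (g z) = g' (f z)" if "z \<in> D" for z using \<Phi>(2)[of "g z"] kD(2)[OF that] that by simp
  qed
qed

end
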